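(* Let $\Gamma=(G,\sigma)$ be a $5$-regular orthogonal signed graph, and let $D_G$ be the graph on $V(G)$ in which two distinct vertices are adjacent if and only if they have exactly four common neighbors in $G$. Then one of the following holds. (1) $D_G$ is edgeless and $\Gamma$ is switching equivalent to one of the four signed graphs: (1.1) $\overline{Q_4^+}$; (1.2) the bipartite signed graph of $W(12,5)$; (1.3) $F\square K_2$, where $F$ is the bipartite signed graph of $W(7,4)$; (1.4) $\overline{Q_5}$. (2) $D_G$ contains a triangle and $\Gamma$ is switching equivalent to one of the four signed graphs: (2.1) $T_3^+$; (2.2) $T_6^{\ast}$; (2.3) $T_4\square K_2$; (2.4) $T_4^+$. (3) $D_G$ is a nonempty matching (it has at least one edge and maximum degree $1$) and $\Gamma$ is switching equivalent to a member of one of the three infinite families: (3.1) $T_n\square K_2$ with $n\geqslant 3$, $n\neq 4$; (3.2) $T_n^+$ with $n\geqslant 5$; (3.3) $T_{2n}^{\ast}$ with $n\geqslant 4$.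
   Context: Graphs are finite and simple. A signed graph $\Gamma=(G,\sigma)$ is a graph $G$ with a function $\sigma:E(G)\to\{1,-1\}$. Its signed adjacency matrix $A(\Gamma)$ has entry $\sigma(ij)$ at $(i,j)$ if $ij\in E(G)$ and $0$ otherwise. $\Gamma$ is orthogonal if $G$ is connected and $A(\Gamma)^2=D$, where $D$ is the diagonal matrix of vertex degrees of $G$; it is $k$-regular if $G$ is. Signed graphs $\Gamma,\Gamma'$ are switching equivalent if $A(\Gamma')=P^TA(\Gamma)P$ for some signed permutation matrix $P$ (a permutation matrix with some of its $1$'s replaced by $-1$). A weighing matrix of order $n$ and weight $k$ is an $n\times n$ $(-1,0,1)$-matrix $W$ with $WW^T=kI$. Its bipartite signed graph is the signed graph with signed adjacency matrix $\begin{bmatrix} 0 & W \\ W^T & 0 \end{bmatrix}$. $W(7,4)$: the $7\times7$ circulant matrix with first row $(-1,1,1,0,1,0,0)$. $W(12,5)$: the weighing matrix of order $12$ and weight $5$ whose zero/nonzero pattern is the adjacency matrix of the icosahedron (so the underlying graph of its bipartite signed graph is the bipartite double of the icosahedron). Explicitly, index rows and columns by $\infty,\infty'$ and $i,i'$ for $i\in\mathbb{Z}/5$. Row $\infty$ has $+1$ in every column $i$. Row $i$ has $+1$ in columns $\infty,\,i+1,\,i'$ and $-1$ in columns $i-1,\,(i+1)'$. Row $i'$ has $+1$ in columns $\infty',\,(i+1)',\,i$ and $-1$ in columns $(i-1)',\,i-1$. Row $\infty'$ has $+1$ in every column $i'$. All other entries are $0$. For an orthogonal signed graph $\Gamma$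 with $A=A(\Gamma)$, $\Gamma\square K_2$ is the signed graph with signed adjacency matrix $\begin{bmatrix} A & I \\ I & -A \end{bmatrix}$. The signed hypercube $\overline{Q_n}$ is obtained from the one-vertex graph $K_1$ by applying $\Gamma\mapsto\Gamma\square K_2$ $n$ times. $\overline{Q_4^+}$: the orthogonal signed graph whose underlying graph is the folded hypercube $Q_4^+$, i.e. the $4$-dimensional hypercube on $\{0,1\}^4$ together with an edge joining every pair of antipodal vertices. A representative signature: the edge between $x$ and $x+e_i$ (mod $2$) has sign $(-1)^{x_1+\cdots+x_{i-1}}$, and the edge between $x$ and $x+(1,1,1,1)$ has sign $(-1)^{x_1+x_3}$. $T_n$ ($n\geqslant3$): the signed graph on $\{0,1\}\times\{0,1,\ldots,n-1\}$, second coordinates modulo $n$, in which each $(0,j)$ is joined to $(0,j+1)$ and $(1,j+1)$ with sign $1$, and each $(1,j)$ is joined to $(0,j+1)$ and $(1,j+1)$ with sign $-1$. $T_n^+$ ($n\geqslant3$): $T_n$ together with edges joining $(0,j)$ to $(1,j)$ with sign $1$, for all $j$. $T_{2n}^{\ast}$ ($n\geqslant2$): $T_{2n}$ together with, for $j=0,1,\ldots,n-1$, edges joining $(0,j)$ to $(1,j+n)$ and $(1,j)$ to $(0,j+n)$, all with sign $1$. *)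

theory Defs
  imports "Graph_Theory.Graph_Theory"
begin

section \<open>Integer matrices with arbitrary index sets\<close>

text \<open>
  The entries of a matrix are given by a function of the row and the column index; only
  entries at indices in the relevant index sets are meaningful. Rows and columns need not
  be ordered, so the vertices of a graph can serve as indices.
\<close>

type_synonym ('a, 'b) matrix = "'a \<Rightarrow> 'b \<Rightarrow> int"

definition mat_prod :: "'b set \<Rightarrow> ('a, 'b) matrix \<Rightarrow> ('b, 'c) matrix \<Rightarrow> ('a, 'c) matrix" where
  "mat_prod I A B = (\<lambda>i k. \<Sum>j\<in>I. A i j * B j k)"

definition mat_transpose :: "('a, 'b) matrix \<Rightarrow> ('b, 'a) matrix" where
  "mat_transpose A = (\<lambda>i j. A j i)"

definition permutation_matrix :: "'a set \<Rightarrow> 'b set \<Rightarrow> ('a, 'b) matrix \<Rightarrow> bool" where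
  "permutation_matrix I J P \<longleftrightarrow>
     (\<forall>i\<in>I. \<forall>j\<in>J. P i j \<in> {0, 1}) \<and>
     (\<forall>i\<in>I. \<exists>!j. j \<in> J \<and> P i j = 1) \<and>
     (\<forall>j\<in>J. \<exists>!i. i \<in> I \<and> P i j = 1)"

definition signed_permutation_matrix :: "'a set \<Rightarrow> 'b set \<Rightarrow> ('a, 'b) matrix \<Rightarrow> bool" where
  "signed_permutation_matrix I J P \<longleftrightarrow> permutation_matrix I J (\<lambda>i j. \<bar>P i j\<bar>)"

definition weighing_matrix :: "'a set \<Rightarrow> nat \<Rightarrow> nat \<Rightarrow> ('a, 'a) matrix \<Rightarrow> bool" where
  "weighing_matrix I n k W \<longleftrightarrow>
     finite I \<and> card I = n \<and>
     (\<forall>i\<in>I. \<forall>j\<in>I. W i j \<in> {-1, 0, 1}) \<and>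
     (\<forall>i\<in>I. \<forall>j\<in>I. mat_prod I W (mat_transpose W) i j = (if i = j then int k else 0))"


section \<open>Signed graphs\<close>

text \<open>
  A finite simple graph is a symmetric loop-free digraph (locale \<open>pair_graph\<close>), in which
  every edge is present as two opposite arcs. The signature is a symmetric function on arcs;
  its values on other pairs are irrelevant. The degree of a vertex is its \<open>out_degree\<close>.
\<close>

record 'a signed_graph =
  ugraph :: "'a pair_pre_digraph"
  sign :: "'a \<Rightarrow> 'a \<Rightarrow> int"

definition signed_graph :: "'a signed_graph \<Rightarrow> bool" where
  "signed_graph \<Gamma> \<longleftrightarrow>
     pair_graph (ugraph \<Gamma>) \<and>
     (\<forall>(u, v) \<in> parcs (ugraph \<Gamma>). sign \<Gamma> u v \<in> {1, -1} \<and> sign \<Gamma> u v = sign \<Gamma> v u)"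

definition signed_adj :: "'a signed_graph \<Rightarrow> ('a, 'a) matrix" where
  "signed_adj \<Gamma> = (\<lambda>u v. if (u, v) \<in> parcs (ugraph \<Gamma>) then sign \<Gamma> u v else 0)"

definition k_regular :: "nat \<Rightarrow> 'a pair_pre_digraph \<Rightarrow> bool" where
  "k_regular k G \<longleftrightarrow> (\<forall>v \<in> pverts G. out_degree (with_proj G) v = k)"

text \<open>The library's \<open>connected\<close> includes that there is at least one vertex.\<close>

definition orthogonal :: "'a signed_graph \<Rightarrow> bool" where
  "orthogonal \<Gamma> \<longleftrightarrow>
     connected (with_proj (ugraph \<Gamma>)) \<and>
     (\<forall>u \<in> pverts (ugraph \<Gamma>). \<forall>v \<in> pverts (ugraph \<Gamma>).
        mat_prod (pverts (ugraph \<Gamma>)) (signed_adj \<Gamma>) (signed_adj \<Gamma>) u v =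
          (if u = v then int (out_degree (with_proj (ugraph \<Gamma>)) u) else 0))"

definition switching_equivalent :: "'a signed_graph \<Rightarrow> 'b signed_graph \<Rightarrow> bool" where
  "switching_equivalent \<Gamma> \<Gamma>' \<longleftrightarrow>
     (\<exists>P. signed_permutation_matrix (pverts (ugraph \<Gamma>)) (pverts (ugraph \<Gamma>')) P \<and>
        (\<forall>x \<in> pverts (ugraph \<Gamma>'). \<forall>y \<in> pverts (ugraph \<Gamma>').
           signed_adj \<Gamma>' x y =
             mat_prod (pverts (ugraph \<Gamma>))
               (mat_prod (pverts (ugraph \<Gamma>)) (mat_transpose P) (signed_adj \<Gamma>)) P x y))"

text \<open>The signed graph with a given signed adjacency matrix.\<close>

definition signed_graph_of :: "'a set \<Rightarrow> ('a, 'a) matrix \<Rightarrow> 'a signed_graph" where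
  "signed_graph_of V A =
     \<lparr>ugraph = \<lparr>pverts = V, parcs = {(u, v). u \<in> V \<and> v \<in> V \<and> A u v \<noteq> 0}\<rparr>, sign = A\<rparr>"

text \<open>Addition of edges of sign \<open>1\<close>, each of them given by one of its two arcs.\<close>

definition add_positive_edges :: "'a signed_graph \<Rightarrow> 'a rel \<Rightarrow> 'a signed_graph" where
  "add_positive_edges \<Gamma> F =
     \<lparr>ugraph = \<lparr>pverts = pverts (ugraph \<Gamma>), parcs = parcs (ugraph \<Gamma>) \<union> F \<union> F\<inverse>\<rparr>,
      sign = (\<lambda>u v. if (u, v) \<in> F \<union> F\<inverse> then 1 else sign \<Gamma> u v)\<rparr>"


section \<open>The graph \<open>D\<^sub>G\<close>\<close>

definition common_neighbors :: "'a pair_pre_digraph \<Rightarrow> 'a \<Rightarrow> 'a \<Rightarrow> 'a set" where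
  "common_neighbors G u v = {w \<in> pverts G. (u, w) \<in> parcs G \<and> (v, w) \<in> parcs G}"

definition D_graph :: "'a pair_pre_digraph \<Rightarrow> 'a pair_pre_digraph" where
  "D_graph G =
     \<lparr>pverts = pverts G,
      parcs = {(u, v). u \<in> pverts G \<and> v \<in> pverts G \<and> u \<noteq> v \<and> card (common_neighbors G u v) = 4}\<rparr>"

definition edgeless :: "'a pair_pre_digraph \<Rightarrow> bool" where
  "edgeless H \<longleftrightarrow> parcs H = {}"

definition has_triangle :: "'a pair_pre_digraph \<Rightarrow> bool" where
  "has_triangle H \<longleftrightarrow>
     (\<exists>u v w. u \<noteq> v \<and> v \<noteq> w \<and> u \<noteq> w \<and>
        (u, v) \<in> parcs H \<and> (v, w) \<in> parcs H \<and> (u, w) \<in> parcs H)"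

definition nonempty_matching :: "'a pair_pre_digraph \<Rightarrow> bool" where
  "nonempty_matching H \<longleftrightarrow>
     parcs H \<noteq> {} \<and> (\<forall>v \<in> pverts H. out_degree (with_proj H) v \<le> 1)"


section \<open>Bipartite signed graphs of weighing matrices\<close>

fun bipartite_matrix :: "('a, 'a) matrix \<Rightarrow> ('a + 'a, 'a + 'a) matrix" where
  "bipartite_matrix W (Inl i) (Inr j) = W i j"
| "bipartite_matrix W (Inr i) (Inl j) = mat_transpose W i j"
| "bipartite_matrix W (Inl i) (Inl j) = 0"
| "bipartite_matrix W (Inr i) (Inr j) = 0"

definition bipartite_signed_graph :: "'a set \<Rightarrow> ('a, 'a) matrix \<Rightarrow> ('a + 'a) signed_graph" where
  "bipartite_signed_graph I W = signed_graph_of (I <+> I) (bipartite_matrix W)"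

text \<open>In a circulant matrix the entry at \<open>(i, j)\<close> is the entry at \<open>j - i\<close> of the first row.\<close>

definition W7_4 :: "(nat, nat) matrix" where
  "W7_4 i j = [-1, 1, 1, 0, 1, 0, 0] ! ((j + 7 - i) mod 7)"

lemma weighing_matrix_W7_4: "weighing_matrix {..<7} 7 4 W7_4"
proof -
  have "{..<7::nat} = {0, 1, 2, 3, 4, 5, 6}" by auto
  then show ?thesis
    by (simp add: weighing_matrix_def mat_prod_def mat_transpose_def W7_4_def)
qed

text \<open>\<open>Up i\<close> and \<open>Lo i\<close> are the indices \<open>i\<close> and \<open>i'\<close>; subtracting \<open>1\<close> modulo \<open>5\<close> is adding \<open>4\<close>.\<close>

datatype ico = Infty | Infty' | Up nat | Lo nat

definition ico_indices :: "ico set" where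
  "ico_indices = {Infty, Infty'} \<union> Up ` {..<5} \<union> Lo ` {..<5}"

fun W12_5 :: "(ico, ico) matrix" where
  "W12_5 Infty (Up j) = 1"
| "W12_5 (Up i) Infty = 1"
| "W12_5 (Up i) (Up j) =
     (if j = (i + 1) mod 5 then 1 else if j = (i + 4) mod 5 then -1 else 0)"
| "W12_5 (Up i) (Lo j) =
     (if j = i then 1 else if j = (i + 1) mod 5 then -1 else 0)"
| "W12_5 (Lo i) Infty' = 1"
| "W12_5 (Lo i) (Lo j) =
     (if j = (i + 1) mod 5 then 1 else if j = (i + 4) mod 5 then -1 else 0)"
| "W12_5 (Lo i) (Up j) =
     (if j = i then 1 else if j = (i + 4) mod 5 then -1 else 0)"
| "W12_5 Infty' (Lo j) = 1"
| "W12_5 _ _ = 0"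

lemma weighing_matrix_W12_5: "weighing_matrix ico_indices 12 5 W12_5"
proof -
  have "{..<5::nat} = {0, 1, 2, 3, 4}" by auto
  then have eq: "ico_indices =
      {Infty, Infty', Up 0, Up 1, Up 2, Up 3, Up 4, Lo 0, Lo 1, Lo 2, Lo 3, Lo 4}"
    unfolding ico_indices_def by auto
  show ?thesis
    unfolding eq by (simp add: weighing_matrix_def mat_prod_def mat_transpose_def)
qed


section \<open>The operation \<open>\<Gamma> \<box> K\<^sub>2\<close> and hypercubes\<close>

text \<open>The second component of a vertex selects the block: \<open>False\<close> the first, \<open>True\<close> the second.\<close>

fun box_K2_matrix :: "('a, 'a) matrix \<Rightarrow> ('a \<times> bool, 'a \<times> bool) matrix" where
  "box_K2_matrix A (u, False) (v, False) = A u v"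
| "box_K2_matrix A (u, False) (v, True) = (if u = v then 1 else 0)"
| "box_K2_matrix A (u, True) (v, False) = (if u = v then 1 else 0)"
| "box_K2_matrix A (u, True) (v, True) = - A u v"

definition box_K2 :: "'a signed_graph \<Rightarrow> ('a \<times> bool) signed_graph" where
  "box_K2 \<Gamma> = signed_graph_of (pverts (ugraph \<Gamma>) \<times> UNIV) (box_K2_matrix (signed_adj \<Gamma>))"

text \<open>
  To have all hypercubes in one type, the vertex \<open>(x, b)\<close> of \<open>box_K2 (signed_hypercube n)\<close>
  is renamed to \<open>b # x\<close> in \<open>signed_hypercube (Suc n)\<close>.
\<close>

fun signed_hypercube :: "nat \<Rightarrow> bool list signed_graph" where
  "signed_hypercube 0 = signed_graph_of {[]} (\<lambda>x y. 0)"
| "signed_hypercube (Suc n) =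
     signed_graph_of {b # x | b x. x \<in> pverts (ugraph (signed_hypercube n))}
       (\<lambda>x y. signed_adj (box_K2 (signed_hypercube n)) (tl x, hd x) (tl y, hd y))"

text \<open>
  For given \<open>x\<close> and \<open>y\<close> at most one summand is nonzero. Coordinates are counted from \<open>0\<close>.
\<close>

definition folded_Q4_matrix :: "(bool list, bool list) matrix" where
  "folded_Q4_matrix x y =
     (\<Sum>i<4. if y = x[i := \<not> x ! i] then (-1) ^ (\<Sum>k<i. of_bool (x ! k)) else 0) +
     (if y = map Not x then (-1) ^ (of_bool (x ! 0) + of_bool (x ! 2)) else 0)"

definition folded_Q4 :: "bool list signed_graph" where
  "folded_Q4 = signed_graph_of {x. length x = 4} folded_Q4_matrix"


section \<open>The families \<open>T\<^sub>n\<close>, \<open>T\<^sub>n\<^sup>+\<close> and \<open>T\<^sub>2\<^sub>n\<^sup>*\<close>\<close>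

text \<open>
  For \<open>n \<ge> 3\<close> the two conditions in \<open>T_matrix\<close> exclude each other. Of the two end points of an
  edge between positions \<open>j\<close> and \<open>j + 1\<close>, it is the one at position \<open>j\<close> that determines the sign.
\<close>

fun T_matrix :: "nat \<Rightarrow> (nat \<times> nat, nat \<times> nat) matrix" where
  "T_matrix n (a, i) (b, j) =
     (if j = (i + 1) mod n then (if a = 0 then 1 else -1)
      else if i = (j + 1) mod n then (if b = 0 then 1 else -1)
      else 0)"

definition T :: "nat \<Rightarrow> (nat \<times> nat) signed_graph" where
  "T n = signed_graph_of ({0, 1} \<times> {..<n}) (T_matrix n)"

definition T_plus :: "nat \<Rightarrow> (nat \<times> nat) signed_graph" where
  "T_plus n = add_positive_edges (T n) {((0, j), (1, j)) | j. j < n}"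

text \<open>\<open>T_star n\<close> is \<open>T\<^sub>2\<^sub>n\<^sup>*\<close>.\<close>

definition T_star :: "nat \<Rightarrow> (nat \<times> nat) signed_graph" where
  "T_star n = add_positive_edges (T (2 * n))
     ({((0, j), (1, j + n)) | j. j < n} \<union> {((1, j), (0, j + n)) | j. j < n})"

end

theory Submission
  imports Defs
begin

text \<open>The odd degree drives everything: orthogonality makes the number of common neighbours of
  two distinct vertices even, so it is 0, 2 or 4. Most contradictions below are five common
  neighbours or a sixth neighbour. Four common neighbours contain a positive 4-cycle. Orthogonality
  at one side of it forces another one beyond, and the chain obtained must close up into a copy of
  \<open>T n\<close> with n at least 3. This accounts for four of the five edges at each of its
  vertices. The fifth edges stay inside the pairs, join opposite pairs or lead to a second copy;
  hence the three families. If four never occurs, a vertex acts on the pairs of neighbours of a base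
  vertex as an oriented cycle in the complete graph on five points, and the lengths that occur (some
  5-cycle, some 4-cycle, only triangles) tell the graphs apart. The obstacle is that this
  reconstruction only sees a bipartite graph, of which the actual graph may be a quotient
  identifying the two sides. Since 16 vertices are always found around the base vertex, this can
  only happen for the 5-cube, and its quotient is the folded cube.\<close>

definition sgnb :: "bool \<Rightarrow> int" where
  "sgnb b = (if b then -1 else 1)"

definition neg :: "'a \<times> bool \<Rightarrow> 'a \<times> bool" where
  "neg p = (fst p, \<not> snd p)"

lemma fst_neg [simp]: "fst (neg p) = fst p"
  and neg_neg [simp]: "neg (neg p) = p"
  and neg_neq [simp]: "neg p \<noteq> p" "p \<noteq> neg p"
  by (auto simp: neg_def prod_eq_iff)

lemma fst_eq_imp: "fst p = fst q \<Longrightarrow> p = q \<or> p = neg q"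
  by (auto simp: neg_def prod_eq_iff)

lemma sgnb_cases: "sgnb b = 1 \<or> sgnb b = -1"
  by (simp add: sgnb_def)

lemma sgnb_square [simp]: "sgnb b * sgnb b = 1"
  by (simp add: sgnb_def)

lemma sgnb_not [simp]: "sgnb (\<not> b) = - sgnb b"
  by (simp add: sgnb_def)

lemma sgnb_neq_0 [simp]: "sgnb b \<noteq> 0"
  by (simp add: sgnb_def)

section \<open>Signed vertices, stars and orthogonality\<close>

locale ortho5 =
  fixes V :: "'a set" and A :: "'a \<Rightarrow> 'a \<Rightarrow> int"
  assumes finite_V: "finite V"
    and V_nonempty: "V \<noteq> {}"
    and A_sym: "A x y = A y x"
    and A_diag [simp]: "A x x = 0"
    and A_vals: "A x y \<in> {-1, 0, 1}"
    and A_supp: "A x y \<noteq> 0 \<Longrightarrow> x \<in> V"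
    and A_deg: "x \<in> V \<Longrightarrow> card {y. A x y \<noteq> 0} = 5"
    and A_orth: "x \<in> V \<Longrightarrow> y \<in> V \<Longrightarrow> x \<noteq> y \<Longrightarrow> (\<Sum>z\<in>V. A x z * A y z) = 0"
    and A_conn: "S \<subseteq> V \<Longrightarrow> S \<noteq> {} \<Longrightarrow> (\<And>x y. x \<in> S \<Longrightarrow> A x y \<noteq> 0 \<Longrightarrow> y \<in> S) \<Longrightarrow> S = V"
begin

text \<open>
  A pair of a vertex and a Boolean is a vertex with a sign (\<open>True\<close> for \<open>-1\<close>), and \<open>B\<close> is the
  adjacency matrix on such signed vertices. Choosing the sign of a new vertex when it is
  introduced replaces switching.
\<close>

definition B :: "'a \<times> bool \<Rightarrow> 'a \<times> bool \<Rightarrow> int" where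
  "B p q = sgnb (snd p) * sgnb (snd q) * A (fst p) (fst q)"

lemma B_sym: "B p q = B q p"
  by (simp add: B_def A_sym[of "fst p"])

lemma B_neg [simp]: "B (neg p) q = - B p q" "B p (neg q) = - B p q"
  by (simp_all add: B_def neg_def)

lemma B_vals: "B p q = -1 \<or> B p q = 0 \<or> B p q = 1"
  using A_vals[of "fst p" "fst q"] sgnb_cases[of "snd p"] sgnb_cases[of "snd q"]
  by (auto simp: B_def)

lemma B_self: "fst p = fst q \<Longrightarrow> B p q = 0"
  by (simp add: B_def)

lemma B_self' [simp]: "B p p = 0"
  by (simp add: B_self)

lemma B_0_iff: "B p q = 0 \<longleftrightarrow> A (fst p) (fst q) = 0"
  by (simp add: B_def)

lemma B_fst_cong: "fst q = fst q' \<Longrightarrow> B p q = 0 \<longleftrightarrow> B p q' = 0"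
  by (simp add: B_0_iff)

lemma B_in_V: "B p q \<noteq> 0 \<Longrightarrow> fst p \<in> V" "B p q \<noteq> 0 \<Longrightarrow> fst q \<in> V"
  using A_supp[of "fst p" "fst q"] A_supp[of "fst q" "fst p"] A_sym[of "fst p" "fst q"]
  by (auto simp: B_0_iff)

lemma B_normalize: "B p q \<noteq> 0 \<Longrightarrow> \<exists>q'. fst q' = fst q \<and> B p q' = 1"
  using B_vals[of p q] by (metis B_neg(2) fst_neg minus_minus)

lemma abs_B: "\<bar>B p q\<bar> = (if B p q = 0 then 0 else 1)"
  using B_vals[of p q] by auto

text \<open>The whole neighbourhood of \<open>u\<close>, with signs chosen such that the row of
  \<open>u\<close> is constantly 1 on it. It is a list so that single neighbours can be named by
  pattern.\<close>

definition star :: "'a \<times> bool \<Rightarrow> ('a \<times> bool) list \<Rightarrow> bool" where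
  "star u xs \<longleftrightarrow> length xs = 5 \<and> distinct (map fst xs) \<and> (\<forall>a\<in>set xs. B u a = 1)"

lemma finite_nbrs: "finite {y. A x y \<noteq> 0}"
  by (rule finite_subset[OF _ finite_V]) (use A_supp A_sym in force)

lemma star_nbrs:
  assumes "star u xs"
  shows "{y. A (fst u) y \<noteq> 0} = fst ` set xs"
proof -
  have sub: "fst ` set xs \<subseteq> {y. A (fst u) y \<noteq> 0}"
  proof clarsimp
    fix a b assume "(a, b) \<in> set xs" "A (fst u) a = 0"
    then show False using assms B_0_iff[of u "(a, b)"] by (force simp: star_def)
  qed
  have "card (fst ` set xs) = 5"
    using assms distinct_card[of "map fst xs"] by (simp add: star_def)
  moreover have "fst u \<in> V"
    using assms B_in_V(1)[of u "hd xs"] by (cases xs) (auto simp: star_def)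
  ultimately show ?thesis
    using card_subset_eq[OF finite_nbrs sub] A_deg by simp
qed

lemma star_mem: "star u xs \<Longrightarrow> B u y \<noteq> 0 \<Longrightarrow> fst y \<in> fst ` set xs"
  using star_nbrs[of u xs] by (auto simp: B_0_iff)

lemma star_in_V: "star u xs \<Longrightarrow> fst u \<in> V"
  using B_in_V(1)[of u "hd xs"] by (cases xs) (auto simp: star_def)

text \<open>The normalized signs absorb the row of \<open>u\<close>, so orthogonality to the row of
  \<open>y\<close> becomes a plain zero sum without products.\<close>

lemma star_orth:
  assumes st: "star u xs" and ne: "fst y \<noteq> fst u"
  shows "(\<Sum>a\<leftarrow>xs. B y a) = 0"
proof (cases "fst y \<in> V")
  case False
  then have "B y a = 0" for a using B_in_V by blast
  then show ?thesis by simp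
next
  case True
  let ?u = "fst u" and ?y = "fst y"
  have "0 = (\<Sum>z\<in>V. A ?u z * A ?y z)"
    using A_orth[of ?u ?y] ne True star_in_V[OF st] by simp
  also have "\<dots> = (\<Sum>z\<in>fst ` set xs. A ?u z * A ?y z)"
    unfolding star_nbrs[OF st, symmetric]
    by (rule sum.mono_neutral_right) (use A_supp A_sym finite_V in force)+
  also have "\<dots> = (\<Sum>a\<in>set xs. A ?u (fst a) * A ?y (fst a))"
    using st by (subst sum.reindex) (auto simp: star_def distinct_map)
  also have "\<dots> = (\<Sum>a\<in>set xs. sgnb (snd u) * sgnb (snd y) * B y a)"
  proof (rule sum.cong[OF refl])
    fix a assume "a \<in> set xs"
    then have "sgnb (snd u) * sgnb (snd a) * A ?u (fst a) = 1"
      using st by (simp add: star_def B_def)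
    then show "A ?u (fst a) * A ?y (fst a) = sgnb (snd u) * sgnb (snd y) * B y a"
      using sgnb_cases[of "snd u"] sgnb_cases[of "snd a"] sgnb_cases[of "snd y"]
      by (auto simp: B_def)
  qed
  also have "\<dots> = sgnb (snd u) * sgnb (snd y) * (\<Sum>a\<in>set xs. B y a)"
    by (simp add: sum_distrib_left)
  finally have "(\<Sum>a\<in>set xs. B y a) = 0" by simp
  then show ?thesis
    using st by (simp add: star_def sum_list_distinct_conv_sum_set distinct_map)
qed

text \<open>Known neighbours can be put in front, and the missing ones are signed afterwards by
  \<open>B_normalize\<close>.\<close>

lemma star_extend:
  assumes "fst u \<in> V" and d: "distinct (map fst xs)" and B: "\<forall>a\<in>set xs. B u a = 1"
  shows "length xs \<le> 5 \<and> (\<exists>ys. length ys = 5 - length xs \<and> star u (xs @ ys))"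
proof -
  let ?N = "{y. A (fst u) y \<noteq> 0}"
  have card: "card ?N = 5" using A_deg assms(1) .
  have sub: "fst ` set xs \<subseteq> ?N"
  proof
    fix z assume "z \<in> fst ` set xs"
    then obtain a where "a \<in> set xs" "z = fst a" by blast
    then show "z \<in> ?N" using B B_0_iff[of u a] by simp
  qed
  have cx: "card (fst ` set xs) = length xs"
    using d distinct_card[of "map fst xs"] by simp
  have le: "length xs \<le> 5" using card_mono[OF finite_nbrs sub] card cx by simp
  obtain zs where zs: "set zs = ?N - fst ` set xs" "distinct zs"
    using finite_distinct_list[of "?N - fst ` set xs"] finite_nbrs by auto
  have lz: "length zs = 5 - length xs"
    using zs distinct_card[of zs] card_Diff_subset[OF _ sub] card cx by simp
  define g where "g z = (SOME q. fst q = z \<and> B u q = 1)" for z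
  have g: "fst (g z) = z \<and> B u (g z) = 1" if "A (fst u) z \<noteq> 0" for z
  proof -
    have "B u (z, False) \<noteq> 0" using that by (simp add: B_0_iff)
    from B_normalize[OF this] have "\<exists>q. fst q = z \<and> B u q = 1" by simp
    then show ?thesis unfolding g_def by (rule someI_ex)
  qed
  have gz: "fst (g z) = z" "B u (g z) = 1" if "z \<in> set zs" for z
    using g[of z] that zs(1) by auto
  have "map fst (map g zs) = zs"
    using gz by (simp add: map_idI)
  then have "distinct (map fst (xs @ map g zs))"
    using d zs by auto
  moreover have "\<forall>a\<in>set (xs @ map g zs). B u a = 1"
    using B gz by auto
  ultimately have "star u (xs @ map g zs)"
    unfolding star_def using le lz by simp
  then show ?thesis using le lz by (intro conjI exI[of _ "map g zs"]) auto
qed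

lemma star_exists: "fst u \<in> V \<Longrightarrow> \<exists>xs. star u xs"
  using star_extend[of u "[]"] by auto

lemma star_perm: "star u xs \<Longrightarrow> mset ys = mset xs \<Longrightarrow> star u ys"
  unfolding star_def by (metis distinct_map mset_eq_imp_distinct_iff mset_eq_length mset_eq_setD mset_map)

lemma star_zero: "star u xs \<Longrightarrow> fst y \<notin> fst ` set xs \<Longrightarrow> B u y = 0"
  using star_mem by blast

text \<open>Five entries 1 or -1 have an odd sum, which cannot be 0.\<close>

lemma not_all_common:
  assumes st: "star u [a, b, c, d, e]" and "fst y \<noteq> fst u"
  shows "B y a = 0 \<or> B y b = 0 \<or> B y c = 0 \<or> B y d = 0 \<or> B y e = 0"
proof (rule ccontr)
  assume "\<not> ?thesis"
  then have "odd (B y x)" if "x \<in> {a, b, c, d, e}" for x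
    using B_vals[of y x] that by auto
  then have "odd (\<Sum>x\<leftarrow>[a, b, c, d, e]. B y x)" by simp
  then show False unfolding star_orth[OF assms] by simp
qed

lemma list5: "length xs = 5 \<Longrightarrow> \<exists>a b c d e. xs = [a, b, c, d, e]"
  by (auto simp: numeral_eq_Suc length_Suc_conv)

lemma card_common:
  assumes "star u xs"
  shows "int (card {z. A (fst u) z \<noteq> 0 \<and> A (fst y) z \<noteq> 0}) = (\<Sum>a\<leftarrow>xs. \<bar>B y a\<bar>)"
proof -
  have inj: "inj_on fst (set xs)" and d: "distinct xs"
    using assms by (auto simp: star_def distinct_map)
  have "{z. A (fst u) z \<noteq> 0 \<and> A (fst y) z \<noteq> 0} = fst ` {a\<in>set xs. B y a \<noteq> 0}"
    using star_nbrs[OF assms] by (auto simp: B_0_iff)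
  then have "card {z. A (fst u) z \<noteq> 0 \<and> A (fst y) z \<noteq> 0} = card {a\<in>set xs. B y a \<noteq> 0}"
    using inj by (metis (no_types, lifting) card_image inj_on_subset mem_Collect_eq subsetI)
  moreover have "int (card {a\<in>set xs. B y a \<noteq> 0}) = (\<Sum>a\<in>set xs. \<bar>B y a\<bar>)"
    by (simp add: abs_B sum.If_cases Int_def)
  ultimately show ?thesis
    using d by (simp add: sum_list_distinct_conv_sum_set)
qed

section \<open>Recognizing a matrix from its nonzero entries\<close>

lemma signed_image_nbrs:
  assumes "card J \<ge> 5" "finite J" "inj_on (fst \<circ> f) J" "\<And>j. j \<in> J \<Longrightarrow> B u (f j) \<noteq> 0"
  shows "{y. A (fst u) y \<noteq> 0} = fst ` f ` J"
proof -
  have sub: "fst ` f ` J \<subseteq> {y. A (fst u) y \<noteq> 0}"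
    using assms(4) by (auto simp: B_0_iff)
  have "card (fst ` f ` J) = card J"
    using assms(3) card_image[of "fst \<circ> f" J] by (simp add: image_comp)
  moreover have "fst u \<in> V"
    using assms(1,4) B_in_V(1) by (metis card.empty ex_in_conv not_numeral_le_zero)
  ultimately show ?thesis
    using card_seteq[OF finite_nbrs sub] A_deg assms(1) by simp
qed

text \<open>
  To recognize a matrix \<open>M\<close> it suffices to find the edges of \<open>M\<close>: as every row of \<open>M\<close> has at
  least five nonzero entries, the image is closed under adjacency. If \<open>M\<close> is bipartite and the
  two sides are not known to have disjoint images, they may also coincide.
\<close>

lemma recognize_bipartite:
  fixes s :: "'b \<Rightarrow> bool"
  assumes fin: "finite I" and ne: "I \<noteq> {}"
    and M: "\<And>i j. i \<in> I \<Longrightarrow> j \<in> I \<Longrightarrow> M i j \<noteq> 0 \<Longrightarrow> s i \<noteq> s j \<and> B (f i) (f j) = M i j"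
    and card: "\<And>i. i \<in> I \<Longrightarrow> card {j\<in>I. M i j \<noteq> 0} \<ge> 5"
    and inj: "\<And>b. inj_on (fst \<circ> f) {i\<in>I. s i = b}"
  shows "inj_on (fst \<circ> f) I \<or> (\<forall>b. V = fst ` f ` {i\<in>I. s i = b})"
proof (rule disjCI)
  assume "\<not> (\<forall>b. V = fst ` f ` {i\<in>I. s i = b})"
  then obtain b where b: "V \<noteq> fst ` f ` {i\<in>I. s i = b}" by blast
  have N: "{y. A (fst (f i)) y \<noteq> 0} \<subseteq> fst ` f ` {j\<in>I. s j \<noteq> s i}" if "i \<in> I" for i
  proof -
    have sub: "{j\<in>I. M i j \<noteq> 0} \<subseteq> {j\<in>I. s j = (\<not> s i)}"
      using M that by blast
    have "{y. A (fst (f i)) y \<noteq> 0} = fst ` f ` {j\<in>I. M i j \<noteq> 0}"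
      using signed_image_nbrs[of "{j\<in>I. M i j \<noteq> 0}" f "f i"] card[OF that] fin M that
        inj_on_subset[OF inj sub] by simp
    then show ?thesis using sub by blast
  qed
  define P where "P c = fst ` f ` {i\<in>I. s i = c}" for c
  have PV: "P c \<subseteq> V" for c
  proof
    fix x assume "x \<in> P c"
    then obtain i where i: "i \<in> I" "x = fst (f i)" by (auto simp: P_def)
    then obtain j where "j \<in> I" "M i j \<noteq> 0"
      using card[OF i(1)] by (metis (mono_tags, lifting) Collect_empty_eq card.empty not_numeral_le_zero)
    then show "x \<in> V" using M[OF i(1)] i B_in_V(1)[of "f i" "f j"] by metis
  qed
  have step: "y \<in> P (\<not> c)" if "x \<in> P c" "A x y \<noteq> 0" for x y c
    using that N by (force simp: P_def)
  have "P True \<inter> P False = {}"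
  proof (rule ccontr)
    assume ne: "P True \<inter> P False \<noteq> {}"
    \<comment> \<open>Adjacency exchanges the two images, so their intersection is closed under it
      and, if nonempty, is everything by connectedness.\<close>
    have "P True \<inter> P False = V"
      by (rule A_conn) (use PV ne step[of _ True] step[of _ False] in auto)
    then have "P b = V" using PV[of b] by (cases b) auto
    then show False using b by (simp add: P_def)
  qed
  note disj = this
  show "inj_on (fst \<circ> f) I"
  proof (rule inj_onI)
    fix i j assume i: "i \<in> I" and j: "j \<in> I" and eq: "(fst \<circ> f) i = (fst \<circ> f) j"
    have "s i = s j"
    proof (rule ccontr)
      assume "s i \<noteq> s j"
      moreover have "fst (f i) \<in> P (s i)" "fst (f j) \<in> P (s j)"
        using i j by (auto simp: P_def)
      ultimately show False using disj eq by (cases "s i"; cases "s j") auto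
    qed
    then show "i = j"
      using inj_onD[OF inj[of "s j"] eq] i j by simp
  qed
qed

lemma recognize:
  assumes fin: "finite I" and ne: "I \<noteq> {}"
    and inj: "inj_on (fst \<circ> f) I"
    and M: "\<And>i j. i \<in> I \<Longrightarrow> j \<in> I \<Longrightarrow> M i j \<noteq> 0 \<Longrightarrow> B (f i) (f j) = M i j"
    and card: "\<And>i. i \<in> I \<Longrightarrow> card {j\<in>I. M i j \<noteq> 0} \<ge> 5"
  shows "fst ` f ` I = V" and "i \<in> I \<Longrightarrow> j \<in> I \<Longrightarrow> B (f i) (f j) = M i j"
proof -
  have N: "{y. A (fst (f i)) y \<noteq> 0} = fst ` f ` {j\<in>I. M i j \<noteq> 0}" if "i \<in> I" for i
    using signed_image_nbrs[of "{j\<in>I. M i j \<noteq> 0}" f "f i"] card[OF that] fin M that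
      inj_on_subset[OF inj, of "{j\<in>I. M i j \<noteq> 0}"] by simp
  show "fst ` f ` I = V"
  proof (rule A_conn)
    show "fst ` f ` I \<subseteq> V"
    proof clarsimp
      fix i assume "i \<in> I"
      then obtain j where "j \<in> I" "M i j \<noteq> 0"
        using card by (metis (mono_tags, lifting) Collect_empty_eq card.empty not_numeral_le_zero)
      then show "fst (f i) \<in> V" using M[OF \<open>i \<in> I\<close>] B_in_V(1)[of "f i" "f j"] by metis
    qed
    fix x y assume "x \<in> fst ` f ` I" "A x y \<noteq> 0"
    then obtain i where i: "i \<in> I" "y \<in> {y. A (fst (f i)) y \<noteq> 0}" by auto
    then show "y \<in> fst ` f ` I" unfolding N[OF i(1)] by auto
  qed (use ne in simp)
  assume i: "i \<in> I" and j: "j \<in> I"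
  show "B (f i) (f j) = M i j"
  proof (cases "M i j = 0")
    case True
    have "B (f i) (f j) = 0"
    proof (rule ccontr)
      assume "B (f i) (f j) \<noteq> 0"
      then have "fst (f j) \<in> fst ` f ` {j\<in>I. M i j \<noteq> 0}"
        using N[OF i] by (auto simp: B_0_iff)
      then obtain k where "k \<in> I" "M i k \<noteq> 0" "fst (f j) = fst (f k)" by blast
      then show False using True inj_onD[OF inj, of j k] j by auto
    qed
    then show ?thesis using True by simp
  qed (use M i j in blast)
qed

end

section \<open>Between signed graphs and matrices\<close>

lemma switching_equivalentI:
  assumes bij: "bij_betw (fst \<circ> f) (pverts (ugraph \<Gamma>')) (pverts (ugraph \<Gamma>))"
    and fin: "finite (pverts (ugraph \<Gamma>))"
    and A: "\<And>i j. i \<in> pverts (ugraph \<Gamma>') \<Longrightarrow> j \<in> pverts (ugraph \<Gamma>') \<Longrightarrow>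
      signed_adj \<Gamma>' i j = sgnb (snd (f i)) * sgnb (snd (f j)) * signed_adj \<Gamma> (fst (f i)) (fst (f j))"
  shows "switching_equivalent \<Gamma> \<Gamma>'"
proof -
  let ?I = "pverts (ugraph \<Gamma>')" and ?V = "pverts (ugraph \<Gamma>)"
  define P where "P x i = (if fst (f i) = x then sgnb (snd (f i)) else 0)" for x i
  have inV: "fst (f i) \<in> ?V" if "i \<in> ?I" for i
    using bij that by (auto simp: bij_betw_def)
  have "signed_permutation_matrix ?V ?I P"
    unfolding signed_permutation_matrix_def permutation_matrix_def
  proof (intro conjI ballI)
    fix x assume "x \<in> ?V"
    then have "x \<in> (fst \<circ> f) ` ?I" using bij by (simp add: bij_betw_def)
    then obtain i where "i \<in> ?I" "fst (f i) = x" by auto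
    moreover have "inj_on (fst \<circ> f) ?I" using bij by (simp add: bij_betw_def)
    ultimately show "\<exists>!j. j \<in> ?I \<and> \<bar>P x j\<bar> = 1"
      by (intro ex1I[of _ i]) (auto simp: P_def sgnb_def inj_on_def split: if_splits)
  qed (use inV in \<open>auto simp: P_def sgnb_def split: if_splits\<close>)
  moreover have "signed_adj \<Gamma>' x y =
      mat_prod ?V (mat_prod ?V (mat_transpose P) (signed_adj \<Gamma>)) P x y"
    if x: "x \<in> ?I" and y: "y \<in> ?I" for x y
  proof -
    have col: "(\<Sum>z\<in>?V. g z * P z i) = g (fst (f i)) * sgnb (snd (f i))" if "i \<in> ?I" for g i
    proof -
      have "(\<Sum>z\<in>?V. g z * P z i) = (\<Sum>z\<in>?V. if z = fst (f i) then g z * sgnb (snd (f i)) else 0)"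
        by (rule sum.cong) (auto simp: P_def)
      then show ?thesis using fin inV[OF that] by simp
    qed
    have row: "mat_prod ?V (mat_transpose P) (signed_adj \<Gamma>) x z =
        sgnb (snd (f x)) * signed_adj \<Gamma> (fst (f x)) z" for z
      using col[OF x, of "\<lambda>w. signed_adj \<Gamma> w z"]
      by (simp add: mat_prod_def mat_transpose_def mult.commute)
    show ?thesis
      unfolding A[OF x y] mat_prod_def[of ?V "mat_prod _ _ _"] row col[OF y] by simp
  qed
  ultimately show ?thesis
    unfolding switching_equivalent_def by blast
qed

lemma ortho5_signed_adj:
  fixes \<Gamma> :: "'a signed_graph"
  assumes sg: "signed_graph \<Gamma>" and orth: "orthogonal \<Gamma>" and reg: "k_regular 5 (ugraph \<Gamma>)"
  shows "ortho5 (pverts (ugraph \<Gamma>)) (signed_adj \<Gamma>)"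
proof -
  let ?G = "ugraph \<Gamma>"
  interpret G: pair_graph ?G using sg by (simp add: signed_graph_def)
  have val: "sign \<Gamma> x y \<in> {1, -1}" "sign \<Gamma> x y = sign \<Gamma> y x" if "(x, y) \<in> parcs ?G" for x y
    using sg that by (auto simp: signed_graph_def)
  have symG: "(y, x) \<in> parcs ?G" if "(x, y) \<in> parcs ?G" for x y
    using G.sym_arcs that by (simp add: symmetric_def sym_def)
  have A0: "signed_adj \<Gamma> x y \<noteq> 0 \<longleftrightarrow> (x, y) \<in> parcs ?G" for x y
    using val[of x y] by (auto simp: signed_adj_def)
  have deg: "out_degree (with_proj ?G) x = card {y. (x, y) \<in> parcs ?G}" for x
  proof -
    have "out_arcs (with_proj ?G) x = Pair x ` {y. (x, y) \<in> parcs ?G}"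
      by (auto simp: out_arcs_def)
    then show ?thesis
      unfolding out_degree_def by (simp add: card_image inj_on_def)
  qed
  show ?thesis
  proof
    show "finite (pverts ?G)" by (rule G.pair_finite_verts)
    show "pverts ?G \<noteq> {}"
      using orth unfolding orthogonal_def connected_def strongly_connected_def
      by (auto simp: mk_symmetric_def)
    show "signed_adj \<Gamma> x y = signed_adj \<Gamma> y x" for x y
      using symG[of x y] symG[of y x] val(2)[of x y] by (auto simp: signed_adj_def)
    show "signed_adj \<Gamma> x x = 0" for x
      using G.no_loops by (force simp: signed_adj_def)
    show "signed_adj \<Gamma> x y \<in> {-1, 0, 1}" for x y
      using val(1)[of x y] by (auto simp: signed_adj_def)
    show "x \<in> pverts ?G" if "signed_adj \<Gamma> x y \<noteq> 0" for x y
      using that A0 G.in_arcsD1 by blast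
    show "card {y. signed_adj \<Gamma> x y \<noteq> 0} = 5" if "x \<in> pverts ?G" for x
      using that reg by (simp add: A0 deg k_regular_def)
    show "(\<Sum>z\<in>pverts ?G. signed_adj \<Gamma> x z * signed_adj \<Gamma> y z) = 0"
      if "x \<in> pverts ?G" "y \<in> pverts ?G" "x \<noteq> y" for x y
    proof -
      have "signed_adj \<Gamma> y z = signed_adj \<Gamma> z y" for z
        using symG[of z y] symG[of y z] val(2)[of y z] by (auto simp: signed_adj_def)
      then show ?thesis
        using orth that by (simp add: orthogonal_def mat_prod_def)
    qed
    fix S assume S: "S \<subseteq> pverts ?G" "S \<noteq> {}"
      and cl: "\<And>x y. x \<in> S \<Longrightarrow> signed_adj \<Gamma> x y \<noteq> 0 \<Longrightarrow> y \<in> S"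
    from S obtain x where x: "x \<in> S" by blast
    have "y \<in> S" if y: "y \<in> pverts ?G" for y
    proof -
      \<comment> \<open>The library defines connectedness through the symmetric closure; for a
        symmetric digraph reachability there is reachability in the graph itself.\<close>
      have "x \<rightarrow>\<^sup>*\<^bsub>mk_symmetric (with_proj ?G)\<^esub> y"
        using orth x y S by (auto simp: orthogonal_def connected_def strongly_connected_def mk_symmetric_def with_proj_def)
      then have "x \<rightarrow>\<^sup>*\<^bsub>with_proj ?G\<^esub> y"
        using G.reachable_mk_symmetric_eq[OF G.sym_arcs] by simp
      then have "(x, y) \<in> (parcs ?G)\<^sup>*"
        by (auto simp: reachable_def intro: rtrancl_on_rtranclI)
      then show ?thesis
        by (induction rule: rtrancl_induct) (use x cl A0 in auto)
    qed
    then show "S = pverts ?G" using S by blast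
  qed
qed

section \<open>Parity of common neighbourhoods and positive 4-cycles\<close>

context ortho5
begin

text \<open>A signed bijection takes the place of the signed permutation matrix until the very
  end.\<close>

definition equiv_to :: "'b signed_graph \<Rightarrow> bool" where
  "equiv_to \<Gamma>' \<longleftrightarrow> (\<exists>f. bij_betw (fst \<circ> f) (pverts (ugraph \<Gamma>')) V \<and>
     (\<forall>i\<in>pverts (ugraph \<Gamma>'). \<forall>j\<in>pverts (ugraph \<Gamma>'). signed_adj \<Gamma>' i j = B (f i) (f j)))"

lemma equiv_toI:
  assumes "finite (pverts (ugraph \<Gamma>'))" "pverts (ugraph \<Gamma>') \<noteq> {}"
    and inj: "inj_on (fst \<circ> f) (pverts (ugraph \<Gamma>'))"
    and M: "\<And>i j. i \<in> pverts (ugraph \<Gamma>') \<Longrightarrow> j \<in> pverts (ugraph \<Gamma>') \<Longrightarrow> signed_adj \<Gamma>' i j \<noteq> 0 \<Longrightarrow>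
      B (f i) (f j) = signed_adj \<Gamma>' i j"
    and "\<And>i. i \<in> pverts (ugraph \<Gamma>') \<Longrightarrow> card {j\<in>pverts (ugraph \<Gamma>'). signed_adj \<Gamma>' i j \<noteq> 0} \<ge> 5"
  shows "equiv_to \<Gamma>'"
  unfolding equiv_to_def
proof (intro exI[of _ f] conjI ballI)
  show "bij_betw (fst \<circ> f) (pverts (ugraph \<Gamma>')) V"
    using inj recognize(1)[OF assms] by (simp add: bij_betw_def image_comp)
qed (use recognize(2)[OF assms] in simp)

lemma deg_le:
  assumes "\<And>y. y \<in> S \<Longrightarrow> A x y \<noteq> 0"
  shows "finite S" "card S \<le> 5"
proof -
  have S: "S \<subseteq> {y. A x y \<noteq> 0}" using assms by blast
  then show "finite S" using finite_nbrs finite_subset by blast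
  show "card S \<le> 5"
  proof (cases "S = {}")
    case False
    then have "x \<in> V" using assms A_supp by blast
    then show ?thesis using card_mono[OF finite_nbrs S] A_deg by simp
  qed simp
qed

text \<open>Orthogonality modulo 2: an even number of the five entries is nonzero. The chain is an
  exclusive or, a purely propositional form that combines well with membership facts.\<close>

lemma star_parity:
  assumes "star u [a, b, c, d, e]" and "fst y \<noteq> fst u"
  shows "((((B y a \<noteq> 0) \<noteq> (B y b \<noteq> 0)) \<noteq> (B y c \<noteq> 0)) \<noteq> (B y d \<noteq> 0)) = (B y e \<noteq> 0)"
proof -
  have "even (B y z) \<longleftrightarrow> B y z = 0" for z using B_vals[of y z] by auto
  moreover have "even (B y a + (B y b + (B y c + (B y d + B y e))))"
    using star_orth[OF assms] by simp
  ultimately show ?thesis by (auto simp: even_add)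
qed

lemma B_nz_fst: "B p q \<noteq> 0 \<Longrightarrow> fst p \<noteq> fst q"
  using B_self by blast

definition N :: "'a \<Rightarrow> 'a set" where
  "N x = {y. A x y \<noteq> 0}"

lemma N_sym: "y \<in> N x \<longleftrightarrow> x \<in> N y"
  by (simp add: N_def A_sym[of x])

lemma N_irrefl [simp]: "x \<notin> N x"
  by (simp add: N_def)

lemma B_N: "B p q \<noteq> 0 \<longleftrightarrow> fst q \<in> N (fst p)"
  by (simp add: N_def B_0_iff)

lemma N_in_V: "y \<in> N x \<Longrightarrow> x \<in> V" "y \<in> N x \<Longrightarrow> y \<in> V"
  using A_supp[of x y] A_supp[of y x] A_sym[of x y] by (auto simp: N_def)

lemma N_le: "S \<subseteq> N x \<Longrightarrow> card S \<le> 5"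
  using deg_le(2)[of S x] by (auto simp: N_def)

lemma N_eq:
  assumes "S \<subseteq> N x" "card S = 5"
  shows "N x = S"
proof -
  from assms(2) obtain y where "y \<in> S" by fastforce
  then have "x \<in> V" using assms(1) N_in_V by blast
  then show ?thesis
    using card_subset_eq[of "N x" S] assms A_deg finite_nbrs by (simp add: N_def)
qed

lemma N_fifth:
  assumes "S \<subseteq> N x" "card S = 4"
  obtains z where "z \<notin> S" "N x = insert z S"
proof -
  from assms(2) obtain y where "y \<in> S" by fastforce
  then have "x \<in> V" using assms(1) N_in_V by blast
  then have c: "card (N x) = 5" by (simp add: N_def A_deg)
  then have "S \<noteq> N x" using assms(2) by auto
  then obtain z where z: "z \<in> N x" "z \<notin> S" using assms(1) by blast
  have "card (insert z S) = 5"
    using z(2) assms(2) card_ge_0_finite[of S] by simp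
  then show ?thesis using that z N_eq[of "insert z S" x] assms(1) by blast
qed

lemma N_parity:
  assumes "N x = {a, b, c, d, e}" "distinct [a, b, c, d, e]" and "x \<noteq> y"
  shows "((((a \<in> N y) \<noteq> (b \<in> N y)) \<noteq> (c \<in> N y)) \<noteq> (d \<in> N y)) = (e \<in> N y)"
proof -
  have "\<exists>z'. fst z' = z \<and> B (x, False) z' = 1" if "z \<in> N x" for z
    using B_normalize[of "(x, False)" "(z, False)"] that by (simp add: B_N)
  then obtain g where g: "\<And>z. z \<in> N x \<Longrightarrow> fst (g z) = z \<and> B (x, False) (g z) = 1" by metis
  have "star (x, False) [g a, g b, g c, g d, g e]"
    using g assms(1,2) by (simp add: star_def)
  from star_parity[OF this, of "(y, False)"] assms(1,3) g show ?thesis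
    by (simp add: B_N)
qed

text \<open>Equal neighbourhoods would mean five common neighbours, an odd number.\<close>

lemma N_inj:
  assumes "x \<in> V" "N x = N y"
  shows "x = y"
proof (rule ccontr)
  assume ne: "x \<noteq> y"
  obtain xs where st: "star (x, False) xs" using star_exists[of "(x, False)"] assms(1) by auto
  then obtain a b c d e where xs: "xs = [a, b, c, d, e]"
    using list5 star_def by blast
  have "N x = {fst a, fst b, fst c, fst d, fst e}" "distinct [fst a, fst b, fst c, fst d, fst e]"
    using star_nbrs[OF st] st xs by (auto simp: N_def star_def)
  from N_parity[OF this ne] this assms(2) show False by auto
qed

lemma same_five:
  assumes "S \<subseteq> N x" "S \<subseteq> N y" "card S = 5"
  shows "x = y"
proof -
  from assms(3) obtain y where "y \<in> S" by fastforce
  then have "x \<in> V" using assms(1) N_in_V by blast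
  then show ?thesis using N_inj N_eq assms by metis
qed

text \<open>A 4-cycle with sign product 1, signed like the edges of \<open>T_n\<close> between two
  consecutive positions. The order of the first pair matters, as its vertices carry the signs 1 and
  -1; the second pair may be interchanged.\<close>

definition square :: "'a \<times> bool \<Rightarrow> 'a \<times> bool \<Rightarrow> 'a \<times> bool \<Rightarrow> 'a \<times> bool \<Rightarrow> bool" where
  "square u v a b \<longleftrightarrow> B u a = 1 \<and> B u b = 1 \<and> B v a = -1 \<and> B v b = -1 \<and> fst u \<noteq> fst v \<and> fst a \<noteq> fst b"

lemma squareD:
  assumes "square u v a b"
  shows "B u a = 1" "B u b = 1" "B v a = -1" "B v b = -1"
    "B a u = 1" "B b u = 1" "B a v = -1" "B b v = -1"
    "fst u \<noteq> fst v" "fst v \<noteq> fst u" "fst a \<noteq> fst b" "fst b \<noteq> fst a"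
    "fst u \<noteq> fst a" "fst u \<noteq> fst b" "fst v \<noteq> fst a" "fst v \<noteq> fst b"
  using assms B_sym[of a u] B_sym[of b u] B_sym[of a v] B_sym[of b v]
    B_nz_fst[of u a] B_nz_fst[of u b] B_nz_fst[of v a] B_nz_fst[of v b]
  by (auto simp: square_def)

text \<open>In a star of \<open>a\<close> that begins with \<open>u\<close> and
  \<open>neg v\<close>, the row of \<open>b\<close> has two entries 1, so its other three entries
  sum to -2. Two of them are -1, and these give the next square.\<close>

lemma square_extend:
  assumes "square u v a b"
  obtains p q where "square a b p q" "fst p \<noteq> fst u" "fst p \<noteq> fst v" "fst q \<noteq> fst u" "fst q \<noteq> fst v"
proof -
  note s = squareD[OF assms]
  have "\<exists>ys. length ys = 3 \<and> star a ([u, neg v] @ ys)"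
    using star_extend[of a "[u, neg v]"] s B_in_V(2)[of u a] by simp
  then obtain x y z where st: "star a [u, neg v, x, y, z]"
    by (auto simp: numeral_eq_Suc length_Suc_conv)
  then have B: "B a x = 1" "B a y = 1" "B a z = 1"
    and d: "fst x \<noteq> fst y" "fst x \<noteq> fst z" "fst y \<noteq> fst z"
      "fst x \<noteq> fst u" "fst x \<noteq> fst v" "fst y \<noteq> fst u" "fst y \<noteq> fst v" "fst z \<noteq> fst u" "fst z \<noteq> fst v"
    by (auto simp: star_def)
  have "B b u + (B b (neg v) + (B b x + (B b y + B b z))) = 0"
    using star_orth[OF st, of b] s by simp
  then have "B b x + B b y + B b z = -2"
    using s by simp
  then consider "B b x = -1" "B b y = -1" | "B b x = -1" "B b z = -1" | "B b y = -1" "B b z = -1"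
    using B_vals[of b x] B_vals[of b y] B_vals[of b z] by linarith
  then show ?thesis
  proof cases
    case 1 then show ?thesis using that[of x y] s B d by (simp add: square_def)
  next
    case 2 then show ?thesis using that[of x z] s B d by (simp add: square_def)
  next
    case 3 then show ?thesis using that[of y z] s B d by (simp add: square_def)
  qed
qed

lemma square_swap: "square u v a b \<Longrightarrow> square u v b a"
  by (auto simp: square_def)

text \<open>The unsigned version of a square is symmetric in all respects.\<close>

definition psquare :: "'a \<Rightarrow> 'a \<Rightarrow> 'a \<Rightarrow> 'a \<Rightarrow> bool" where
  "psquare u v a b \<longleftrightarrow> u \<noteq> v \<and> a \<noteq> b \<and> A u a * A u b * A v a * A v b = 1"

lemma psquare_sym:
  assumes "psquare u v a b"
  shows "psquare v u a b" "psquare u v b a" "psquare a b u v"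
  using assms A_sym[of a u] A_sym[of b u] A_sym[of a v] A_sym[of b v]
  by (auto simp: psquare_def ac_simps)

lemma psquare_N:
  assumes "psquare u v a b"
  shows "a \<in> N u" "b \<in> N u" "a \<in> N v" "b \<in> N v"
  using assms by (auto simp: psquare_def N_def)

lemma square_psquare: "square u v a b \<Longrightarrow> psquare (fst u) (fst v) (fst a) (fst b)"
proof -
  assume s: "square u v a b"
  have "B u a * B u b * B v a * B v b = 1" using s by (simp add: square_def)
  then have "A (fst u) (fst a) * A (fst u) (fst b) * A (fst v) (fst a) * A (fst v) (fst b) = 1"
    unfolding B_def using sgnb_cases[of "snd u"] sgnb_cases[of "snd v"] sgnb_cases[of "snd a"] sgnb_cases[of "snd b"]
    by auto
  then show ?thesis using s by (simp add: psquare_def square_def)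
qed

lemma psquare_square:
  assumes "psquare u v a b"
  obtains u' v' a' b' where "square u' v' a' b'" "fst u' = u" "fst v' = v" "fst a' = a" "fst b' = b"
proof -
  have nz: "A u a \<noteq> 0" "A u b \<noteq> 0" "A v a \<noteq> 0" "A v b \<noteq> 0"
    using assms by (auto simp: psquare_def)
  obtain a' where a: "fst a' = a" "B (u, False) a' = 1"
    using B_normalize[of "(u, False)" "(a, False)"] nz by (auto simp: B_0_iff)
  obtain b' where b: "fst b' = b" "B (u, False) b' = 1"
    using B_normalize[of "(u, False)" "(b, False)"] nz by (auto simp: B_0_iff)
  obtain v'' where v'': "fst v'' = v" "B a' v'' = 1"
    using B_normalize[of a' "(v, False)"] nz a by (auto simp: B_0_iff A_sym[of a])
  define v' where "v' = neg v''"
  have v: "fst v' = v" "B v' a' = -1" using v'' by (simp_all add: v'_def B_sym[of v''])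
  have "A u a * A u b * A v a * A v b = B (u, False) a' * B (u, False) b' * B v' a' * B v' b'"
    using a(1) b(1) v(1) sgnb_cases[of "snd a'"] sgnb_cases[of "snd b'"] sgnb_cases[of "snd v'"]
    by (auto simp: B_def)
  then have "B v' b' = -1"
    using assms a b v by (simp add: psquare_def)
  then show ?thesis
    using that[of "(u, False)" v' a' b'] a b v assms by (simp add: square_def psquare_def)
qed

lemma psquare_extend:
  assumes "psquare u v a b"
  obtains p q where "psquare a b p q" "p \<noteq> u" "p \<noteq> v" "q \<noteq> u" "q \<noteq> v"
proof -
  obtain u' v' a' b' where s: "square u' v' a' b'"
    and f: "fst u' = u" "fst v' = v" "fst a' = a" "fst b' = b"
    using psquare_square[OF assms] .
  obtain p q where pq: "square a' b' p q" and ne: "fst p \<noteq> fst u'" "fst p \<noteq> fst v'" "fst q \<noteq> fst u'" "fst q \<noteq> fst v'"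
    using square_extend[OF s] .
  have "psquare a b (fst p) (fst q)" using square_psquare[OF pq] f by simp
  then show ?thesis using that ne f by blast
qed

text \<open>Dependent choice with \<open>square_extend\<close>. A state holds two consecutive pairs
  because the next pair must avoid the last but one.\<close>

lemma chain_exists:
  assumes "square u v a b"
  obtains x y where "x 0 = u" "y 0 = v" "x 1 = a" "y 1 = b"
    and "\<And>j::nat. square (x j) (y j) (x (Suc j)) (y (Suc j))"
    and "\<And>j. {fst (x j), fst (y j)} \<inter> {fst (x (Suc (Suc j))), fst (y (Suc (Suc j)))} = {}"
proof -
  let ?Q = "\<lambda>((u, v), (a, b)) ((a', b'), (p, q)). a' = a \<and> b' = b \<and> square a b p q \<and>
    {fst u, fst v} \<inter> {fst p, fst q} = {}"
  have "\<exists>f. f 0 = ((u, v), (a, b)) \<and>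
      (\<forall>j::nat. (case f j of ((u, v), (a, b)) \<Rightarrow> square u v a b) \<and> ?Q (f j) (f (Suc j)))"
  proof -
    have "\<exists>f. \<forall>j::nat. (case f j of ((u', v'), (a', b')) \<Rightarrow> square u' v' a' b' \<and>
        (j = 0 \<longrightarrow> f j = ((u, v), (a, b)))) \<and> ?Q (f j) (f (Suc j))"
    proof (rule dependent_nat_choice)
      show "\<exists>f0. case f0 of ((u', v'), (a', b')) \<Rightarrow> square u' v' a' b' \<and> ((0::nat) = 0 \<longrightarrow> f0 = ((u, v), (a, b)))"
        using assms by (intro exI[of _ "((u, v), (a, b))"]) simp
    next
      fix s and n :: nat
      assume h: "case s of ((u', v'), (a', b')) \<Rightarrow> square u' v' a' b' \<and> (n = 0 \<longrightarrow> s = ((u, v), (a, b)))"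
      obtain u' v' a' b' where s: "s = ((u', v'), (a', b'))" by (metis surj_pair)
      then have "square u' v' a' b'" using h by simp
      then obtain p q where "square a' b' p q" "{fst u', fst v'} \<inter> {fst p, fst q} = {}"
        using square_extend[of u' v' a' b'] by (metis (no_types, lifting) disjoint_insert(1) inf_bot_right insert_iff singletonD)
      then show "\<exists>t. (case t of ((u', v'), (a', b')) \<Rightarrow> square u' v' a' b' \<and> (Suc n = 0 \<longrightarrow> t = ((u, v), (a, b)))) \<and> ?Q s t"
        unfolding s by (intro exI[of _ "((a', b'), (p, q))"]) simp
    qed
    then obtain f where f: "\<forall>j::nat. (case f j of ((u', v'), (a', b')) \<Rightarrow> square u' v' a' b' \<and>
        (j = 0 \<longrightarrow> f j = ((u, v), (a, b)))) \<and> ?Q (f j) (f (Suc j))" by blast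
    then have "f 0 = ((u, v), (a, b))" using spec[OF f, of 0] by (simp add: case_prod_beta)
    then show ?thesis using f by (intro exI[of _ f]) (auto split: prod.splits)
  qed
  then obtain f where f0: "f 0 = ((u, v), (a, b))"
    and f: "\<And>j::nat. (case f j of ((u, v), (a, b)) \<Rightarrow> square u v a b) \<and> ?Q (f j) (f (Suc j))"
    by blast
  have f1: "fst (f (Suc j)) = snd (f j)" for j
    using f[of j] by (auto simp: case_prod_beta prod_eq_iff)
  show ?thesis
  proof (rule that[of "\<lambda>j. fst (fst (f j))" "\<lambda>j. snd (fst (f j))"])
    show "square (fst (fst (f j))) (snd (fst (f j))) (fst (fst (f (Suc j)))) (snd (fst (f (Suc j))))" for j
      using f[of j] f1[of j] by (auto simp: case_prod_beta)
    show "{fst (fst (fst (f j))), fst (snd (fst (f j)))} \<inter>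
        {fst (fst (fst (f (Suc (Suc j))))), fst (snd (fst (f (Suc (Suc j)))))} = {}" for j
      using f[of j] f1[of "Suc j"] by (auto simp: case_prod_beta)
  qed (use f0 f1[of 0] in auto)
qed

end

section \<open>Closing the chain of squares\<close>

context ortho5
begin

text \<open>
  Two consecutive pairs of a chain of squares determine the next pair, and a vertex of a pair
  has room for only one further neighbour. Hence the first pair that meets an earlier one meets
  the initial pair; the next lemma shows that it then coincides with it.
\<close>

lemma chain_closes:
  assumes P0: "psquare u v a b" and P1: "psquare a b y1 y2" and Pl: "psquare o1 o2 p q"
    and Pn: "psquare p q u w"
    and d0: "{u, v} \<inter> {y1, y2} = {}" "{u, v} \<inter> {p, q} = {}" "{u, v} \<inter> {o1, o2} = {}"
    and dn: "{u, w} \<inter> {a, b} = {}" "{u, w} \<inter> {y1, y2} = {}" "{u, w} \<inter> {o1, o2} = {}"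
    and dp: "{a, b} \<inter> {p, q} = {}"
    and oy: "{o1, o2} = {y1, y2} \<or> {o1, o2} \<inter> {y1, y2} = {}"
  shows "w = v"
proof (rule ccontr)
  assume wv: "w \<noteq> v"
  note N0 = psquare_N[OF P0] psquare_N[OF psquare_sym(3)[OF P0]]
  note N1 = psquare_N[OF P1] psquare_N[OF psquare_sym(3)[OF P1]]
  note Nl = psquare_N[OF Pl] psquare_N[OF psquare_sym(3)[OF Pl]]
  note Nn = psquare_N[OF Pn] psquare_N[OF psquare_sym(3)[OF Pn]]
  have ne: "u \<noteq> v" "a \<noteq> b" "p \<noteq> q" "u \<noteq> w" "y1 \<noteq> y2" "o1 \<noteq> o2"
    using P0 P1 Pl Pn by (auto simp: psquare_def)
  have "card {a, b, p, q} = 4" using ne dp by auto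
  then obtain u' where u': "u' \<notin> {a, b, p, q}" "N u = {u', a, b, p, q}"
    using N_fifth[of "{a, b, p, q}" u] N0 Nn by auto
  \<comment> \<open>\<open>u\<close> and \<open>v\<close> have a second square apart from
    \<open>a\<close>, \<open>b\<close>, so two of \<open>u'\<close>, \<open>p\<close>,
    \<open>q\<close> are adjacent to \<open>v\<close>. They are not \<open>p\<close> and
    \<open>q\<close>, which would then share the five neighbours \<open>u\<close>, \<open>v\<close>,
    \<open>w\<close>, \<open>o1\<close>, \<open>o2\<close>. The same is done below for
    \<open>w\<close>.\<close>
  obtain g h where gh: "psquare u v g h" "g \<notin> {a, b}" "h \<notin> {a, b}"
    using psquare_extend[OF psquare_sym(3)[OF P0]] by blast
  have "\<not> (p \<in> N v \<and> q \<in> N v)"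
  proof
    assume "p \<in> N v \<and> q \<in> N v"
    then have "p = q"
      using same_five[of "{u, v, w, o1, o2}" p q] Nl Nn ne wv d0 dn N_sym by auto
    then show False using ne by simp
  qed
  then have v1: "u' \<in> N v" "(p \<in> N v) \<noteq> (q \<in> N v)"
    using psquare_N[OF gh(1)] gh u' by (auto simp: psquare_def)
  obtain g h where gh: "psquare u w g h" "g \<notin> {p, q}" "h \<notin> {p, q}"
    using psquare_extend[OF Pn] by blast
  have "\<not> (a \<in> N w \<and> b \<in> N w)"
  proof
    assume "a \<in> N w \<and> b \<in> N w"
    then have "a = b"
      using same_five[of "{u, v, w, y1, y2}" a b] N0 N1 ne wv d0 dn N_sym by auto
    then show False using ne by simp
  qed
  then have w1: "u' \<in> N w" "(a \<in> N w) \<noteq> (b \<in> N w)"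
    using psquare_N[OF gh(1)] gh u' by (auto simp: psquare_def)
  obtain p' q' where pq: "p' = p \<and> q' = q \<or> p' = q \<and> q' = p" "p' \<in> N v" "q' \<notin> N v"
    using v1(2) by blast
  obtain a' b' where ab: "a' = a \<and> b' = b \<or> a' = b \<and> b' = a" "a' \<in> N w" "b' \<notin> N w"
    using w1(2) by blast
  have ne': "p' \<noteq> q'" "a' \<noteq> b'" using pq ab by blast+
  have d': "p' \<notin> {a', b'}" "q' \<notin> {a', b'}" "u' \<notin> {a', b', p', q'}"
    using dp pq(1) ab(1) u'(1) by blast+
  have Nu: "N u = {u', a', b', p', q'}" using u'(2) pq(1) ab(1) by blast
  have "{a', b', p', u'} \<subseteq> N v" using N0 pq(1,2) ab(1) v1(1) by blast
  moreover have "card {a', b', p', u'} = 4" using ne' d' by auto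
  ultimately obtain v' where v': "v' \<notin> {a', b', p', u'}" "N v = {v', a', b', p', u'}"
    using N_fifth by metis
  have v'q: "v' \<noteq> q'" using v'(2) pq(3) by blast
  have dist: "distinct [v', a', b', p', u', q']" using ne' d' v'(1) v'q by auto
  have pqw: "p' \<in> N w" "q' \<in> N w" using Nn pq(1) by blast+
  have dist1: "distinct [v', a', b', p', u']" using dist by simp
  have v'w: "v' \<in> N w"
    using N_parity[OF v'(2) dist1 wv[symmetric]] w1(1) ab(2,3) pqw by blast
  have "{p', q', a', u', v'} \<subseteq> N w" using pqw ab(2) w1(1) v'w by blast
  moreover have "card {p', q', a', u', v'} = 5" using dist by auto
  ultimately have Nw: "N w = {p', q', a', u', v'}" by (rule N_eq)
  have dist2: "distinct [u', a', b', p', q']" "distinct [p', q', a', u', v']"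
    using dist by auto
  \<comment> \<open>Both \<open>a'\<close> and \<open>b'\<close> are adjacent to \<open>y\<close>.
    Modulo 2, the rows of \<open>u\<close> and \<open>v\<close> make \<open>q'\<close> and
    \<open>v'\<close> equivalent for \<open>y\<close>; the row of \<open>w\<close>, which contains
    \<open>a'\<close> but not \<open>b'\<close>, then decides that both are adjacent to
    \<open>y\<close>.\<close>
  have key: "q' \<in> N y \<and> v' \<in> N y \<and> (p' \<in> N y \<longleftrightarrow> u' \<notin> N y)" if y: "y \<in> {y1, y2}" for y
  proof -
    have ab_y: "a' \<in> N y" "b' \<in> N y" using N1 y ab(1) N_sym by blast+
    have "u \<noteq> y" "v \<noteq> y" "w \<noteq> y" using y d0 dn by blast+
    then show ?thesis
      using N_parity[OF Nu dist2(1)] N_parity[OF v'(2) dist1] N_parity[OF Nw dist2(2)] ab_y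
      by blast
  qed
  \<comment> \<open>If the two pairs coincide, \<open>y1\<close> and \<open>y2\<close> get five
    common neighbours; otherwise \<open>q'\<close> gets six neighbours.\<close>
  show False
  proof (cases "{o1, o2} = {y1, y2}")
    case True
    have "{a', b', p', q', v'} \<subseteq> N y" if y: "y \<in> {y1, y2}" for y
    proof -
      have "y \<in> {o1, o2}" using True y by blast
      then have "p \<in> N y" "q \<in> N y" using Nl by blast+
      then show ?thesis using key[OF y] N1 y pq(1) ab(1) N_sym by blast
    qed
    moreover have "card {a', b', p', q', v'} = 5" using dist by auto
    ultimately have "y1 = y2" using same_five[of "{a', b', p', q', v'}" y1 y2] by blast
    then show False using ne by simp
  next
    case False
    then have "{o1, o2} \<inter> {y1, y2} = {}" using oy by blast
    then have "card {o1, o2, u, w, y1, y2} = 6"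
      using ne d0 dn by auto
    moreover have "{o1, o2, u, w, y1, y2} \<subseteq> N q'"
      using Nl Nn pq(1) key N_sym by blast
    ultimately show False using N_le[of "{o1, o2, u, w, y1, y2}" q'] by simp
  qed
qed

lemma psquare_set:
  assumes "psquare u v a b" "{u', v'} = {u, v}" "{a', b'} = {a, b}"
  shows "psquare u' v' a' b'"
  using assms psquare_sym(1,2)[OF assms(1)] psquare_sym(2)[OF psquare_sym(1)[OF assms(1)]]
  unfolding doubleton_eq_iff by blast

text \<open>The vertices of the closing pair are known, but not their order and signs. Both
  \<open>u\<close> and \<open>v\<close> have opposite entries at \<open>p\<close> and
  \<open>q\<close>. If \<open>u\<close> and \<open>v\<close> differed in sign at \<open>p\<close>,
  the row of \<open>v\<close> would sum to -4 plus a single entry over a star of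
  \<open>u\<close>.\<close>

lemma square_close:
  assumes s0: "square u v a b" and sn: "square p q z w" and zw: "{fst z, fst w} = {fst u, fst v}"
    and d: "{fst a, fst b} \<inter> {fst p, fst q} = {}"
    and "fst p \<noteq> fst q"
  shows "square p q u v \<or> square q p u v"
proof -
  note s0' = squareD[OF s0] and sn' = squareD[OF sn]
  have uv: "B p r \<in> {1, -1} \<and> B q r = - B p r" if "fst r \<in> {fst z, fst w}" for r
  proof -
    have "r = z \<or> r = neg z \<or> r = w \<or> r = neg w"
      using that fst_eq_imp[of r z] fst_eq_imp[of r w] by auto
    then show ?thesis using sn' by auto
  qed
  have pu: "B p u \<in> {1, -1}" "B q u = - B p u" "B p v \<in> {1, -1}" "B q v = - B p v"
    using uv[of u] uv[of v] zw by auto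
  define p' where "p' = (if B p u = 1 then p else neg p)"
  define q' where "q' = (if B p u = 1 then neg q else q)"
  have f: "fst p' = fst p" "fst q' = fst q" by (auto simp: p'_def q'_def)
  have pq: "B u p' = 1" "B u q' = 1" "B v p' = B p u * B p v" "B v q' = B p u * B p v"
    using pu B_sym[of u p] B_sym[of u q] B_sym[of v p] B_sym[of v q] by (auto simp: p'_def q'_def)
  have "distinct (map fst [a, b, p', q'])"
    using d f s0' \<open>fst p \<noteq> fst q\<close> by auto
  moreover have "fst u \<in> V" using B_in_V(1)[of u a] s0' by simp
  ultimately have "\<exists>ys. length ys = 1 \<and> star u ([a, b, p', q'] @ ys)"
    using star_extend[of u "[a, b, p', q']"] s0' pq by simp
  then obtain e where st: "star u [a, b, p', q', e]"
    by (auto simp: length_Suc_conv)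
  have "B p u * B p v = 1"
    using star_orth[OF st, of v] s0' pq pu B_vals[of v e] by auto
  then show ?thesis
    using pu \<open>fst p \<noteq> fst q\<close> s0' by (auto simp: square_def)
qed

text \<open>A copy of \<open>T_n\<close>, not necessarily induced. Integer indices with period
  \<open>n\<close> remove the boundary cases for the positions j - 1 and j + 1.\<close>

definition frame :: "nat \<Rightarrow> (int \<Rightarrow> 'a \<times> bool) \<Rightarrow> (int \<Rightarrow> 'a \<times> bool) \<Rightarrow> bool" where
  "frame n x y \<longleftrightarrow> 3 \<le> n \<and> (\<forall>j. square (x j) (y j) (x (j + 1)) (y (j + 1))) \<and>
     (\<forall>j. x (j + int n) = x j \<and> y (j + int n) = y j) \<and>
     (\<forall>i j. fst (x i) = fst (x j) \<longrightarrow> int n dvd i - j) \<and>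
     (\<forall>i j. fst (y i) = fst (y j) \<longrightarrow> int n dvd i - j) \<and>
     (\<forall>i j. fst (x i) \<noteq> fst (y j))"

lemma frameI:
  fixes x y :: "nat \<Rightarrow> 'a \<times> bool"
  assumes n: "3 \<le> n"
    and sq: "\<And>j. j < n \<Longrightarrow> square (x j) (y j) (x (Suc j mod n)) (y (Suc j mod n))"
    and disj: "\<And>i j. i < j \<Longrightarrow> j < n \<Longrightarrow> {fst (x i), fst (y i)} \<inter> {fst (x j), fst (y j)} = {}"
  shows "frame n (\<lambda>j. x (nat (j mod int n))) (\<lambda>j. y (nat (j mod int n)))"
proof -
  define r where "r j = nat (j mod int n)" for j
  have r: "r j < n" for j using n by (simp add: r_def nat_less_iff)
  have r1: "r (j + 1) = Suc (r j) mod n" for j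
  proof -
    have ri: "int (r i) = i mod int n" for i using n by (simp add: r_def)
    have "int (r (j + 1)) = int (Suc (r j) mod n)"
      by (simp add: ri zmod_int mod_add_right_eq add.commute[of j])
    then show ?thesis by simp
  qed
  have req: "int n dvd i - j" if "r i = r j" for i j
  proof -
    have "i mod int n = j mod int n" using that n by (simp add: r_def nat_eq_iff2 split: if_splits)
    then show ?thesis by (simp add: mod_eq_dvd_iff)
  qed
  have d: "r i = r j" if "fst (x (r i)) = fst (x (r j)) \<or> fst (y (r i)) = fst (y (r j)) \<or> fst (x (r i)) = fst (y (r j))" for i j
    using that disj[of "r i" "r j"] disj[of "r j" "r i"] r[of i] r[of j]
    by (cases "r i" "r j" rule: linorder_cases) auto
  have "fst (x (r i)) \<noteq> fst (y (r j))" for i j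
    using d[of i j] squareD(9)[OF sq[OF r[of j]]] by auto
  moreover have "square (x (r j)) (y (r j)) (x (r (j + 1))) (y (r (j + 1)))" for j
    unfolding r1 by (rule sq[OF r])
  moreover have "r (j + int n) = r j" for j by (simp add: r_def)
  ultimately show ?thesis
    unfolding frame_def r_def[symmetric] using n d req by auto
qed

text \<open>Finiteness makes the chain return. At the first return it can only meet the initial
  pair, coincides with it by \<open>chain_closes\<close>, and is closed with correct signs by
  \<open>square_close\<close>.\<close>

lemma square_frame:
  assumes "square u v a b"
  obtains n x y where "frame n x y" "x 0 = u" "y 0 = v"
proof -
  obtain x y where 0: "x 0 = u" "y 0 = v"
    and sq: "\<And>j::nat. square (x j) (y j) (x (Suc j)) (y (Suc j))"
    and alt: "\<And>j. {fst (x j), fst (y j)} \<inter> {fst (x (Suc (Suc j))), fst (y (Suc (Suc j)))} = {}"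
    using chain_exists[OF assms] by metis
  define P where "P j = {fst (x j), fst (y j)}" for j
  have cP: "card (P j) = 2" "finite (P j)" for j
    using squareD(9)[OF sq[of j]] by (auto simp: P_def)
  have PN: "P (Suc j) \<subseteq> N z" if "z \<in> P j" for j z
    using that psquare_N[OF square_psquare[OF sq[of j]]] by (auto simp: P_def)
  have PN': "P j \<subseteq> N z" if "z \<in> P (Suc j)" for j z
    using PN[of _ j] that N_sym by blast
  have inV: "fst (x j) \<in> V" for j using PN[of "fst (x j)" j] N_in_V(1) by (auto simp: P_def)
  have "\<not> inj (\<lambda>j. fst (x j))"
    using inV finite_V by (metis finite_subset image_subsetI infinite_UNIV_nat finite_imageD)
  then have "\<exists>i j. i < j \<and> fst (x i) = fst (x j)"
    by (metis injI linorder_neqE_nat)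
  then obtain i j where "i < j" "fst (x i) = fst (x j)" by blast
  then have "i < j \<and> P i \<inter> P j \<noteq> {}" by (simp add: P_def)
  then have ex: "\<exists>n. \<exists>i<n. P i \<inter> P n \<noteq> {}" by blast
  define n where "n = (LEAST n. \<exists>i<n. P i \<inter> P n \<noteq> {})"
  have "\<exists>i<n. P i \<inter> P n \<noteq> {}" unfolding n_def using ex by (rule LeastI_ex)
  then obtain i where i: "i < n" "P i \<inter> P n \<noteq> {}" by blast
  have disj: "P i \<inter> P j = {}" if "i < j" "j < n" for i j
    using not_less_Least[of j "\<lambda>n. \<exists>i<n. P i \<inter> P n \<noteq> {}"] that unfolding n_def by blast
  have nn1: "P j \<inter> P (Suc j) = {}" for j
    using PN[of _ j] by (metis N_irrefl disjoint_iff subsetD)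
  have nn2: "P j \<inter> P (Suc (Suc j)) = {}" for j using alt by (simp add: P_def)
  have far: "i + 2 < n" if i: "i < n" "P i \<inter> P n \<noteq> {}" for i
  proof (rule ccontr)
    assume "\<not> i + 2 < n"
    then have "n = Suc i \<or> n = Suc (Suc i)" using i(1) by linarith
    then show False using i(2) nn1[of i] nn2[of i] by auto
  qed
  \<comment> \<open>A vertex in a pair \<open>i\<close> with i >= 1 and in pair \<open>n\<close>
    would have the six neighbours in the pairs i - 1, i + 1 and n - 1.\<close>
  have later: "P i \<inter> P n = {}" if i: "1 \<le> i" "i < n" for i
  proof (rule ccontr)
    assume ne: "P i \<inter> P n \<noteq> {}"
    then obtain z where z: "z \<in> P i" "z \<in> P n" by blast
    have lt: "i + 2 < n" using far ne i by blast
    have "P (i - 1) \<union> P (i + 1) \<union> P (n - 1) \<subseteq> N z"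
      using z PN[of z i] PN'[of z "i - 1"] PN'[of z "n - 1"] i by auto
    moreover have "card (P (i - 1) \<union> P (i + 1) \<union> P (n - 1)) = 6"
      using disj[of "i - 1" "i + 1"] disj[of "i - 1" "n - 1"] disj[of "i + 1" "n - 1"] cP lt i
      by (simp add: card_Un_disjoint Int_Un_distrib2)
    ultimately show False using N_le[of "P (i - 1) \<union> P (i + 1) \<union> P (n - 1)" z] by simp
  qed
  have "i = 0" using later[of i] i by (cases i) auto
  then obtain z where z: "z \<in> P 0" "z \<in> P n" using i by blast
  have n: "3 \<le> n" using far[OF i] by simp
  obtain v' where v': "P 0 = {z, v'}" using z(1) by (auto simp: P_def)
  obtain w where w: "P n = {z, w}" using z(2) by (auto simp: P_def)
  define m where "m = n - 2"
  have m: "n = Suc (Suc m)" "1 \<le> m" using n by (simp_all add: m_def)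
  have psq: "psquare (fst (x j)) (fst (y j)) (fst (x (Suc j))) (fst (y (Suc j)))" for j
    using square_psquare[OF sq] .
  have "w = v'"
  proof (rule chain_closes)
    show "psquare z v' (fst (x 1)) (fst (y 1))"
      using psquare_set[OF psq[of 0]] v' by (simp add: P_def)
    show "psquare (fst (x 1)) (fst (y 1)) (fst (x 2)) (fst (y 2))"
      using psq[of 1] by (simp add: numeral_2_eq_2)
    show "psquare (fst (x m)) (fst (y m)) (fst (x (Suc m))) (fst (y (Suc m)))"
      using psq .
    show "psquare (fst (x (Suc m))) (fst (y (Suc m))) z w"
      using psquare_set[OF psq[of "Suc m"]] w m by (simp add: P_def)
    show "{z, v'} \<inter> {fst (x 2), fst (y 2)} = {}" "{z, v'} \<inter> {fst (x (Suc m)), fst (y (Suc m))} = {}"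
      "{z, v'} \<inter> {fst (x m), fst (y m)} = {}"
      using disj[of 0 2] disj[of 0 "Suc m"] disj[of 0 m] m n v' by (simp_all flip: P_def)
    show "{z, w} \<inter> {fst (x 1), fst (y 1)} = {}" "{z, w} \<inter> {fst (x 2), fst (y 2)} = {}"
      "{z, w} \<inter> {fst (x m), fst (y m)} = {}"
      using later[of 1] later[of 2] later[of m] m n w by (auto simp flip: P_def)
    show "{fst (x 1), fst (y 1)} \<inter> {fst (x (Suc m)), fst (y (Suc m))} = {}"
      using disj[of 1 "Suc m"] m by (simp flip: P_def)
    show "{fst (x m), fst (y m)} = {fst (x 2), fst (y 2)} \<or>
        {fst (x m), fst (y m)} \<inter> {fst (x 2), fst (y 2)} = {}"
      using disj[of m 2] disj[of 2 m] m n by (cases m "2::nat" rule: linorder_cases) (auto simp flip: P_def)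
  qed
  then have Pn0: "P n = P 0" using v' w by simp
  define l where "l = Suc m"
  have "square (x l) (y l) (x 0) (y 0) \<or> square (y l) (x l) (x 0) (y 0)"
  proof (rule square_close[OF sq[of 0]])
    show "square (x l) (y l) (x n) (y n)" using sq[of l] m by (simp add: l_def)
    show "{fst (x n), fst (y n)} = {fst (x 0), fst (y 0)}" using Pn0 by (simp add: P_def)
    show "{fst (x (Suc 0)), fst (y (Suc 0))} \<inter> {fst (x l), fst (y l)} = {}"
      using disj[of 1 l] m by (simp add: l_def flip: P_def)
    show "fst (x l) \<noteq> fst (y l)" using squareD(9)[OF sq[of l]] .
  qed
  then obtain xl yl where xyl: "square xl yl (x 0) (y 0)" "xl = x l \<and> yl = y l \<or> xl = y l \<and> yl = x l"
    by blast
  \<comment> \<open>If the chain closes with the last pair reversed, that pair is exchanged: the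
    square entering it does not see the order, and the square leaving it becomes correct.\<close>
  define x' where "x' = x(l := xl)"
  define y' where "y' = y(l := yl)"
  have P': "{fst (x' j), fst (y' j)} = P j" for j
    using xyl(2) by (auto simp: x'_def y'_def P_def)
  have "frame n (\<lambda>j. x' (nat (j mod int n))) (\<lambda>j. y' (nat (j mod int n)))"
  proof (rule frameI[OF n])
    fix j assume j: "j < n"
    consider "Suc j < l" | "Suc j = l" | "j = l" using j m unfolding l_def by linarith
    then show "square (x' j) (y' j) (x' (Suc j mod n)) (y' (Suc j mod n))"
    proof cases
      case 1
      then show ?thesis using sq[of j] m by (simp add: x'_def y'_def l_def)
    next
      case 2
      then show ?thesis using sq[of j] square_swap[OF sq[of j]] m xyl(2)
        by (auto simp: x'_def y'_def l_def)
    next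
      case 3
      then show ?thesis using xyl(1) m by (simp add: x'_def y'_def l_def)
    qed
  next
    fix i j assume "i < j" "j < n"
    then show "{fst (x' i), fst (y' i)} \<inter> {fst (x' j), fst (y' j)} = {}"
      unfolding P' by (rule disj)
  qed
  then show ?thesis
    using that m 0 by (simp add: x'_def y'_def l_def)
qed

end

section \<open>The fifth neighbours of a frame\<close>

locale framed = ortho5 +
  fixes n :: nat and x y :: "int \<Rightarrow> 'a \<times> bool"
  assumes frame: "frame n x y"
begin

lemma n3: "3 \<le> n"
  and sq: "square (x j) (y j) (x (j + 1)) (y (j + 1))"
  and x_inj: "fst (x i) = fst (x j) \<Longrightarrow> int n dvd i - j"
  and y_inj: "fst (y i) = fst (y j) \<Longrightarrow> int n dvd i - j"
  and xy_neq [simp]: "fst (x i) \<noteq> fst (y j)"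
  using frame by (simp_all add: frame_def)

lemma yx_neq [simp]: "fst (y i) \<noteq> fst (x j)"
  using xy_neq[of j i, symmetric] .

lemma per:
  assumes "int n dvd i - j"
  shows "x i = x j" "y i = y j"
proof -
  have step: "x (j + int n) = x j \<and> y (j + int n) = y j" for j
    using frame by (simp add: frame_def)
  have nat: "x (j + int n * int k) = x j \<and> y (j + int n * int k) = y j" for j k
  proof (induction k)
    case (Suc k)
    then show ?case using step[of "j + int n * int k"] by (simp add: algebra_simps)
  qed simp
  obtain k where k: "i - j = int n * k" using assms by (rule dvdE)
  have "x i = x j \<and> y i = y j"
  proof (cases "k \<ge> 0")
    case True
    then show ?thesis using nat[of j "nat k"] k by (simp add: algebra_simps)
  next
    case False
    then have "j = i + int n * int (nat (- k))" using k by (simp add: algebra_simps)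
    then show ?thesis using nat[of i "nat (- k)"] by metis
  qed
  then show "x i = x j" "y i = y j" by simp_all
qed

definition P :: "int \<Rightarrow> 'a set" where
  "P j = {fst (x j), fst (y j)}"

lemma P_disj: "v \<in> P i \<Longrightarrow> v \<in> P j \<Longrightarrow> int n dvd i - j"
  unfolding P_def by (metis insertE singletonD x_inj y_inj xy_neq)

lemma P_cong: "int n dvd i - j \<Longrightarrow> P i = P j"
  using per[of i j] by (simp add: P_def)

lemma x_in_P [simp]: "fst (x j) \<in> P j" and y_in_P [simp]: "fst (y j) \<in> P j"
  by (simp_all add: P_def)

lemma P_eq_iff: "P i = P j \<longleftrightarrow> int n dvd i - j"
  by (metis x_in_P P_disj P_cong)

lemma n_ndvd: "0 < d \<Longrightarrow> d < n \<Longrightarrow> \<not> int n dvd int d" "0 < d \<Longrightarrow> d < n \<Longrightarrow> \<not> int n dvd - int d"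
  using zdvd_not_zless[of "int d" "int n"] by auto

lemma not_dvd12 [simp]: "\<not> int n dvd 1" "\<not> int n dvd 2" "\<not> int n dvd - 1" "\<not> int n dvd - 2"
  using n_ndvd[of 1] n_ndvd[of 2] n3 by auto

lemma P_adj: "v \<in> P j \<Longrightarrow> v \<notin> P (j + 1)" "v \<in> P j \<Longrightarrow> v \<notin> P (j - 1)"
  using P_disj[of v j "j + 1"] P_disj[of v j "j - 1"] n3 by auto

lemma B_fwd [simp]:
  "B (x j) (x (j + 1)) = 1" "B (x j) (y (j + 1)) = 1"
  "B (y j) (x (j + 1)) = -1" "B (y j) (y (j + 1)) = -1"
  using squareD[OF sq[of j]] by simp_all

lemma B_bwd [simp]:
  "B (x j) (x (j - 1)) = 1" "B (y j) (x (j - 1)) = 1"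
  "B (x j) (y (j - 1)) = -1" "B (y j) (y (j - 1)) = -1"
  using B_fwd[of "j - 1"] B_sym[of "x j"] B_sym[of "y j"] by simp_all

lemma ex_p:
  "\<exists>p. star (x j) [x (j + 1), y (j + 1), x (j - 1), neg (y (j - 1)), p]"
  "\<exists>q. star (y j) [neg (x (j + 1)), neg (y (j + 1)), x (j - 1), neg (y (j - 1)), q]"
proof -
  have d: "distinct [fst (x (j + 1)), fst (y (j + 1)), fst (x (j - 1)), fst (y (j - 1))]"
    using x_inj[of "j + 1" "j - 1"] y_inj[of "j + 1" "j - 1"] by auto
  have V: "fst (x j) \<in> V" "fst (y j) \<in> V"
    using B_in_V(1)[of "x j" "x (j + 1)"] B_in_V(1)[of "y j" "x (j + 1)"] by simp_all
  show "\<exists>p. star (x j) [x (j + 1), y (j + 1), x (j - 1), neg (y (j - 1)), p]"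
    using star_extend[of "x j" "[x (j + 1), y (j + 1), x (j - 1), neg (y (j - 1))]"] d V
    by (auto simp: length_Suc_conv)
  show "\<exists>q. star (y j) [neg (x (j + 1)), neg (y (j + 1)), x (j - 1), neg (y (j - 1)), q]"
    using star_extend[of "y j" "[neg (x (j + 1)), neg (y (j + 1)), x (j - 1), neg (y (j - 1))]"] d V
    by (auto simp: length_Suc_conv)
qed

text \<open>The one neighbour of \<open>x j\<close> outside the two adjacent pairs of the frame;
  \<open>q j\<close> is that of \<open>y j\<close>.\<close>

definition p :: "int \<Rightarrow> 'a \<times> bool" where
  "p j = (SOME p. star (x j) [x (j + 1), y (j + 1), x (j - 1), neg (y (j - 1)), p])"

definition q :: "int \<Rightarrow> 'a \<times> bool" where
  "q j = (SOME q. star (y j) [neg (x (j + 1)), neg (y (j + 1)), x (j - 1), neg (y (j - 1)), q])"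

lemma star_x: "star (x j) [x (j + 1), y (j + 1), x (j - 1), neg (y (j - 1)), p j]"
  unfolding p_def using someI_ex[OF ex_p(1)] .

lemma star_y: "star (y j) [neg (x (j + 1)), neg (y (j + 1)), x (j - 1), neg (y (j - 1)), q j]"
  unfolding q_def using someI_ex[OF ex_p(2)] .

lemma B_p [simp]: "B (x j) (p j) = 1" and B_q [simp]: "B (y j) (q j) = 1"
  using star_x[of j] star_y[of j] by (simp_all add: star_def)

lemma pq_notin:
  "fst (p j) \<notin> P (j + 1)" "fst (p j) \<notin> P (j - 1)" "fst (q j) \<notin> P (j + 1)" "fst (q j) \<notin> P (j - 1)"
  using star_x[of j] star_y[of j] by (auto simp: star_def P_def)

lemma N_x: "N (fst (x j)) = P (j + 1) \<union> P (j - 1) \<union> {fst (p j)}"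
  and N_y: "N (fst (y j)) = P (j + 1) \<union> P (j - 1) \<union> {fst (q j)}"
  using star_nbrs[OF star_x[of j]] star_nbrs[OF star_y[of j]] by (auto simp: N_def P_def)

lemma card_P: "card (P (j + 1) \<union> P (j - 1)) = 4"
proof -
  have "P (j + 1) \<inter> P (j - 1) = {}" using P_disj[of _ "j + 1" "j - 1"] by auto
  moreover have "finite (P k)" "card (P k) = 2" for k by (simp_all add: P_def)
  ultimately show ?thesis by (simp add: card_Un_disjoint)
qed

lemma p_neq_q: "fst (p j) \<noteq> fst (q j)"
  using N_x[of j] N_y[of j] xy_neq[of j j] N_inj[of "fst (x j)" "fst (y j)"] N_in_V(1)[of "fst (p j)" "fst (x j)"]
  by auto

lemma orth_x:
  assumes "fst w \<noteq> fst (x j)"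
  shows "B w (x (j + 1)) + B w (y (j + 1)) + B w (x (j - 1)) - B w (y (j - 1)) + B w (p j) = 0"
  using star_orth[OF star_x assms] by simp

lemma orth_y:
  assumes "fst w \<noteq> fst (y j)"
  shows "- B w (x (j + 1)) - B w (y (j + 1)) + B w (x (j - 1)) - B w (y (j - 1)) + B w (q j) = 0"
  using star_orth[OF star_y assms] by simp

text \<open>Let a, b be the entries of \<open>w\<close> at the pair j + 1, c, d those at j - 1, and
  e, f those at \<open>p j\<close>, \<open>q j\<close>. Adding and subtracting the rows of
  \<open>x j\<close> and \<open>y j\<close> gives 2 (c - d) + e + f = 0 and 2 (a + b) + e - f = 0.
  So e and f vanish together, and then a = -b and c = d; otherwise exactly one of a + b and c - d is
  0, and the other is 1 or -1.\<close>

lemma third: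
  assumes "w \<notin> P j"
  shows "fst (p j) \<in> N w \<longleftrightarrow> fst (q j) \<in> N w"
    and "fst (p j) \<notin> N w \<Longrightarrow> fst (x (j + 1)) \<in> N w \<longleftrightarrow> fst (y (j + 1)) \<in> N w"
    and "fst (p j) \<notin> N w \<Longrightarrow> fst (x (j - 1)) \<in> N w \<longleftrightarrow> fst (y (j - 1)) \<in> N w"
    and "fst (p j) \<in> N w \<Longrightarrow>
      (fst (x (j + 1)) \<in> N w \<longleftrightarrow> fst (y (j + 1)) \<in> N w) \<noteq> (fst (x (j - 1)) \<in> N w \<longleftrightarrow> fst (y (j - 1)) \<in> N w)"
proof -
  let ?w = "(w, False)"
  have ne: "fst ?w \<noteq> fst (x j)" "fst ?w \<noteq> fst (y j)" using assms by (auto simp: P_def)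
  have N: "z \<in> N w \<longleftrightarrow> B ?w (z, b) \<noteq> 0" "fst r \<in> N w \<longleftrightarrow> B ?w r \<noteq> 0" for z b r
    using B_N[of ?w "(z, b)"] B_N[of ?w r] by simp_all
  note h = orth_x[OF ne(1)] orth_y[OF ne(2)] B_vals[of ?w "x (j + 1)"] B_vals[of ?w "y (j + 1)"]
    B_vals[of ?w "x (j - 1)"] B_vals[of ?w "y (j - 1)"] B_vals[of ?w "p j"] B_vals[of ?w "q j"]
  show "fst (p j) \<in> N w \<longleftrightarrow> fst (q j) \<in> N w"
    unfolding N(2) using h by (smt (verit))
  show "fst (p j) \<notin> N w \<Longrightarrow> fst (x (j + 1)) \<in> N w \<longleftrightarrow> fst (y (j + 1)) \<in> N w"
    "fst (p j) \<notin> N w \<Longrightarrow> fst (x (j - 1)) \<in> N w \<longleftrightarrow> fst (y (j - 1)) \<in> N w"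
    "fst (p j) \<in> N w \<Longrightarrow>
      (fst (x (j + 1)) \<in> N w \<longleftrightarrow> fst (y (j + 1)) \<in> N w) \<noteq> (fst (x (j - 1)) \<in> N w \<longleftrightarrow> fst (y (j - 1)) \<in> N w)"
    unfolding N(2) using h by (smt (verit))+
qed

definition F :: "int \<Rightarrow> 'a set" where
  "F j = {fst (p j), fst (q j)}"

text \<open>The fifth neighbour of a vertex.\<close>

lemma fifth_unique:
  assumes "v \<in> P j" "z \<in> N v" "z' \<in> N v" "z \<notin> P (j + 1) \<union> P (j - 1)" "z' \<notin> P (j + 1) \<union> P (j - 1)"
  shows "z' = z"
  using assms N_x[of j] N_y[of j] by (auto simp: P_def)

lemma P_subset_N: "v \<in> P j \<Longrightarrow> P (j + 1) \<subseteq> N v" "v \<in> P j \<Longrightarrow> P (j - 1) \<subseteq> N v"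
  using N_x[of j] N_y[of j] by (auto simp: P_def)

lemma F_N: "z \<in> F j \<Longrightarrow> \<exists>v\<in>P j. z \<in> N v"
  using N_x[of j] N_y[of j] by (auto simp: F_def)

lemma N_F: "v \<in> P j \<Longrightarrow> \<exists>z\<in>F j. z \<in> N v"
  using N_x[of j] N_y[of j] by (auto simp: F_def P_def)

lemma N_F_iff: "v \<in> P j \<Longrightarrow> z \<in> N v \<Longrightarrow> z \<notin> P (j + 1) \<Longrightarrow> z \<notin> P (j - 1) \<Longrightarrow> z \<in> F j"
  using N_x[of j] N_y[of j] by (auto simp: F_def P_def)

lemma F_notin: "z \<in> F j \<Longrightarrow> z \<notin> P (j + 1)" "z \<in> F j \<Longrightarrow> z \<notin> P (j - 1)"
  using pq_notin[of j] by (auto simp: F_def)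

text \<open>By \<open>third\<close>, the neighbours of \<open>z\<close> in the pairs l - 1 and l + 1
  are neighbours of \<open>z'\<close> too. In such a pair, \<open>z'\<close> must not be a fifth
  common neighbour of the two vertices, so it lies in pair l, or else in both l - 2 and l + 2, which
  forces n = 4.\<close>

lemma F_meets_aux:
  assumes zz: "F j = {z, z'}" and z: "z \<in> P l"
  shows "z' \<in> P l"
proof -
  have l1: "\<not> int n dvd l - (j + 1)" "\<not> int n dvd l - (j - 1)"
    using F_notin[of z j] zz z P_cong[of l] by auto
  obtain v where v: "v \<in> P j" "z \<in> N v" using F_N[of z j] zz by auto
  show ?thesis
  proof (cases "int n dvd l - j")
    case True
    then have zj: "z \<in> P j" using z P_cong by blast
    have "v \<notin> P (j + 1)" "v \<notin> P (j - 1)" using P_adj[OF v(1)] by auto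
    then have "v \<in> F j" using N_F_iff[OF zj] v(2) N_sym by blast
    moreover have "v \<noteq> z" using v(2) by auto
    ultimately show ?thesis using zz v(1) True P_cong by blast
  next
    case False
    have adj: "z' \<in> N w" if "w \<in> P (l + 1) \<union> P (l - 1)" for w
    proof -
      have "w \<notin> P j" using that l1 P_disj[of w "l + 1" j] P_disj[of w "l - 1" j] by (auto simp: algebra_simps)
      moreover have "z \<in> N w" using P_subset_N[OF z] that N_sym by blast
      ultimately show ?thesis
        using third(1)[of w j] zz by (auto simp: F_def doubleton_eq_iff)
    qed
    have two: "z' \<in> P l \<union> P (m + (m - l))" if "m = l + 1 \<or> m = l - 1" for m
    proof (rule ccontr)
      assume no: "z' \<notin> P l \<union> P (m + (m - l))"
      have "P l \<union> P (m + (m - l)) = P (m + 1) \<union> P (m - 1)"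
        using that by (auto simp: algebra_simps)
      then have c: "card (insert z' (P (m + 1) \<union> P (m - 1))) = 5"
        using no card_P[of m] by (simp add: P_def)
      have "insert z' (P (m + 1) \<union> P (m - 1)) \<subseteq> N w" if "w \<in> P m" for w
        using that \<open>m = l + 1 \<or> m = l - 1\<close> adj[of w] P_subset_N[of w m] by auto
      then have "fst (x m) = fst (y m)"
        by (intro same_five[OF _ _ c]) simp_all
      then show False using xy_neq by blast
    qed
    show ?thesis
    proof (rule ccontr)
      assume no: "z' \<notin> P l"
      then have "z' \<in> P (l + 2)" "z' \<in> P (l - 2)" using two[of "l + 1"] two[of "l - 1"] by (auto simp: add.commute)
      then have n4: "int n dvd 4" using P_disj[of z' "l + 2" "l - 2"] by simp
      then have "n = 4" using n3 zdvd_imp_le[of "int n" 4] by (cases "n = 3") auto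
      \<comment> \<open>Modulo 4 only l = j + 2 is left, so \<open>z'\<close> is in pair
        \<open>j\<close>. Its neighbour in that pair belongs to \<open>F j\<close> and hence is
        \<open>z\<close>.\<close>
      then have "int n dvd l + 2 - j" using l1 False by simp presburger
      then have z'j: "z' \<in> P j" using \<open>z' \<in> P (l + 2)\<close> P_cong by blast
      obtain v' where v': "v' \<in> P j" "z' \<in> N v'" using F_N[of z' j] zz by auto
      have "v' \<notin> P (j + 1)" "v' \<notin> P (j - 1)" using P_adj[OF v'(1)] by auto
      then have "v' \<in> F j" using N_F_iff[OF z'j] v'(2) N_sym by blast
      moreover have "v' \<noteq> z'" using v'(2) by auto
      ultimately have "z \<in> P j" using zz v'(1) by auto
      then show False using z P_disj False by blast
    qed
  qed
qed

lemma F_meets: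
  assumes "z \<in> F j" "z \<in> P l"
  shows "F j = P l"
proof -
  obtain z' where zz: "F j = {z, z'}" using assms(1) by (auto simp: F_def)
  then have "z' \<in> P l" "z \<noteq> z'" using F_meets_aux[OF zz assms(2)] p_neq_q[of j] by (auto simp: F_def)
  then show ?thesis using assms(2) zz by (auto simp: P_def)
qed

lemma F_sym:
  assumes "F j = P l"
  shows "F l = P j"
proof -
  obtain v where v: "v \<in> P j" "fst (x l) \<in> N v" using F_N[of "fst (x l)" j] assms by auto
  have "v \<notin> P (l + 1)" "v \<notin> P (l - 1)"
    using P_disj[OF v(1)] F_notin[of "fst (x l)" j] assms P_cong[of l "j + 1"] P_cong[of l "j - 1"]
    by (force simp: algebra_simps dvd_diff_commute)+
  then have "v \<in> F l" using N_F_iff[of "fst (x l)" l v] v N_sym by auto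
  then show ?thesis using F_meets v(1) by blast
qed

lemma F_cong: "int n dvd i - j \<Longrightarrow> F i = F j"
proof -
  assume "int n dvd i - j"
  moreover from this have "int n dvd (i + 1) - (j + 1)" "int n dvd (i - 1) - (j - 1)" by simp_all
  ultimately have "p i = p j" "q i = q j" unfolding p_def q_def using per by presburger+
  then show ?thesis by (simp add: F_def)
qed

lemma e_notin_step:
  assumes "z \<in> N (fst (x (j + 1)))" "z \<notin> P (j + 2)" "z \<notin> P j"
  shows "fst (y (j + 1)) \<notin> N z"
proof
  assume "fst (y (j + 1)) \<in> N z"
  then have "fst (p (j + 1)) = z" "fst (q (j + 1)) = z"
    using N_x[of "j + 1"] N_y[of "j + 1"] assms N_sym by (auto simp: algebra_simps)
  then show False using p_neq_q by metis
qed

text \<open>If \<open>x (j + 1)\<close> and \<open>y (j + 1)\<close> were not adjacent, the rows of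
  \<open>x j\<close> and \<open>y j\<close> would give \<open>x (j + 1)\<close> equal entries at
  \<open>p j\<close> and \<open>q j\<close>. But these are \<open>y j\<close> and \<open>x j\<close>
  up to a common sign, where its entries are opposite.\<close>

lemma F_same_step:
  assumes "F j = P j"
  shows "F (j + 1) = P (j + 1)"
proof (rule ccontr)
  assume no: "F (j + 1) \<noteq> P (j + 1)"
  let ?a = "x (j + 1)" and ?z = "fst (p (j + 1))"
  have zN: "?z \<in> N (fst ?a)" "fst ?a \<in> N ?z" using N_x N_sym by auto
  have zF: "?z \<in> F (j + 1)" by (simp add: F_def)
  have z1: "?z \<notin> P (j + 1)" using F_meets[OF zF] no by blast
  have z2: "?z \<notin> P j" "?z \<notin> P (j + 2)" using F_notin[OF zF] by (simp_all add: algebra_simps)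
  have px: "fst (p j) = fst (y j)" "fst (q j) = fst (x j)"
    using assms N_x[of j] N_y[of j] N_irrefl[of "fst (x j)"] N_irrefl[of "fst (y j)"]
    by (auto simp: F_def P_def doubleton_eq_iff simp del: N_irrefl)
  have zj: "?z \<in> P (j - 1)"
  proof (rule ccontr)
    assume "?z \<notin> P (j - 1)"
    then have "fst (p j) \<notin> N ?z"
      using px N_y[of j] z1 z2 N_sym[of "fst (y j)"] by auto
    then show False
      using third(2)[OF z2(1)] zN e_notin_step[OF zN(1) z2(2,1)] by blast
  qed
  have "B ?a (y (j + 1)) = 0"
  proof -
    have "fst (y (j + 1)) \<notin> N (fst ?a)"
      using N_x[of "j + 1"] z1 P_adj[OF y_in_P[of "j + 1"]] y_in_P[of "j + 1"] by fastforce
    then show ?thesis using B_N by blast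
  qed
  moreover have "fst ?a \<noteq> fst (x j)" using x_inj[of "j + 1" j] n3 by auto
  ultimately have "B ?a (p j) = B ?a (q j)"
    using orth_x[of ?a j] orth_y[of ?a j] by simp
  moreover have "p j = y j \<and> q j = x j \<or> p j = neg (y j) \<and> q j = neg (x j)"
    using fst_eq_imp[OF px(1)] fst_eq_imp[OF px(2)] B_p[of j] B_q[of j] B_sym[of "x j" "y j"]
    by (auto simp del: B_p B_q)
  ultimately show False
    using B_sym[of ?a "x j"] B_sym[of ?a "y j"] by auto
qed

text \<open>By \<open>third\<close>, the fifth neighbour of \<open>x (j + 1)\<close> is adjacent to
  \<open>p j\<close>, which is in pair \<open>l\<close>. So it is in a pair next to \<open>l\<close>
  or is the fifth neighbour of \<open>p j\<close>; the latter is \<open>x j\<close>, which is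
  excluded.\<close>

lemma F_step:
  assumes "F j = P l" "\<not> int n dvd l - j"
  shows "F (j + 1) = P (l + 1) \<or> F (j + 1) = P (l - 1)"
proof -
  let ?a = "x (j + 1)" and ?z = "fst (p (j + 1))"
  have zN: "?z \<in> N (fst ?a)" "fst ?a \<in> N ?z" using N_x N_sym by auto
  have zF: "?z \<in> F (j + 1)" by (simp add: F_def)
  have z2: "?z \<notin> P j" "?z \<notin> P (j + 2)" using F_notin[OF zF] by (simp_all add: algebra_simps)
  have r: "fst (p j) \<in> N ?z"
    using third(2)[OF z2(1)] zN e_notin_step[OF zN(1) z2(2,1)] by blast
  have pl: "fst (p j) \<in> P l" using assms by (auto simp: F_def)
  have "?z \<in> P (l + 1) \<union> P (l - 1)"
  proof (rule ccontr)
    assume no: "?z \<notin> P (l + 1) \<union> P (l - 1)"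
    have xj: "fst (x j) \<in> N (fst (p j))" using N_x N_sym by auto
    have l1: "\<not> int n dvd l - (j + 1)" "\<not> int n dvd l - (j - 1)"
      using F_notin[of "fst (p j)" j] pl P_cong[of l] by (auto simp: F_def)
    have "fst (x j) \<notin> P (l + 1) \<union> P (l - 1)"
      using P_disj[of "fst (x j)" j] l1 by (force simp: algebra_simps dvd_diff_commute)
    then have "?z = fst (x j)" using fifth_unique[OF pl xj] r N_sym no by blast
    then show False using z2 by simp
  qed
  then show ?thesis using F_meets[OF zF] by blast
qed

lemma int_induct_mod:
  assumes "Q j" and step: "\<And>i. Q i \<Longrightarrow> Q (i + 1)" and cong: "\<And>i k. int n dvd i - k \<Longrightarrow> Q i = Q k"
  shows "Q (i::int)"
proof -
  have "Q (j + int k)" for k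
  proof (induction k)
    case (Suc k)
    then show ?case using step[of "j + int k"] by (simp add: algebra_simps)
  qed (use assms(1) in simp)
  then have "Q (j + int (nat ((i - j) mod int n)))" .
  moreover have "int n dvd i - (j + (i - j) mod int n)"
    by (metis diff_diff_eq minus_mod_eq_mult_div dvd_triv_left)
  ultimately show ?thesis using cong n3 by simp
qed

lemma F_same_all:
  assumes "F j = P j"
  shows "F i = P i"
  by (rule int_induct_mod[of "\<lambda>i. F i = P i", OF assms F_same_step])
    (use F_cong P_cong in simp_all)

text \<open>\<open>F_step\<close> keeps the offset between a pair and its fifth neighbours or lowers
  it by 2, so the least positive offset is constant around the frame. By \<open>F_sym\<close> twice
  the offset is 0 modulo \<open>n\<close>.\<close>

lemma F_trichotomy:
  obtains (outside) "\<And>i j. F i \<inter> P j = {}" | (same) "\<And>i. F i = P i"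
    | (shift) m where "n = 2 * m" "2 \<le> m" "\<And>i. F i = P (i + int m)"
proof -
  define D where "D d \<longleftrightarrow> 0 < d \<and> d < n \<and> (\<exists>j. F j = P (j + int d))" for d
  show ?thesis
  proof (cases "(\<exists>j. F j = P j) \<or> (\<forall>i j. F i \<inter> P j = {})")
    case True
    then show ?thesis using same outside F_same_all by metis
  next
    case False
    then obtain i j where ij: "F i = P j" using F_meets by blast
    then have nd: "\<not> int n dvd j - i" using False P_cong by blast
    define d where "d = nat ((j - i) mod int n)"
    have d: "int d = (j - i) mod int n" using n3 by (simp add: d_def)
    have "int n dvd j - (i + int d)"
      unfolding d by (metis diff_diff_eq minus_mod_eq_mult_div dvd_triv_left)
    then have "F i = P (i + int d)" using ij P_cong by simp
    moreover have "0 < int d" using nd n3 unfolding d by (simp add: order_less_le dvd_eq_mod_eq_0)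
    moreover have "int d < int n" using n3 unfolding d by simp
    ultimately have "D d" unfolding D_def by auto
    then have "\<exists>d. D d" by blast
    define d where "d = (LEAST d. D d)"
    have Dd: "D d" unfolding d_def using \<open>\<exists>d. D d\<close> by (rule LeastI_ex)
    have min: "\<not> D k" if "k < d" for k using that not_less_Least unfolding d_def by blast
    obtain j where j: "F j = P (j + int d)" and d: "0 < d" "d < n" using Dd by (auto simp: D_def)
    have nd: "\<not> int n dvd int d" using n_ndvd d by blast
    have step: "F (i + 1) = P (i + 1 + int d)" if i: "F i = P (i + int d)" for i
    proof (rule ccontr)
      assume no: "F (i + 1) \<noteq> P (i + 1 + int d)"
      then have F1: "F (i + 1) = P (i + int d - 1)"
        using F_step[OF i] nd by (auto simp: algebra_simps)
      have "d \<noteq> 1" using F_notin(1)[of "fst (p i)" i] i by (auto simp: F_def)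
      then consider "d = 2" | "d \<ge> 3" using d by linarith
      then show False
      proof cases
        case 1
        then have "F (i + 1) = P (i + 1)" using F1 by (simp add: algebra_simps)
        then show False using False by blast
      next
        case 2
        then have "D (d - 2)" using F1 d by (auto simp: D_def of_nat_diff algebra_simps intro!: exI[of _ "i + 1"])
        then show False using min[of "d - 2"] d by simp
      qed
    qed
    have all: "F i = P (i + int d)" for i
    proof (rule int_induct_mod[of "\<lambda>i. F i = P (i + int d)", OF j step])
      fix i k :: int assume "int n dvd i - k"
      then show "(F i = P (i + int d)) = (F k = P (k + int d))"
        using F_cong[of i k] P_cong[of "i + int d" "k + int d"] by simp
    qed
    have "P j = P (j + int d + int d)"
      using F_sym[OF all[of j]] all[of "j + int d"] by simp
    then have "int n dvd j - (j + int d + int d)" using P_eq_iff by blast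
    then have "int n dvd int (2 * d)" by (simp add: dvd_diff_commute)
    then have "n dvd 2 * d" by (simp only: int_dvd_int_iff)
    then obtain k where "2 * d = n * k" by (rule dvdE)
    moreover have "k = 1"
      using calculation d by (cases k; cases "k - 1") (auto simp: algebra_simps)
    ultimately have "n = 2 * d" by simp
    then show ?thesis using shift[of d] n3 all by simp
  qed
qed

end

lemma signed_adj_add:
  "signed_adj (add_positive_edges \<Gamma> F) u v = (if (u, v) \<in> F \<union> F\<inverse> then 1 else signed_adj \<Gamma> u v)"
  by (auto simp: signed_adj_def add_positive_edges_def)

lemma signed_adj_of:
  "signed_adj (signed_graph_of I M) u v = (if u \<in> I \<and> v \<in> I then M u v else 0)"
  by (auto simp: signed_adj_def signed_graph_of_def)

lemma pverts_of [simp]: "pverts (ugraph (signed_graph_of I M)) = I"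
  by (simp add: signed_graph_of_def)

section \<open>Pairs of vertices with four common neighbours\<close>

context ortho5
begin

definition D :: "'a \<Rightarrow> 'a \<Rightarrow> bool" where
  "D v w \<longleftrightarrow> v \<noteq> w \<and> card (N v \<inter> N w) = 4"

lemma D_sym: "D v w \<longleftrightarrow> D w v"
  by (auto simp: D_def Int_commute)

lemma finite_N [simp]: "finite (N x)"
  unfolding N_def by (rule finite_nbrs)

text \<open>Four known common neighbours suffice because five are impossible.\<close>

lemma DI:
  assumes "v \<noteq> w" "S \<subseteq> N v" "S \<subseteq> N w" "card S = 4"
  shows "D v w"
proof -
  have "S \<noteq> {}" using assms(4) by auto
  then have V: "v \<in> V" "w \<in> V" using assms(2,3) N_in_V by blast+
  then have c: "card (N v) = 5" "card (N w) = 5" by (simp_all add: N_def A_deg)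
  have "card (N v \<inter> N w) \<le> 5" using card_mono[of "N v" "N v \<inter> N w"] c by simp
  moreover have "card (N v \<inter> N w) \<noteq> 5"
  proof
    assume "card (N v \<inter> N w) = 5"
    then show False using same_five[of "N v \<inter> N w" v w] assms(1) by simp
  qed
  moreover have "4 \<le> card (N v \<inter> N w)"
    using card_mono[of "N v \<inter> N w" S] assms by simp
  ultimately show ?thesis using assms(1) by (simp add: D_def)
qed

text \<open>Four entries 1 or -1 of \<open>v\<close> on a star of \<open>u\<close> sum to 0, so two
  of them are 1. The two neighbours concerned close a positive 4-cycle.\<close>

lemma D_psquare:
  assumes "D u v"
  obtains a b where "psquare u v a b"
proof -
  have "N u \<noteq> {}" using assms by (auto simp: D_def)
  then have "u \<in> V" using N_in_V(1) by blast
  then obtain xs where st: "star (u, False) xs" using star_exists[of "(u, False)"] by auto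
  obtain a b c d e where xs: "xs = [a, b, c, d, e]" using st list5 star_def by blast
  let ?v = "(v, False)"
  have ne: "fst ?v \<noteq> fst (u, False)" using assms by (auto simp: D_def)
  have card: "\<bar>B ?v a\<bar> + \<bar>B ?v b\<bar> + \<bar>B ?v c\<bar> + \<bar>B ?v d\<bar> + \<bar>B ?v e\<bar> = 4"
    using card_common[OF st, of ?v] assms xs by (simp add: D_def N_def Int_def)
  have sum: "B ?v a + B ?v b + B ?v c + B ?v d + B ?v e = 0"
    using star_orth[OF st ne] xs by simp
  have ps: "psquare u v (fst r) (fst s)"
    if "r \<in> set xs" "s \<in> set xs" "fst r \<noteq> fst s" "B ?v r = 1" "B ?v s = 1" for r s
  proof -
    have "B (u, False) r = 1" "B (u, False) s = 1" using st that by (auto simp: star_def)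
    then have "A u (fst r) = sgnb (snd r)" "A u (fst s) = sgnb (snd s)"
      "A v (fst r) = sgnb (snd r)" "A v (fst s) = sgnb (snd s)"
      using that sgnb_cases[of "snd r"] sgnb_cases[of "snd s"] by (auto simp: B_def sgnb_def[of False])
    then show ?thesis using that assms sgnb_cases[of "snd r"] sgnb_cases[of "snd s"]
      by (auto simp: psquare_def D_def)
  qed
  have dist: "distinct (map fst xs)" using st by (simp add: star_def)
  have "(B ?v a = 1 \<and> (B ?v b = 1 \<or> B ?v c = 1 \<or> B ?v d = 1 \<or> B ?v e = 1)) \<or>
    (B ?v b = 1 \<and> (B ?v c = 1 \<or> B ?v d = 1 \<or> B ?v e = 1)) \<or>
    (B ?v c = 1 \<and> (B ?v d = 1 \<or> B ?v e = 1)) \<or> (B ?v d = 1 \<and> B ?v e = 1)"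
    using card sum B_vals[of ?v a] B_vals[of ?v b] B_vals[of ?v c] B_vals[of ?v d] B_vals[of ?v e]
    by (smt (verit))
  note one = this
  have d: "fst a \<noteq> fst b" "fst a \<noteq> fst c" "fst a \<noteq> fst d" "fst a \<noteq> fst e" "fst b \<noteq> fst c" "fst b \<noteq> fst d" "fst b \<noteq> fst e" "fst c \<noteq> fst d" "fst c \<noteq> fst e" "fst d \<noteq> fst e"
    using dist xs by simp_all
  have m: "a \<in> set xs" "b \<in> set xs" "c \<in> set xs" "d \<in> set xs" "e \<in> set xs"
    using xs by simp_all
  show ?thesis
  proof (rule ccontr)
    assume "\<not> ?thesis"
    then have no: "\<not> (B ?v r = 1 \<and> B ?v s = 1)" if "r \<in> set xs" "s \<in> set xs" "fst r \<noteq> fst s" for r s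
      using ps[of r s] that \<open>\<And>a b. psquare u v a b \<Longrightarrow> thesis\<close> by blast
    show False
      using one no[OF m(1) m(2) d(1)] no[OF m(1) m(3) d(2)] no[OF m(1) m(4) d(3)] no[OF m(1) m(5) d(4)] no[OF m(2) m(3) d(5)] no[OF m(2) m(4) d(6)] no[OF m(2) m(5) d(7)] no[OF m(3) m(4) d(8)] no[OF m(3) m(5) d(9)] no[OF m(4) m(5) d(10)]
      by blast
  qed
qed

definition triangle :: bool where
  "triangle \<longleftrightarrow> (\<exists>u v w. D u v \<and> D v w \<and> D u w)"

definition matching :: bool where
  "matching \<longleftrightarrow> (\<exists>u v. D u v) \<and> (\<forall>u v w. D u v \<longrightarrow> D u w \<longrightarrow> v = w)"

lemma D_in_V: "D u v \<Longrightarrow> u \<in> V"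
proof -
  assume "D u v"
  then have "N u \<noteq> {}" by (auto simp: D_def)
  then show ?thesis using N_in_V(1) by blast
qed

end

section \<open>Edges of \<open>D\<close> along a frame\<close>

context framed
begin

lemma D_xy: "D (fst (x j)) (fst (y j))"
  using card_P[of j] N_x[of j] N_y[of j] by (intro DI[of _ _ "P (j + 1) \<union> P (j - 1)"]) auto

text \<open>Elsewhere, \<open>w\<close> would be a fifth common neighbour of \<open>x m\<close> and
  \<open>y m\<close>.\<close>

lemma common_pair:
  assumes "P m \<subseteq> N w"
  shows "w \<in> P (m + 1) \<union> P (m - 1)"
proof (rule ccontr)
  assume no: "w \<notin> P (m + 1) \<union> P (m - 1)"
  then have c: "card (insert w (P (m + 1) \<union> P (m - 1))) = 5"
    using card_P[of m] by (simp add: P_def)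
  have "insert w (P (m + 1) \<union> P (m - 1)) \<subseteq> N z" if "z \<in> P m" for z
    using that assms P_subset_N[of z m] N_sym by blast
  then have "fst (x m) = fst (y m)"
    by (intro same_five[OF _ _ c]) simp_all
  then show False using xy_neq by blast
qed

text \<open>\<open>s\<close> is the direction from \<open>i\<close> to \<open>w\<close>. The
  neighbours of \<open>w\<close> are the pairs i + s and i + 3 s and a single further vertex, which
  cannot accommodate both vertices of \<open>P (i - s)\<close> or of \<open>F i\<close>.\<close>

lemma D_outside_aux:
  assumes s: "s = 1 \<or> s = -1" and w: "w \<in> P (i + 2 * s)" and ne: "w \<notin> P i"
    and h: "(F i \<inter> N w = {} \<and> P (i - s) \<subseteq> N w) \<or> F i \<subseteq> N w"
  shows "n = 4 \<or> F i = P (i + 3 * s)"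
proof -
  have "\<exists>z. N w = P (i + 2 * s + 1) \<union> P (i + 2 * s - 1) \<union> {z}"
    using w N_x[of "i + 2 * s"] N_y[of "i + 2 * s"] unfolding P_def[of "i + 2 * s"] by blast
  moreover have "P (i + 2 * s + 1) \<union> P (i + 2 * s - 1) = P (i + s) \<union> P (i + 3 * s)"
    using s by (auto simp: algebra_simps)
  ultimately have "\<exists>z. N w = P (i + s) \<union> P (i + 3 * s) \<union> {z}" by simp
  then obtain z where Nw: "N w = P (i + s) \<union> P (i + 3 * s) \<union> {z}" by blast
  from h show ?thesis
  proof
    assume "F i \<inter> N w = {} \<and> P (i - s) \<subseteq> N w"
    then have sub: "P (i - s) \<subseteq> P (i + s) \<union> P (i + 3 * s) \<union> {z}" using Nw by blast
    have "P (i - s) \<inter> P (i + s) = {}"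
      using P_disj[of _ "i - s" "i + s"] s by auto
    then have "\<exists>v. v \<in> P (i - s) \<inter> P (i + 3 * s)"
      using sub xy_neq[of "i - s" "i - s"] x_in_P[of "i - s"] y_in_P[of "i - s"] by blast
    then have "int n dvd (i - s) - (i + 3 * s)" using P_disj by blast
    moreover have "(i - s) - (i + 3 * s) = - 4 * s" by simp
    ultimately have "int n dvd 4" using s by auto
    then have "n = 4" using n3 zdvd_imp_le[of "int n" 4] by (cases "n = 3") auto
    then show ?thesis by simp
  next
    assume "F i \<subseteq> N w"
    moreover have "F i \<inter> P (i + s) = {}" using F_notin[of _ i] s by auto
    ultimately have "\<exists>v. v \<in> F i \<inter> P (i + 3 * s)"
      using Nw p_neq_q[of i] by (auto simp: F_def)
    then show ?thesis using F_meets by blast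
  qed
qed

text \<open>\<open>w\<close> misses just one of the five neighbours of \<open>v\<close>. By
  \<open>third\<close> it is then adjacent to a whole pair next to \<open>i\<close>, hence lies in
  the pair two steps away, where \<open>D_outside_aux\<close> applies.\<close>

lemma D_outside:
  assumes D: "D v w" and v: "v \<in> P i" and w: "w \<notin> P i"
  shows "n = 4 \<or> F i = P (i + 3) \<or> F i = P (i - 3)"
proof -
  obtain e where e: "N v = P (i + 1) \<union> P (i - 1) \<union> {e}" "e \<in> F i" "e \<notin> P (i + 1)" "e \<notin> P (i - 1)"
    using v N_x[of i] N_y[of i] pq_notin[of i] by (auto simp: P_def[of i] F_def)
  have eF: "e \<in> N w \<longleftrightarrow> F i \<subseteq> N w" "e \<notin> N w \<longleftrightarrow> F i \<inter> N w = {}"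
    using third(1)[OF w] e(2) by (auto simp: F_def)
  have P1: "P (i + 1) \<subseteq> N w \<longleftrightarrow> fst (x (i + 1)) \<in> N w \<and> fst (y (i + 1)) \<in> N w"
    "P (i - 1) \<subseteq> N w \<longleftrightarrow> fst (x (i - 1)) \<in> N w \<and> fst (y (i - 1)) \<in> N w" by (auto simp: P_def)
  have miss: "r = s" if "r \<in> N v" "s \<in> N v" "r \<notin> N w" "s \<notin> N w" for r s
  proof (rule ccontr)
    assume rs: "r \<noteq> s"
    have "v \<in> V" using D D_in_V by blast
    then have "card (N v - {r, s}) = 3"
      using that rs by (simp add: card_Diff_subset N_def A_deg)
    moreover have "N v \<inter> N w \<subseteq> N v - {r, s}" using that by blast
    then have "card (N v \<inter> N w) \<le> card (N v - {r, s})" by (intro card_mono) simp_all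
    ultimately show False using D by (simp add: D_def)
  qed
  have pF: "fst (p i) \<in> F i" by (simp add: F_def)
  have "\<exists>s. (s = 1 \<or> s = -1) \<and> P (i + s) \<subseteq> N w \<and>
    ((F i \<inter> N w = {} \<and> P (i - s) \<subseteq> N w) \<or> F i \<subseteq> N w)"
  proof (cases "e \<in> N w")
    case False
    have "r \<in> N w" if "r \<in> P (i + 1) \<union> P (i - 1)" for r
    proof (rule ccontr)
      assume "r \<notin> N w"
      then have "r = e" using miss[of r e] e(1) that False by blast
      then show False using that e by blast
    qed
    then show ?thesis using False eF by (intro exI[of _ 1]) auto
  next
    case True
    then have Fw: "F i \<subseteq> N w" using eF by blast
    then have x4: "(fst (x (i + 1)) \<in> N w \<longleftrightarrow> fst (y (i + 1)) \<in> N w) \<noteq>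
        (fst (x (i - 1)) \<in> N w \<longleftrightarrow> fst (y (i - 1)) \<in> N w)"
      using third(4)[OF w] pF by blast
    have "\<not> (fst (x k) \<notin> N w \<and> fst (y k) \<notin> N w)" if "k = i + 1 \<or> k = i - 1" for k
    proof -
      have "fst (x k) \<in> N v" "fst (y k) \<in> N v"
        unfolding e(1) using that x_in_P[of k] y_in_P[of k] by blast+
      then show ?thesis using miss xy_neq by blast
    qed
    then have "P (i + 1) \<subseteq> N w \<or> P (i - 1) \<subseteq> N w" using x4 P1 by blast
    then show ?thesis
    proof
      assume "P (i + 1) \<subseteq> N w" then show ?thesis using Fw by blast
    next
      assume "P (i - 1) \<subseteq> N w" then show ?thesis using Fw by (intro exI[of _ "-1"]) simp
    qed
  qed
  then obtain s where s: "s = 1 \<or> s = -1" "P (i + s) \<subseteq> N w"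
    "(F i \<inter> N w = {} \<and> P (i - s) \<subseteq> N w) \<or> F i \<subseteq> N w" by blast
  have "i + s + 1 = i + 2 * s \<and> i + s - 1 = i \<or> i + s + 1 = i \<and> i + s - 1 = i + 2 * s"
    using s(1) by auto
  then have "w \<in> P (i + 2 * s)"
  proof (elim disjE conjE)
    assume e: "i + s + 1 = i + 2 * s" "i + s - 1 = i"
    then show ?thesis using common_pair[OF s(2)] w unfolding e by blast
  next
    assume e: "i + s + 1 = i" "i + s - 1 = i + 2 * s"
    then show ?thesis using common_pair[OF s(2)] w unfolding e by blast
  qed
  from D_outside_aux[OF s(1) this w s(3)] s(1) show ?thesis by (elim disjE) simp_all
qed

text \<open>A fifth neighbour at i + 1 has entries 1 and 0 on the pair i + 1, and the rows of the
  pair i then force -1 at \<open>p i\<close> and 1 at \<open>q i\<close>. The order is reversed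
  because the fifth neighbours carry the negated signs, like the second block of
  \<open>box_K2\<close>.\<close>

lemma pq_fwd: "square (q i) (p i) (q (i + 1)) (p (i + 1))"
proof -
  have "B (p i) w = -1 \<and> B (q i) w = 1" if w: "w = p (i + 1) \<or> w = q (i + 1)" for w
  proof -
    have notin: "fst w \<notin> P i" "fst w \<notin> P (i + 2)"
      using w pq_notin[of "i + 1"] by (auto simp: algebra_simps)
    then have ne: "fst w \<noteq> fst (x i)" "fst w \<noteq> fst (y i)" by (auto simp: P_def)
    have "fst (q (i + 1)) \<notin> N (fst (x (i + 1)))" "fst (p (i + 1)) \<notin> N (fst (y (i + 1)))"
      using N_x[of "i + 1"] N_y[of "i + 1"] p_neq_q[of "i + 1"] pq_notin[of "i + 1"] by auto
    then have "B (q (i + 1)) (x (i + 1)) = 0" "B (p (i + 1)) (y (i + 1)) = 0"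
      using B_N B_sym by metis+
    then have "B w (x (i + 1)) + B w (y (i + 1)) = 1"
      using w B_sym[of "p (i + 1)" "x (i + 1)"] B_sym[of "q (i + 1)" "y (i + 1)"] by auto
    then have "B w (p i) = -1 \<and> B w (q i) = 1"
      using orth_x[OF ne(1)] orth_y[OF ne(2)] B_vals[of w "p i"] B_vals[of w "q i"]
      by (smt (verit))
    then show ?thesis using B_sym[of w] by simp
  qed
  then show ?thesis
    using p_neq_q[of i] p_neq_q[of "i + 1"] by (auto simp: square_def)
qed

lemma pq_cong: "int n dvd i - j \<Longrightarrow> p i = p j \<and> q i = q j"
proof -
  assume "int n dvd i - j"
  moreover from this have "int n dvd (i + 1) - (j + 1)" "int n dvd (i - 1) - (j - 1)" by simp_all
  ultimately show ?thesis unfolding p_def q_def using per by presburger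
qed

section \<open>Recognizing the three families\<close>

definition g :: "nat \<times> nat \<Rightarrow> 'a \<times> bool" where
  "g v = (if fst v = 0 then x (int (snd v)) else y (int (snd v)))"

lemma per_mod:
  "x (int (k mod n)) = x (int k)" "y (int (k mod n)) = y (int k)"
  "p (int (k mod n)) = p (int k)" "q (int (k mod n)) = q (int k)"
proof -
  have "int n dvd int (k mod n) - int k"
    unfolding mod_eq_dvd_iff[symmetric] by (simp add: zmod_int)
  from per[OF this] pq_cong[OF this] show
    "x (int (k mod n)) = x (int k)" "y (int (k mod n)) = y (int k)"
    "p (int (k mod n)) = p (int k)" "q (int (k mod n)) = q (int k)" by simp_all
qed

lemma int_dvd_less: "int n dvd int i - int j \<Longrightarrow> i < n \<Longrightarrow> j < n \<Longrightarrow> i = j"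
  unfolding mod_eq_dvd_iff[symmetric] by simp

lemma inj_g: "inj_on (fst \<circ> g) ({0, 1} \<times> {..<n})"
proof (rule inj_onI)
  fix u v assume "u \<in> {0, 1} \<times> {..<n}" "v \<in> {0, 1} \<times> {..<n}" "(fst \<circ> g) u = (fst \<circ> g) v"
  then show "u = v"
    using x_inj[of "int (snd u)" "int (snd v)"] y_inj[of "int (snd u)" "int (snd v)"]
      int_dvd_less[of "snd u" "snd v"]
    by (auto simp: g_def prod_eq_iff split: if_splits)
qed

lemma T_edge:
  assumes "T_matrix n u v \<noteq> 0" "fst u \<in> {0, 1}" "fst v \<in> {0, 1}"
  shows "B (g u) (g v) = T_matrix n u v"
proof -
  obtain a i b j where uv: "u = (a, i)" "v = (b, j)" by fastforce
  consider "j = (i + 1) mod n" | "j \<noteq> (i + 1) mod n" "i = (j + 1) mod n"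
    using assms(1) unfolding uv T_matrix.simps by presburger
  then show ?thesis
  proof cases
    case 1
    then have "x (int j) = x (int i + 1)" "y (int j) = y (int i + 1)"
      using per_mod[of "i + 1"] by (simp_all add: add.commute)
    then show ?thesis using 1 assms(2,3) uv by (auto simp: g_def)
  next
    case 2
    then have "x (int i) = x (int j + 1)" "y (int i) = y (int j + 1)"
      using per_mod[of "j + 1"] by (simp_all add: add.commute)
    then show ?thesis using 2 assms(2,3) uv B_sym[of "g u" "g v"] by (auto simp: g_def)
  qed
qed

text \<open>Subtraction on naturals truncates, so the preceding position is written with
  \<open>+ n\<close>.\<close>

definition T_nbrs :: "nat \<Rightarrow> (nat \<times> nat) set" where
  "T_nbrs i = {0, 1} \<times> {(i + 1) mod n, (i + n - 1) mod n}"

lemma pred_succ_mod: "i < n \<Longrightarrow> ((i + n - 1) mod n + 1) mod n = i"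
  using n3 by (simp add: mod_simps)

lemma T_nbrs_props:
  assumes "i < n"
  shows "finite (T_nbrs i)" "card (T_nbrs i) = 4" "T_nbrs i \<subseteq> {0, 1} \<times> {..<n}"
    "v \<in> T_nbrs i \<Longrightarrow> T_matrix n (a, i) v \<noteq> 0" "(b, i) \<notin> T_nbrs i"
proof -
  have s: "(i + 1) mod n = (if i + 1 = n then 0 else i + 1)"
    "(i + n - 1) mod n = (if i = 0 then n - 1 else i - 1)"
    using assms n3 by (auto simp: mod_if)
  show "finite (T_nbrs i)" by (simp add: T_nbrs_def)
  have "(i + 1) mod n \<noteq> (i + n - 1) mod n" using s assms n3 by auto
  then show "card (T_nbrs i) = 4" by (simp add: T_nbrs_def card_cartesian_product)
  show "T_nbrs i \<subseteq> {0, 1} \<times> {..<n}" using n3 by (auto simp: T_nbrs_def)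
  show "(b, i) \<notin> T_nbrs i" unfolding T_nbrs_def s using assms n3 by (auto split: if_splits)
  assume "v \<in> T_nbrs i"
  then show "T_matrix n (a, i) v \<noteq> 0"
    using pred_succ_mod[OF assms] by (cases v) (auto simp: T_nbrs_def)
qed

text \<open>The frame provides the edges of \<open>T n\<close>. \<open>R\<close> consists of the
  arcs of the fifth edges, and an arc at each vertex that leaves \<open>T_nbrs\<close> brings all
  degrees to five, as recognition requires.\<close>

lemma equiv_T:
  assumes V: "pverts (ugraph \<Gamma>') = {0, 1} \<times> {..<n}"
    and M: "\<And>u v. u \<in> {0, 1} \<times> {..<n} \<Longrightarrow> v \<in> {0, 1} \<times> {..<n} \<Longrightarrow>
      signed_adj \<Gamma>' u v = (if (u, v) \<in> R then 1 else T_matrix n u v)"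
    and R: "\<And>u v. u \<in> {0, 1} \<times> {..<n} \<Longrightarrow> (u, v) \<in> R \<Longrightarrow> B (g u) (g v) = 1"
    and R_ex: "\<And>a i. a \<in> {0, 1::nat} \<Longrightarrow> i < n \<Longrightarrow> \<exists>v\<in>{0, 1} \<times> {..<n}. ((a, i), v) \<in> R \<and> v \<notin> T_nbrs i"
  shows "equiv_to \<Gamma>'"
proof (rule equiv_toI[of \<Gamma>' g, unfolded V])
  show "finite ({0, 1::nat} \<times> {..<n})" "{0, 1::nat} \<times> {..<n} \<noteq> {}" using n3 by (auto simp: lessThan_empty_iff)
  show "inj_on (fst \<circ> g) ({0, 1} \<times> {..<n})" by (rule inj_g)
  show "B (g u) (g v) = signed_adj \<Gamma>' u v"
    if uv: "u \<in> {0, 1} \<times> {..<n}" "v \<in> {0, 1} \<times> {..<n}" "signed_adj \<Gamma>' u v \<noteq> 0" for u v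
    using R[OF uv(1), of v] T_edge[of u v] uv(3) uv(1,2) unfolding M[OF uv(1,2)] by (auto split: if_splits)
  show "5 \<le> card {v \<in> {0, 1} \<times> {..<n}. signed_adj \<Gamma>' u v \<noteq> 0}" if u: "u \<in> {0, 1} \<times> {..<n}" for u
  proof -
    obtain a i where ai: "u = (a, i)" "a \<in> {0, 1}" "i < n" using u by auto
    obtain v where v: "v \<in> {0, 1} \<times> {..<n}" "(u, v) \<in> R" "v \<notin> T_nbrs i"
      using R_ex[OF ai(2,3)] ai(1) by blast
    have "signed_adj \<Gamma>' u w \<noteq> 0" if "w \<in> insert v (T_nbrs i)" for w
    proof (cases "w = v")
      case True
      then show ?thesis using M[OF u v(1)] v(2) by simp
    next
      case False
      then have "w \<in> T_nbrs i" using that by simp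
      then have "w \<in> {0, 1} \<times> {..<n}" "T_matrix n u w \<noteq> 0"
        using T_nbrs_props(3,4)[OF ai(3)] ai(1) by blast+
      then show ?thesis using M[OF u, of w] by presburger
    qed
    then have "insert v (T_nbrs i) \<subseteq> {v \<in> {0, 1} \<times> {..<n}. signed_adj \<Gamma>' u v \<noteq> 0}"
      using v(1) T_nbrs_props(3)[OF ai(3)] by blast
    then have "card (insert v (T_nbrs i)) \<le> card {v \<in> {0, 1} \<times> {..<n}. signed_adj \<Gamma>' u v \<noteq> 0}"
      by (rule card_mono[rotated]) simp
    then show ?thesis using v(3) T_nbrs_props(1,2)[OF ai(3)] by simp
  qed
qed

lemma signed_adj_T [simp]:
  "signed_adj (T n) u v = (if u \<in> {0, 1} \<times> {..<n} \<and> v \<in> {0, 1} \<times> {..<n} then T_matrix n u v else 0)"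
  by (simp add: T_def signed_graph_of_def signed_adj_def)

lemma pverts_T [simp]: "pverts (ugraph (T n)) = {0, 1} \<times> {..<n}"
  by (simp add: T_def signed_graph_of_def)

lemma equiv_T_plus:
  assumes "\<And>i. B (x i) (y i) = 1"
  shows "equiv_to (T_plus n)"
proof (rule equiv_T)
  let ?R = "{((0, j), (1, j)) | j. j < n} \<union> {((0, j), (1, j)) | j. j < n}\<inverse>"
  show "pverts (ugraph (T_plus n)) = {0, 1} \<times> {..<n}"
    by (simp add: T_plus_def add_positive_edges_def)
  show "signed_adj (T_plus n) u v = (if (u, v) \<in> ?R then 1 else T_matrix n u v)"
    if "u \<in> {0, 1} \<times> {..<n}" "v \<in> {0, 1} \<times> {..<n}" for u v
    unfolding T_plus_def signed_adj_add signed_adj_T by (simp only: that simp_thms if_True)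
  show "B (g u) (g v) = 1" if "(u, v) \<in> ?R" for u v
  proof -
    have "B (y i) (x i) = 1" for i using assms B_sym by simp
    then show ?thesis using that assms by (auto simp: g_def)
  qed
  show "\<exists>v\<in>{0, 1} \<times> {..<n}. ((a, i), v) \<in> ?R \<and> v \<notin> T_nbrs i"
    if "a \<in> {0, 1}" "i < n" for a i :: nat
    using that T_nbrs_props(5)[OF that(2)] by (intro bexI[of _ "(1 - a, i)"]) auto
qed

lemma equiv_T_star:
  assumes n: "n = 2 * m" "2 \<le> m"
    and c: "\<And>i. i < m \<Longrightarrow> B (x (int i)) (y (int (i + m))) = 1"
      "\<And>i. i < m \<Longrightarrow> B (y (int i)) (x (int (i + m))) = 1"
  shows "equiv_to (T_star m)"
proof (rule equiv_T)
  let ?F = "{((0, j), (1, j + m)) | j. j < m} \<union> {((1, j), (0, j + m)) | j. j < m}"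
  show "pverts (ugraph (T_star m)) = {0, 1} \<times> {..<n}"
    by (simp add: T_star_def add_positive_edges_def flip: n(1))
  show "signed_adj (T_star m) u v = (if (u, v) \<in> ?F \<union> ?F\<inverse> then 1 else T_matrix n u v)"
    if "u \<in> {0, 1} \<times> {..<n}" "v \<in> {0, 1} \<times> {..<n}" for u v
    unfolding T_star_def n(1)[symmetric] signed_adj_add signed_adj_T
    by (simp only: that simp_thms if_True)
  show "B (g u) (g v) = 1" if "(u, v) \<in> ?F \<union> ?F\<inverse>" for u v
  proof -
    have "B (y (int (i + m))) (x (int i)) = 1" "B (x (int (i + m))) (y (int i)) = 1" if "i < m" for i
      using c that B_sym by simp_all
    then show ?thesis using that c by (auto simp: g_def)
  qed
  show "\<exists>v\<in>{0, 1} \<times> {..<n}. ((a, i), v) \<in> ?F \<union> ?F\<inverse> \<and> v \<notin> T_nbrs i"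
    if ai: "a \<in> {0, 1}" "i < n" for a i :: nat
  proof -
    define k where "k = (if i < m then i + m else i - m)"
    have k: "k < n" "k \<noteq> (i + 1) mod n" "k \<noteq> (i + n - 1) mod n"
      using ai n by (auto simp: k_def mod_if)
    have "((a, i), (1 - a, k)) \<in> ?F \<union> ?F\<inverse>"
    proof (cases "i < m")
      case False
      then have "i = k + m" "k < m" using ai n by (auto simp: k_def)
      then show ?thesis using ai(1) by auto
    qed (use ai(1) in \<open>auto simp: k_def\<close>)
    then show ?thesis using k ai(1) by (intro bexI[of _ "(1 - a, k)"]) (auto simp: T_nbrs_def)
  qed
qed

end

section \<open>Fifth edges inside pairs, between opposite pairs, and to a second frame\<close>

context framed
begin

text \<open>The rows of pair i at \<open>x (i + 1)\<close> show that the edges inside the pairs have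
  a common sign. If it is -1, running through the frame backwards with all \<open>y\<close> negated
  gives a frame again and makes the sign 1.\<close>

lemma same_plus:
  assumes F: "\<And>i. F i = P i"
  shows "equiv_to (T_plus n)"
proof -
  define s where "s i = B (x i) (y i)" for i
  have pq: "fst (p i) = fst (y i)" "fst (q i) = fst (x i)" for i
    using F[of i] N_x[of i] N_y[of i] N_irrefl[of "fst (x i)"] N_irrefl[of "fst (y i)"]
    by (auto simp: F_def P_def doubleton_eq_iff simp del: N_irrefl)
  have ps: "p i = y i \<and> q i = x i \<and> s i = 1 \<or> p i = neg (y i) \<and> q i = neg (x i) \<and> s i = -1" for i
    using fst_eq_imp[OF pq(1)[of i]] fst_eq_imp[OF pq(2)[of i]] B_p[of i] B_q[of i] B_sym[of "x i" "y i"]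
    by (auto simp: s_def simp del: B_p B_q)
  have step: "s (i + 1) = s i" for i
  proof -
    let ?w = "x (i + 1)"
    have ne: "fst ?w \<noteq> fst (x i)" using x_inj[of "i + 1" i] n3 by auto
    have "B ?w (p i) = - s i" "B ?w (q i) = s i"
      using ps[of i] B_sym[of ?w "x i"] B_sym[of ?w "y i"] by auto
    then show ?thesis
      using orth_x[OF ne] orth_y[of ?w i] by (simp add: s_def)
  qed
  have s0: "s i = s 0" for i
    by (rule int_induct_mod[of "\<lambda>i. s i = s 0" 0]) (use step per in \<open>simp_all add: s_def\<close>)
  show ?thesis
  proof (cases "s 0 = 1")
    case True
    then show ?thesis using s0 by (intro equiv_T_plus) (simp add: s_def)
  next
    case False
    then have s: "B (x i) (y i) = -1" for i using s0[of i] ps[of 0] by (auto simp: s_def)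
    define x' where "x' i = x (- i)" for i
    define y' where "y' i = neg (y (- i))" for i
    interpret R: framed V A n x' y'
    proof
      have "square (x' j) (y' j) (x' (j + 1)) (y' (j + 1))" for j
        using B_bwd[of "- j"] xy_neq[of "- j" "- j"] xy_neq[of "- j - 1" "- j - 1"]
        by (simp add: square_def x'_def y'_def)
      moreover have "x' (j + int n) = x' j \<and> y' (j + int n) = y' j" for j
        using per[of "- j - int n" "- j"] by (simp add: x'_def y'_def)
      moreover have "int n dvd i - j" if "fst (x' i) = fst (x' j)" for i j
        using x_inj[of "- i" "- j"] that by (simp add: x'_def dvd_diff_commute)
      moreover have "int n dvd i - j" if "fst (y' i) = fst (y' j)" for i j
        using y_inj[of "- i" "- j"] that by (simp add: y'_def dvd_diff_commute)
      ultimately show "frame n x' y'"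
        unfolding frame_def using n3 by (simp add: x'_def y'_def)
    qed
    show ?thesis by (rule R.equiv_T_plus) (simp add: x'_def y'_def s)
  qed
qed

lemma V_frame:
  assumes "\<And>i. F i = P (i + c)"
  shows "V = (\<Union>i. P i)"
proof (rule sym, rule A_conn)
  have N: "N v \<subseteq> (\<Union>i. P i)" if "v \<in> P i" for v i
  proof -
    have "fst (p i) \<in> P (i + c)" "fst (q i) \<in> P (i + c)" using assms[of i] by (auto simp: F_def)
    then have "N v \<subseteq> P (i + 1) \<union> P (i - 1) \<union> P (i + c)"
      using that N_x[of i] N_y[of i] by (auto simp: P_def[of i])
    then show ?thesis by blast
  qed
  show "(\<Union>i. P i) \<subseteq> V"
    using P_subset_N N_in_V(1) x_in_P by blast
  show "w \<in> (\<Union>i. P i)" if v: "v \<in> (\<Union>i. P i)" "A v w \<noteq> 0" for v w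
  proof -
    obtain i where "v \<in> P i" using v(1) by blast
    then show ?thesis using N[of v i] v(2) unfolding N_def by blast
  qed
qed (simp add: P_def)

lemma matching_frame:
  assumes V: "V = (\<Union>i. P i)" and n4: "n \<noteq> 4"
    and F3: "\<And>i. F i \<noteq> P (i + 3)" "\<And>i. F i \<noteq> P (i - 3)"
  shows "matching"
  unfolding matching_def
proof (intro conjI allI impI)
  show "\<exists>u v. D u v" using D_xy by blast
  fix u v w assume D: "D u v" "D u w"
  then obtain i where u: "u \<in> P i" using V D_in_V by blast
  then have "v \<in> P i" "w \<in> P i" using D_outside D n4 F3 by blast+
  moreover have "v \<noteq> u" "w \<noteq> u" using D by (auto simp: D_def)
  ultimately show "v = w" using u by (auto simp: P_def)
qed

lemma triangleI:
  assumes "D (fst (x i)) w" "D (fst (y i)) w"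
  shows "triangle"
  unfolding triangle_def using D_xy[of i] assms by blast

text \<open>For n = 4 the pairs 0 and 2 are both adjacent to all of the pairs 1 and 3.\<close>

lemma triangle_4:
  assumes "n = 4"
  shows "triangle"
proof (rule triangleI[of 0 "fst (x 2)"])
  have P3: "P (2 + 1) = P (- 1)" using P_cong[of 3 "- 1"] assms by simp
  have c: "card (P 1 \<union> P (- 1)) = 4" using card_P[of 0] by simp
  have N2: "P 1 \<union> P (- 1) \<subseteq> N (fst (x 2))" using N_x[of 2] P3 by auto
  have ne: "fst (x 0) \<noteq> fst (x 2)" using x_inj[of 0 2] assms by auto
  show "D (fst (x 0)) (fst (x 2))" using N_x[of 0] by (intro DI[OF ne _ N2 c]) auto
  show "D (fst (y 0)) (fst (x 2))" using N_y[of 0] by (intro DI[OF _ _ N2 c]) auto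
qed

text \<open>Here the graph is complete on six vertices, so any two vertices share the other
  four.\<close>

lemma triangle_3_same:
  assumes "n = 3" and F: "\<And>i. F i = P i"
  shows "triangle"
proof (rule triangleI[of 0 "fst (x 1)"])
  have P3: "P 2 = P (- 1)" using P_cong[of 2 "- 1"] assms by simp
  have pq: "fst (p i) = fst (y i)" "fst (q i) = fst (x i)" for i
    using F[of i] N_x[of i] N_y[of i] N_irrefl[of "fst (x i)"] N_irrefl[of "fst (y i)"]
    by (auto simp: F_def P_def doubleton_eq_iff simp del: N_irrefl)
  have Nx: "N (fst (x 0)) = P 1 \<union> P (- 1) \<union> {fst (y 0)}"
    and Ny: "N (fst (y 0)) = P 1 \<union> P (- 1) \<union> {fst (x 0)}"
    and N1: "N (fst (x 1)) = P (- 1) \<union> P 0 \<union> {fst (y 1)}"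
    using N_x[of 0] N_y[of 0] N_x[of 1] pq P3 by simp_all
  have ne: "fst (x 0) \<noteq> fst (x 1)" "fst (y 0) \<noteq> fst (y 1)"
    using x_inj[of 0 1] y_inj[of 0 1] n3 by auto
  have d: "P (- 1) \<inter> P 1 = {}" "P (- 1) \<inter> P 0 = {}" using P_disj[of _ "- 1" 1] P_adj(1)[of _ "- 1"] by auto
  have c2: "card (P (- 1)) = 2" "finite (P (- 1))" by (simp_all add: P_def)
  have y0: "fst (y 0) \<notin> P (- 1)" "fst (x 0) \<notin> P (- 1)" "fst (y 1) \<notin> P (- 1)"
    using d x_in_P[of 0] y_in_P[of 0] y_in_P[of 1] by blast+
  show "D (fst (x 0)) (fst (x 1))"
    by (rule DI[of _ _ "P (- 1) \<union> {fst (y 0), fst (y 1)}"])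
      (use Nx N1 ne c2 y0 in \<open>auto simp: P_def[of 0] P_def[of 1]\<close>)
  show "D (fst (y 0)) (fst (x 1))"
    by (rule DI[of _ _ "P (- 1) \<union> {fst (x 0), fst (y 1)}"])
      (use Ny N1 ne c2 y0 in \<open>auto simp: P_def[of 0] P_def[of 1]\<close>)
qed

text \<open>The vertices 0 and 2 share pair 1; moreover the fifth neighbour of each lies in a pair
  next to the other, namely 3 and 5.\<close>

lemma triangle_6_shift:
  assumes "n = 6" and F: "\<And>i. F i = P (i + 3)"
  shows "triangle"
proof (rule triangleI[of 0 "fst (x 2)"])
  have P5: "P 5 = P (- 1)" using P_cong[of 5 "- 1"] assms by simp
  have F0: "fst (p 0) \<in> P 3" "fst (q 0) \<in> P 3" "fst (p 2) \<in> P (- 1)"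
    using F[of 0] F[of 2] P5 by (auto simp: F_def)
  have Nx: "N (fst (x 0)) = P 1 \<union> P (- 1) \<union> {fst (p 0)}"
    and Ny: "N (fst (y 0)) = P 1 \<union> P (- 1) \<union> {fst (q 0)}"
    and N2: "N (fst (x 2)) = P 3 \<union> P 1 \<union> {fst (p 2)}"
    using N_x[of 0] N_y[of 0] N_x[of 2] by simp_all
  have d: "P 1 \<inter> P 3 = {}" "P 1 \<inter> P (- 1) = {}" "P 3 \<inter> P (- 1) = {}"
    using P_disj[of _ 1 3] P_disj[of _ 1 "- 1"] P_disj[of _ 3 "- 1"] assms by auto
  have c2: "card (P 1) = 2" "finite (P 1)" by (simp_all add: P_def)
  have ne: "fst (x 0) \<noteq> fst (x 2)" using x_inj[of 0 2] assms by auto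
  have z: "fst (p 0) \<notin> P 1" "fst (q 0) \<notin> P 1" "fst (p 2) \<notin> P 1" "fst (p 0) \<noteq> fst (p 2)" "fst (q 0) \<noteq> fst (p 2)"
    using d F0 by (metis disjoint_iff)+
  show "D (fst (x 0)) (fst (x 2))"
    by (rule DI[of _ _ "P 1 \<union> {fst (p 0), fst (p 2)}"]) (use Nx N2 ne c2 z F0 in auto)
  show "D (fst (y 0)) (fst (x 2))"
    by (rule DI[of _ _ "P 1 \<union> {fst (q 0), fst (p 2)}"]) (use Ny N2 c2 z F0 in auto)
qed

text \<open>The pairs in the second half of the frame are replaced by \<open>q i\<close>,
  \<open>p i\<close>, the fifth neighbours of the first half. Then all fifth edges are positive by
  construction, and only the two seams between the halves need checking.\<close>

lemma shift_frame:
  assumes n: "n = 2 * m" "2 \<le> m" and F: "\<And>i. F i = P (i + int m)"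
  shows "equiv_to (T_star m)"
proof -
  let ?l = "int m - 1"
  have Fm: "{fst (q 0), fst (p 0)} = P (int m)" using F[of 0] by (auto simp: F_def)
  have cl: "square (x ?l) (y ?l) (q 0) (p 0) \<or> square (y ?l) (x ?l) (q 0) (p 0)"
  proof (rule square_close)
    show "square (q 0) (p 0) (q 1) (p 1)" using pq_fwd[of 0] by simp
    show "square (x ?l) (y ?l) (x (int m)) (y (int m))" using sq[of ?l] by simp
    show "{fst (x (int m)), fst (y (int m))} = {fst (q 0), fst (p 0)}" using Fm by (simp add: P_def)
    have "{fst (q 1), fst (p 1)} = P (int m + 1)" using F[of 1] by (auto simp: F_def add.commute)
    then show "{fst (q 1), fst (p 1)} \<inter> {fst (x ?l), fst (y ?l)} = {}"
      using P_disj[of _ "int m + 1" ?l] by (auto simp flip: P_def)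
  qed simp
  \<comment> \<open>The square at the first seam may have \<open>x ?l\<close> and
    \<open>y ?l\<close> reversed. Exchanging them, and with them \<open>p ?l\<close> and
    \<open>q ?l\<close>, repairs both seams at once; \<open>e\<close> is the sign of
    \<open>x ?l\<close> at the seam.\<close>
  define sw where "sw \<longleftrightarrow> \<not> square (x ?l) (y ?l) (q 0) (p 0)"
  define e :: int where "e = (if sw then -1 else 1)"
  have Bl: "B (x ?l) (q 0) = e" "B (x ?l) (p 0) = e"
    using cl squareD(1-4)[of "x ?l" "y ?l" "q 0" "p 0"] squareD(1-4)[of "y ?l" "x ?l" "q 0" "p 0"]
    unfolding e_def sw_def by auto
  have Bm: "B (x ?l) (x (int m)) = 1" "B (x ?l) (y (int m)) = 1"
    using B_fwd(1,2)[of ?l] by simp_all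
  have qpm: "q 0 = x (int m) \<and> p 0 = y (int m) \<and> e = 1 \<or> q 0 = y (int m) \<and> p 0 = x (int m) \<and> e = 1 \<or>
      q 0 = neg (x (int m)) \<and> p 0 = neg (y (int m)) \<and> e = -1 \<or>
      q 0 = neg (y (int m)) \<and> p 0 = neg (x (int m)) \<and> e = -1"
  proof -
    have "fst (q 0) = fst (x (int m)) \<and> fst (p 0) = fst (y (int m)) \<or>
        fst (q 0) = fst (y (int m)) \<and> fst (p 0) = fst (x (int m))"
      using Fm unfolding P_def by (simp add: doubleton_eq_iff)
    then show ?thesis
      using fst_eq_imp[of "q 0" "x (int m)"] fst_eq_imp[of "q 0" "y (int m)"]
        fst_eq_imp[of "p 0" "x (int m)"] fst_eq_imp[of "p 0" "y (int m)"] Bl Bm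
      by auto
  qed
  \<comment> \<open>The second seam follows from the first: \<open>x 0\<close> and
    \<open>y 0\<close> each see one of \<open>q 0\<close>, \<open>p 0\<close> with sign 1, so the
    rows of \<open>x ?l\<close> and \<open>y ?l\<close> determine their entries at
    \<open>p ?l\<close> and \<open>q ?l\<close>.\<close>
  have bk: "B w (p ?l) = - e \<and> B w (q ?l) = e" if w: "w = x 0 \<or> w = y 0" for w
  proof -
    have "\<not> int n dvd 0 - ?l" using n_ndvd(2)[of "m - 1"] n by (simp add: of_nat_diff)
    then have "fst w \<notin> P ?l" using w P_disj[of "fst w" 0 ?l] by auto
    then have ne: "fst w \<noteq> fst (x ?l)" "fst w \<noteq> fst (y ?l)" by (auto simp: P_def)
    have "fst (q 0) \<notin> N (fst (x 0))" "fst (p 0) \<notin> N (fst (y 0))"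
      using N_x[of 0] N_y[of 0] p_neq_q[of 0] pq_notin[of 0] by auto
    then have "B (x 0) (q 0) = 0" "B (y 0) (p 0) = 0" using B_N by blast+
    then have "B w (q 0) + B w (p 0) = 1" using w B_p[of 0] B_q[of 0] by auto
    then have "B w (x (int m)) + B w (y (int m)) = e" using qpm by auto
    then show ?thesis
      using orth_x[OF ne(1)] orth_y[OF ne(2)] B_vals[of w "p ?l"] B_vals[of w "q ?l"] e_def
      by (simp split: if_splits) linarith+
  qed
  define a where "a i = (if sw \<and> int i = ?l then y (int i) else x (int i))" for i :: nat
  define b where "b i = (if sw \<and> int i = ?l then x (int i) else y (int i))" for i :: nat
  define a' where "a' i = (if sw \<and> int i = ?l then p (int i) else q (int i))" for i :: nat
  define b' where "b' i = (if sw \<and> int i = ?l then q (int i) else p (int i))" for i :: nat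
  have s1: "square (a i) (b i) (a (Suc i)) (b (Suc i))" "square (a' i) (b' i) (a' (Suc i)) (b' (Suc i))"
    if "Suc i < m" for i
    using that sq[of "int i"] pq_fwd[of "int i"] square_swap[OF sq[of "int i"]] square_swap[OF pq_fwd[of "int i"]]
    by (auto simp: a_def b_def a'_def b'_def add.commute)
  have m1: "int (m - 1) = ?l" "?l \<noteq> 0" using n by (auto simp: of_nat_diff)
  have s2: "square (a (m - 1)) (b (m - 1)) (a' 0) (b' 0)"
    using cl m1 unfolding a_def b_def a'_def b'_def by (auto simp: sw_def)
  have s3: "square (a' (m - 1)) (b' (m - 1)) (a 0) (b 0)"
    using bk[of "x 0"] bk[of "y 0"] m1 p_neq_q[of ?l] xy_neq[of 0 0]
      B_sym[of "x 0" "p ?l"] B_sym[of "x 0" "q ?l"] B_sym[of "y 0" "p ?l"] B_sym[of "y 0" "q ?l"]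
    unfolding a_def b_def a'_def b'_def square_def e_def by auto
  define X where "X j = (if j < m then a j else a' (j - m))" for j
  define Y where "Y j = (if j < m then b j else b' (j - m))" for j
  have XY: "{fst (X j), fst (Y j)} = P (int j)" if "j < n" for j
  proof (cases "j < m")
    case False
    then have "{fst (X j), fst (Y j)} = F (int (j - m))"
      by (auto simp: X_def Y_def a'_def b'_def F_def)
    then show ?thesis using F[of "int (j - m)"] False by simp
  qed (auto simp: X_def Y_def a_def b_def P_def)
  interpret S: framed V A n "\<lambda>j. X (nat (j mod int n))" "\<lambda>j. Y (nat (j mod int n))"
  proof
    show "frame n (\<lambda>j. X (nat (j mod int n))) (\<lambda>j. Y (nat (j mod int n)))"
    proof (rule frameI[OF n3])
      fix j assume j: "j < n"
      consider "Suc j < m" | "j = m - 1" | "m \<le> j" "Suc j < n" | "j = m + (m - 1)" using j n by linarith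
      then show "square (X j) (Y j) (X (Suc j mod n)) (Y (Suc j mod n))"
      proof cases
        case 1
        then show ?thesis using s1(1)[of j] n by (simp add: X_def Y_def)
      next
        case 2
        then have "j < m" "Suc j mod n = m" "X m = a' 0" "Y m = b' 0" using n by (simp_all add: X_def Y_def)
        then show ?thesis using s2 2 by (simp add: X_def Y_def)
      next
        case 3
        then have "Suc j mod n = Suc j" "Suc j - m = Suc (j - m)" "Suc (j - m) < m" using n by auto
        then show ?thesis using s1(2)[of "j - m"] 3 by (simp add: X_def Y_def)
      next
        case 4
        then have "Suc j = n" using n by linarith
        then have "Suc j mod n = 0" by (metis mod_self)
        moreover have "j - m = m - 1" "\<not> j < m" using 4 by simp_all
        ultimately have "Suc j mod n = 0" "j - m = m - 1" "\<not> j < m" by blast+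
        then show ?thesis using s3 n by (simp add: X_def Y_def)
      qed
    next
      fix i j :: nat assume ij: "i < j" "j < n"
      then have "\<not> int n dvd int i - int j" using int_dvd_less[of i j] by auto
      then have "P (int i) \<inter> P (int j) = {}" using P_disj by blast
      then show "{fst (X i), fst (Y i)} \<inter> {fst (X j), fst (Y j)} = {}" using XY ij by simp
    qed
  qed
  have c: "B (a i) (b' i) = 1" "B (b i) (a' i) = 1" for i
    using B_p[of "int i"] B_q[of "int i"] by (auto simp: a_def b_def a'_def b'_def)
  show ?thesis
  proof (rule S.equiv_T_star[OF n])
    fix i assume i: "i < m"
    then have "nat (int i mod int n) = i" "nat (int (i + m) mod int n) = i + m"
      using n by (simp_all add: mod_pos_pos_trivial del: of_nat_add)
    then show "B (X (nat (int i mod int n))) (Y (nat (int (i + m) mod int n))) = 1"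
      "B (Y (nat (int i mod int n))) (X (nat (int (i + m) mod int n))) = 1"
      using i c[of i] by (simp_all add: X_def Y_def)
  qed
qed

text \<open>The smallest graph with opposite fifth edges is not new. The adjacent vertices
  \<open>x 0\<close> and \<open>p 0\<close> form a positive 4-cycle with \<open>x 1\<close> and
  \<open>p 1\<close>, and the frame grown from it has an edge inside a pair.\<close>

lemma shift_2_same:
  assumes n: "n = 4" and F: "\<And>i. F i = P (i + 2)"
  obtains n' x' y' where "frame n' x' y'" "fst (y' 0) \<in> N (fst (x' 0))"
proof -
  let ?w = "x 1"
  have P3: "P (- 1) = P 3" using P_cong[of "- 1" 3] n by simp
  have "fst (p 1) \<in> P (- 1)" "fst (q 1) \<in> P (- 1)" using F[of 1] P3 by (auto simp: F_def)
  then have p1: "fst (p 1) = fst (x (- 1)) \<and> fst (q 1) = fst (y (- 1)) \<or>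
      fst (p 1) = fst (y (- 1)) \<and> fst (q 1) = fst (x (- 1))"
    using p_neq_q[of 1] by (auto simp: P_def)
  have ne: "fst ?w \<noteq> fst (x 0)" using x_inj[of 1 0] n3 by auto
  have nb: "fst (y 1) \<notin> N (fst ?w)" "fst (q 1) \<notin> N (fst ?w)"
    using N_x[of 1] P_adj[OF y_in_P[of 1]] F[of 1] P_disj[of "fst (y 1)" 1 "1 + 2"] n
      p_neq_q[of 1] pq_notin[of 1] by (auto simp: F_def)
  then have z: "B ?w (y 1) = 0" "B ?w (q 1) = 0" using B_N by blast+
  have o: "B ?w (x (- 1)) - B ?w (y (- 1)) + B ?w (p 0) = 0"
    using orth_x[OF ne] z by simp
  have f: "B (x 0) (x (- 1)) = 1" "B (x 0) (y (- 1)) = -1" using B_bwd[of 0] by simp_all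
  \<comment> \<open>Up to sign, \<open>p 1\<close> and \<open>q 1\<close> are \<open>x (- 1)\<close>
    and \<open>y (- 1)\<close> in some order. The one that is \<open>q 1\<close> is not adjacent to
    \<open>x 1\<close>, so the relation \<open>o\<close> fixes the entry at
    \<open>p 0\<close>.\<close>
  have prod: "B (x 0) (p 1) * B ?w (p 0) = -1"
  proof -
    from p1 consider "p 1 = x (- 1)" "fst (q 1) = fst (y (- 1))" | "p 1 = neg (x (- 1))" "fst (q 1) = fst (y (- 1))"
      | "p 1 = y (- 1)" "fst (q 1) = fst (x (- 1))" | "p 1 = neg (y (- 1))" "fst (q 1) = fst (x (- 1))"
      using fst_eq_imp by metis
    then show ?thesis
      using o f z(2) B_p[of 1] B_fst_cong[of "q 1" "y (- 1)" ?w] B_fst_cong[of "q 1" "x (- 1)" ?w]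
      by cases (auto simp del: B_p)
  qed
  have "B (x 0) (x 1) = 1" "B (p 0) (p 1) = -1"
    using B_fwd(1)[of 0] squareD(4)[OF pq_fwd[of 0]] by simp_all
  then have four: "B (x 0) (x 1) * B (x 0) (p 1) * B (p 0) (x 1) * B (p 0) (p 1) = 1"
    using prod B_sym[of ?w "p 0"] by simp
  have "A (fst (x 0)) (fst (x 1)) * A (fst (x 0)) (fst (p 1)) * A (fst (p 0)) (fst (x 1)) * A (fst (p 0)) (fst (p 1)) =
      B (x 0) (x 1) * B (x 0) (p 1) * B (p 0) (x 1) * B (p 0) (p 1)"
    unfolding B_def using sgnb_cases[of "snd (x 0)"] sgnb_cases[of "snd (x 1)"] sgnb_cases[of "snd (p 0)"] sgnb_cases[of "snd (p 1)"]
    by auto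
  moreover have "fst (p i) \<noteq> fst (x i)" "fst (p i) \<in> N (fst (x i))" for i
    using N_x[of i] by (metis N_irrefl UnI2 singletonI)+
  ultimately have "psquare (fst (x 0)) (fst (p 0)) (fst (x 1)) (fst (p 1))"
    using four unfolding psquare_def by metis
  then obtain u v a b where s: "square u v a b" "fst u = fst (x 0)" "fst v = fst (p 0)"
    by (rule psquare_square)
  obtain n' x' y' where "frame n' x' y'" "x' 0 = u" "y' 0 = v" using square_frame[OF s(1)] .
  then show ?thesis using that s(2,3) N_x[of 0] by auto
qed

text \<open>A vertex of \<open>P j\<close> adjacent to one vertex of \<open>F i\<close> is adjacent
  to both by \<open>third\<close>, but only one of its edges leaves the frame.\<close>

lemma F_inj:
  assumes out: "\<And>i j. F i \<inter> P j = {}" and z: "z \<in> F i" "z \<in> F j"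
  shows "int n dvd i - j"
proof (rule ccontr)
  assume nd: "\<not> int n dvd i - j"
  obtain v where v: "v \<in> P j" "z \<in> N v" using F_N z(2) by blast
  then have "v \<notin> P i" using nd P_disj[of v i j] by blast
  then have "fst (p i) \<in> N v" "fst (q i) \<in> N v"
    using third(1)[of v i] v(2) z(1) by (auto simp: F_def)
  moreover have "fst (p i) \<notin> P (j + 1) \<union> P (j - 1)" "fst (q i) \<notin> P (j + 1) \<union> P (j - 1)"
    using out[of i "j + 1"] out[of i "j - 1"] by (auto simp: F_def)
  ultimately show False using fifth_unique[OF v(1)] p_neq_q[of i] by metis
qed

lemma frame_pq:
  assumes out: "\<And>i j. F i \<inter> P j = {}"
  shows "frame n q p"
  unfolding frame_def
proof (intro conjI allI impI)
  show "3 \<le> n" by (rule n3)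
  show "square (q j) (p j) (q (j + 1)) (p (j + 1))" for j by (rule pq_fwd)
  show "q (j + int n) = q j" "p (j + int n) = p j" for j using pq_cong[of "j + int n" j] by simp_all
  show "int n dvd i - j" if "fst (q i) = fst (q j)" for i j
    using F_inj[OF out, of "fst (q i)" i j] that by (auto simp: F_def)
  show "int n dvd i - j" if "fst (p i) = fst (p j)" for i j
    using F_inj[OF out, of "fst (p i)" i j] that by (auto simp: F_def)
  show "fst (q i) \<noteq> fst (p j)" for i j
  proof
    assume eq: "fst (q i) = fst (p j)"
    then have "int n dvd i - j" using F_inj[OF out, of "fst (q i)" i j] by (auto simp: F_def)
    then have "q i = q j" using pq_cong by blast
    then show False using eq p_neq_q[of j] by simp
  qed
qed

text \<open>The fifth neighbours form a frame \<open>q\<close>, \<open>p\<close>. Since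
  \<open>p\<close> belongs to \<open>x\<close> and \<open>q\<close> to \<open>y\<close>, it is met
  with its two vertices exchanged at every position.\<close>

lemma outside_box:
  assumes out: "\<And>i j. F i \<inter> P j = {}"
  shows "equiv_to (box_K2 (T n))" "V = (\<Union>i. P i) \<union> (\<Union>i. F i)"
proof -
  interpret F2: framed V A n q p by unfold_locales (rule frame_pq[OF out])
  let ?I = "{0, 1::nat} \<times> {..<n}"
  define h where "h v = (if fst v = 0 then p (int (snd v)) else q (int (snd v)))" for v :: "nat \<times> nat"
  define f where "f = (\<lambda>(v, c). if c then h v else g v)"
  let ?M = "signed_adj (box_K2 (T n))"
  have V: "pverts (ugraph (box_K2 (T n))) = ?I \<times> UNIV" by (simp add: box_K2_def)
  have M: "?M (u, c) (v, d) = box_K2_matrix (T_matrix n) (u, c) (v, d)" if "u \<in> ?I" "v \<in> ?I" for u v c d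
    using that unfolding box_K2_def signed_adj_of
    by (cases c; cases d; simp del: T_matrix.simps)
  have h: "B (h u) (h v) = - T_matrix n u v"
    if uv: "T_matrix n u v \<noteq> 0" "fst u \<in> {0, 1}" "fst v \<in> {0, 1}" for u v
  proof -
    have sw: "h (a, i) = F2.g (1 - a, i)" if "a \<in> {0, 1}" for a i
      using that by (auto simp: h_def F2.g_def)
    obtain a i b j where ab: "u = (a, i)" "v = (b, j)" by fastforce
    \<comment> \<open>The exchange negates the matrix, as the sign of an edge is read off one end
      point; this is the second diagonal block of \<open>box_K2\<close>.\<close>
    have T: "T_matrix n (1 - a, i) (1 - b, j) = - T_matrix n u v"
      using uv ab by auto
    show ?thesis
      using F2.T_edge[of "(1 - a, i)" "(1 - b, j)"] T uv sw ab by auto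
  qed
  have gh: "B (g u) (h u) = 1" for u by (simp add: g_def h_def)
  have gP: "fst (g u) \<in> P (int (snd u))" and hF: "fst (h u) \<in> F (int (snd u))" for u
    by (auto simp: g_def h_def F_def)
  have ih: "inj_on (fst \<circ> h) ?I"
  proof (rule inj_onI)
    fix u v assume uv: "u \<in> ?I" "v \<in> ?I" "(fst \<circ> h) u = (fst \<circ> h) v"
    then have "int n dvd int (snd u) - int (snd v)"
      using F_inj[OF out hF[of u], of "int (snd v)"] hF[of v] by simp
    then have s: "snd u = snd v" using int_dvd_less uv by auto
    moreover have "fst u = fst v"
      using uv(3) s p_neq_q[of "int (snd v)"] uv(1,2) by (auto simp: h_def split: if_splits)
    ultimately show "u = v" by (simp add: prod_eq_iff)
  qed
  have inj: "inj_on (fst \<circ> f) (?I \<times> UNIV)"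
  proof (rule inj_onI)
    fix u v assume uv: "u \<in> ?I \<times> UNIV" "v \<in> ?I \<times> UNIV" "(fst \<circ> f) u = (fst \<circ> f) v"
    have "snd u = snd v"
      using uv(3) gP[of "fst u"] hF[of "fst u"] gP[of "fst v"] hF[of "fst v"] out
      by (auto simp: f_def case_prod_beta disjoint_iff split: if_splits)
    moreover have "fst u = fst v"
      using uv \<open>snd u = snd v\<close> inj_onD[OF inj_g, of "fst u" "fst v"] inj_onD[OF ih, of "fst u" "fst v"]
      by (cases "snd v") (auto simp: f_def case_prod_beta)
    ultimately show "u = v" by (simp add: prod_eq_iff)
  qed
  have BM: "B (f u) (f v) = ?M u v"
    if uv: "u \<in> ?I \<times> UNIV" "v \<in> ?I \<times> UNIV" "?M u v \<noteq> 0" for u v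
  proof -
    obtain u' c v' d where e: "u = (u', c)" "v = (v', d)" by fastforce
    then have m: "u' \<in> ?I" "v' \<in> ?I" using uv by auto
    then have fs: "fst u' \<in> {0, 1}" "fst v' \<in> {0, 1}" by auto
    have nz: "box_K2_matrix (T_matrix n) (u', c) (v', d) \<noteq> 0" using uv(3) M[OF m] e by simp
    show ?thesis
      unfolding e M[OF m] using nz T_edge[OF _ fs] h[OF _ fs] gh[of u'] B_sym[of "h u'" "g u'"]
      by (cases c; cases d) (auto simp: f_def simp del: T_matrix.simps split: if_splits)
  qed
  have card: "5 \<le> card {v \<in> ?I \<times> UNIV. ?M u v \<noteq> 0}" if u: "u \<in> ?I \<times> UNIV" for u
  proof -
    obtain a i c where e: "u = ((a, i), c)" by (metis surj_pair)
    then have ai: "(a, i) \<in> ?I" "i < n" using u by auto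
    let ?S = "insert ((a, i), \<not> c) (T_nbrs i \<times> {c})"
    have "?M u v \<noteq> 0 \<and> v \<in> ?I \<times> UNIV" if vS: "v \<in> ?S" for v
    proof (cases "v = ((a, i), \<not> c)")
      case True
      then show ?thesis using M[OF ai(1) ai(1), of c "\<not> c"] e ai(1) by (cases c) simp_all
    next
      case False
      then obtain v' where v': "v = (v', c)" "v' \<in> T_nbrs i" using vS by auto
      then have "v' \<in> ?I" "T_matrix n (a, i) v' \<noteq> 0" using T_nbrs_props(3,4)[OF ai(2)] by blast+
      then show ?thesis using M[OF ai(1), of v' c c] e v' by (cases c) (simp_all del: T_matrix.simps)
    qed
    then have "card ?S \<le> card {v \<in> ?I \<times> UNIV. ?M u v \<noteq> 0}" by (intro card_mono) auto
    moreover have "card ?S = 5"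
      using T_nbrs_props(1,2)[OF ai(2)] by (subst card_insert_disjoint) (auto simp: card_cartesian_product)
    ultimately show ?thesis by simp
  qed
  have fin: "finite (?I \<times> (UNIV :: bool set))" and ne: "?I \<times> (UNIV :: bool set) \<noteq> {}"
    using n3 by (auto simp: lessThan_empty_iff)
  show "equiv_to (box_K2 (T n))"
    by (rule equiv_toI[of "box_K2 (T n)" f, unfolded V, OF fin ne inj BM card])
  have img: "fst ` f ` (?I \<times> UNIV) = V"
    by (rule recognize(1)[where M = ?M, OF fin ne inj BM card])
  have "P i \<subseteq> V" for i
  proof
    fix v assume "v \<in> P i"
    then have "fst (x (i + 1)) \<in> N v" using P_subset_N(1) x_in_P by blast
    then show "v \<in> V" by (rule N_in_V(1))
  qed
  moreover have "F i \<subseteq> V" for i using F_N N_in_V(2) by blast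
  moreover have "v \<in> (\<Union>i. P i) \<union> (\<Union>i. F i)" if vV: "v \<in> V" for v
  proof -
    obtain u where "v = fst (f u)" using img vV by blast
    then show ?thesis
      using gP[of "fst u"] hF[of "fst u"] by (auto simp: f_def case_prod_beta)
  qed
  ultimately show "V = (\<Union>i. P i) \<union> (\<Union>i. F i)" by (meson UN_least Un_least subsetI subset_antisym)
qed

text \<open>\<open>D_outside\<close> is applied to both frames: the fifth neighbours of the frame
  \<open>q\<close>, \<open>p\<close> lie in the original one, so neither exception with offset 3
  arises.\<close>

lemma matching_outside:
  assumes out: "\<And>i j. F i \<inter> P j = {}" and n4: "n \<noteq> 4"
  shows "matching"
  unfolding matching_def
proof (intro conjI allI impI)
  interpret F2: framed V A n q p by unfold_locales (rule frame_pq[OF out])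
  have P2: "F2.P i = F i" for i by (auto simp: F2.P_def F_def)
  have neF: "F i \<noteq> P j" for i j using out[of i j] x_in_P[of j] by blast
  have F2: "F2.F i \<noteq> F2.P j" for i j
  proof
    assume eq: "F2.F i = F2.P j"
    have "fst (q i) \<in> N (fst (y i))" using N_y by simp
    then have "fst (y i) \<in> N (fst (q i))" using N_sym by blast
    moreover have "fst (y i) \<notin> F (i + 1)" "fst (y i) \<notin> F (i - 1)"
      using out[of "i + 1" i] out[of "i - 1" i] y_in_P[of i] by blast+
    ultimately have "fst (y i) \<in> F2.F i"
      using F2.N_F_iff[of "fst (q i)" i "fst (y i)"] P2 by (simp add: F_def)
    then show False using eq P2 out[of j i] y_in_P[of i] by blast
  qed
  show "\<exists>u v. D u v" using D_xy by blast
  fix u v w assume D: "D u v" "D u w"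
  have ne: "v \<noteq> u" "w \<noteq> u" using D by (auto simp: D_def)
  have "u \<in> (\<Union>i. P i) \<union> (\<Union>i. F i)" using outside_box(2)[OF out] D_in_V[OF D(1)] by simp
  then consider i where "u \<in> P i" | i where "u \<in> F2.P i" using P2 by blast
  then show "v = w"
  proof cases
    case 1
    then have "v \<in> P i" "w \<in> P i"
      using D_outside[OF D(1) 1] D_outside[OF D(2) 1] n4 neF by blast+
    then show ?thesis using 1 ne by (auto simp: P_def)
  next
    case 2
    then have "v \<in> F2.P i" "w \<in> F2.P i"
      using F2.D_outside[OF D(1) 2] F2.D_outside[OF D(2) 2] n4 F2 by blast+
    then show ?thesis using 2 ne by (auto simp: F2.P_def)
  qed
qed

lemma same_result:
  assumes F: "\<And>i. F i = P i"
  shows "triangle \<and> (equiv_to (T_plus 3) \<or> equiv_to (T_plus 4)) \<or> matching \<and> (\<exists>n\<ge>5. equiv_to (T_plus n))"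
proof -
  have e: "equiv_to (T_plus n)" by (rule same_plus[OF F])
  consider "n = 3" | "n = 4" | "n \<ge> 5" using n3 by linarith
  then show ?thesis
  proof cases
    case 3
    then have "\<not> int n dvd 3" using zdvd_not_zless[of 3 "int n"] by simp
    then have "P i \<noteq> P (i + 3)" "P i \<noteq> P (i - 3)" for i by (simp_all add: P_eq_iff)
    then have "matching" using matching_frame V_frame[of 0] F 3 by simp
    then show ?thesis using e 3 by blast
  qed (use e triangle_3_same[OF _ F] triangle_4 in auto)
qed

end

lemma (in ortho5) D_result:
  assumes "D u v"
  shows "triangle \<and> (equiv_to (T_plus 3) \<or> equiv_to (T_star 3) \<or> equiv_to (box_K2 (T 4)) \<or> equiv_to (T_plus 4)) \<or>
    matching \<and> ((\<exists>n\<ge>3. n \<noteq> 4 \<and> equiv_to (box_K2 (T n))) \<or> (\<exists>n\<ge>5. equiv_to (T_plus n)) \<or>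
      (\<exists>n\<ge>4. equiv_to (T_star n)))"
proof -
  obtain a b where "psquare u v a b" using D_psquare[OF assms] .
  then obtain u' v' a' b' where s: "square u' v' a' b'" by (rule psquare_square)
  obtain n x y where fr: "frame n x y" by (rule square_frame[OF s])
  interpret framed V A n x y by unfold_locales (rule fr)
  show ?thesis
  proof (cases rule: F_trichotomy)
    case outside
    then show ?thesis
      using outside_box(1)[OF outside] matching_outside[OF outside] triangle_4 n3 by (cases "n = 4") auto
  next
    case same
    then show ?thesis using same_result[OF same] by blast
  next
    case (shift m)
    have e: "equiv_to (T_star m)" by (rule shift_frame[OF shift])
    consider "m = 2" | "m = 3" | "m \<ge> 4" using shift by linarith
    then show ?thesis
    proof cases
      case 1
      \<comment> \<open>Here the frame is abandoned for one with an edge inside a pair, which is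
        then of the type with all fifth edges inside pairs.\<close>
      then obtain n' x' y' where fr': "frame n' x' y'" and xy: "fst (y' 0) \<in> N (fst (x' 0))"
        using shift_2_same shift by auto
      interpret G: framed V A n' x' y' by unfold_locales (rule fr')
      have "fst (y' 0) \<in> G.F 0"
        by (rule G.N_F_iff[of "fst (x' 0)"])
          (use xy G.P_adj[OF G.y_in_P[of 0]] in auto)
      then have "G.F 0 = G.P 0" using G.F_meets G.y_in_P by blast
      then have "G.F i = G.P i" for i by (rule G.F_same_all)
      then show ?thesis using G.same_result by blast
    next
      case 2
      then show ?thesis using e triangle_6_shift shift by auto
    next
      case 3
      \<comment> \<open>For m >= 4 both m - 3 and m + 3 lie strictly between 0 and n = 2 m, so the
        offset m is neither 3 nor -3 modulo n.\<close>
      have nd: "\<not> int n dvd int m - 3" "\<not> int n dvd int m + 3"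
        using n_ndvd(1)[of "m - 3"] n_ndvd(1)[of "m + 3"] 3 shift(1) by (auto simp: of_nat_diff)
      then have "P (i + int m) \<noteq> P (i + 3)" "P (i + int m) \<noteq> P (i - 3)" for i
        by (simp_all add: P_eq_iff)
      then have "matching" using matching_frame V_frame[OF shift(3)] shift 3 by simp
      then show ?thesis using e 3 by blast
    qed
  qed
qed

section \<open>No edges of \<open>D\<close>: flows on five points\<close>

text \<open>\<open>ij\<close> is the value of a flow on the edge from i to j, with conservation and
  at most two nonzero values at each point. The solutions through i, j, k are the oriented triangle,
  two 4-cycles and two 5-cycles, in this order.\<close>

lemma flow_cases:
  fixes ij ik il im jk jl jm kl km lm :: int
  assumes v: "ij = 1" "jk = 1" "\<bar>ik\<bar> \<le> 1" "\<bar>il\<bar> \<le> 1" "\<bar>im\<bar> \<le> 1" "\<bar>jl\<bar> \<le> 1" "\<bar>jm\<bar> \<le> 1"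
      "\<bar>kl\<bar> \<le> 1" "\<bar>km\<bar> \<le> 1" "\<bar>lm\<bar> \<le> 1"
    and i: "ij + ik + il + im = 0" "\<bar>ij\<bar> + \<bar>ik\<bar> + \<bar>il\<bar> + \<bar>im\<bar> \<le> 2"
    and j: "- ij + jk + jl + jm = 0" "\<bar>ij\<bar> + \<bar>jk\<bar> + \<bar>jl\<bar> + \<bar>jm\<bar> \<le> 2"
    and k: "- ik - jk + kl + km = 0" "\<bar>ik\<bar> + \<bar>jk\<bar> + \<bar>kl\<bar> + \<bar>km\<bar> \<le> 2"
    and l: "- il - jl - kl + lm = 0" "\<bar>il\<bar> + \<bar>jl\<bar> + \<bar>kl\<bar> + \<bar>lm\<bar> \<le> 2"
    and m: "- im - jm - km - lm = 0" "\<bar>im\<bar> + \<bar>jm\<bar> + \<bar>km\<bar> + \<bar>lm\<bar> \<le> 2"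
  shows "jl = 0 \<and> jm = 0 \<and>
    ((ik = -1 \<and> il = 0 \<and> im = 0 \<and> kl = 0 \<and> km = 0 \<and> lm = 0) \<or>
     (ik = 0 \<and> il = -1 \<and> im = 0 \<and> kl = 1 \<and> km = 0 \<and> lm = 0) \<or>
     (ik = 0 \<and> il = 0 \<and> im = -1 \<and> kl = 0 \<and> km = 1 \<and> lm = 0) \<or>
     (ik = 0 \<and> il = 0 \<and> im = -1 \<and> kl = 1 \<and> km = 0 \<and> lm = 1) \<or>
     (ik = 0 \<and> il = -1 \<and> im = 0 \<and> kl = 0 \<and> km = 1 \<and> lm = -1))"
proof -
  have jj: "jl = 0" "jm = 0" using v(1,2) j by linarith+
  have "ik = -1 \<and> il = 0 \<and> im = 0 \<or> ik = 0 \<and> il = -1 \<and> im = 0 \<or> ik = 0 \<and> il = 0 \<and> im = -1"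
    using v i by (smt (verit))
  then show ?thesis
  proof (elim disjE conjE)
    assume a: "ik = -1" "il = 0" "im = 0"
    then have "kl = 0" "km = 0" using k v(2) by linarith+
    then show ?thesis using a jj l(1) by simp
  next
    assume a: "ik = 0" "il = -1" "im = 0"
    then have "kl = 1 \<and> km = 0 \<or> kl = 0 \<and> km = 1" using k v by (smt (verit))
    then show ?thesis using a jj l(1) m(1) by auto
  next
    assume a: "ik = 0" "il = 0" "im = -1"
    then have "kl = 1 \<and> km = 0 \<or> kl = 0 \<and> km = 1" using k v by (smt (verit))
    then show ?thesis using a jj l(1) m(1) by auto
  qed
qed

definition perm5 :: "nat \<Rightarrow> nat \<Rightarrow> nat \<Rightarrow> nat \<Rightarrow> nat \<Rightarrow> bool" where
  "perm5 i j k l m \<longleftrightarrow> {i, j, k, l, m} = {..<5}"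

lemma perm5_distinct: "perm5 i j k l m \<Longrightarrow> distinct [i, j, k, l, m]"
  unfolding perm5_def by (rule card_distinct) simp

lemma perm5_neq:
  assumes "perm5 i j k l m"
  shows "i \<noteq> j" "i \<noteq> k" "i \<noteq> l" "i \<noteq> m" "j \<noteq> i" "j \<noteq> k" "j \<noteq> l" "j \<noteq> m" "k \<noteq> i" "k \<noteq> j" "k \<noteq> l" "k \<noteq> m" "l \<noteq> i" "l \<noteq> j" "l \<noteq> k" "l \<noteq> m" "m \<noteq> i" "m \<noteq> j" "m \<noteq> k" "m \<noteq> l"
  using perm5_distinct[OF assms] by auto

lemma perm5_less:
  assumes "perm5 i j k l m"
  shows "i < 5" "j < 5" "k < 5" "l < 5" "m < 5"
  using assms unfolding perm5_def by (auto simp: set_eq_iff)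

lemma perm5_cases: "perm5 i j k l m \<Longrightarrow> a < 5 \<Longrightarrow> a = i \<or> a = j \<or> a = k \<or> a = l \<or> a = m"
  unfolding perm5_def by (auto simp: set_eq_iff)

lemma perm5_ex2:
  assumes "i < 5" "j < 5" "i \<noteq> j"
  obtains k l m where "perm5 i j k l m"
proof -
  have c: "card ({..<5} - {i, j}) = 3" using assms by (subst card_Diff_subset) auto
  then obtain k l m where "{..<5} - {i, j} = {k, l, m}" by (auto simp: card_3_iff)
  then have "perm5 i j k l m" using assms unfolding perm5_def by auto
  then show ?thesis using that by blast
qed

lemma perm5_ex1:
  assumes "i < 5"
  obtains j k l m where "perm5 i j k l m"
proof -
  have "\<exists>j<5. j \<noteq> i" by (rule exI[of _ "if i = 0 then 1 else 0"]) simp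
  then obtain j where "j < 5" "i \<noteq> j" by blast
  then show ?thesis using perm5_ex2[OF assms] that by metis
qed

lemma perm5_ex3:
  assumes "i < 5" "j < 5" "k < 5" "i \<noteq> j" "i \<noteq> k" "j \<noteq> k"
  obtains l m where "perm5 i j k l m"
proof -
  have c: "card ({..<5} - {i, j, k}) = 2" using assms by (subst card_Diff_subset) auto
  then obtain l m where "{..<5} - {i, j, k} = {l, m}" by (auto simp: card_2_iff)
  then have "perm5 i j k l m" using assms unfolding perm5_def by auto
  then show ?thesis using that by blast
qed

locale thin = ortho5 +
  assumes thin: "\<not> D v w"
begin

text \<open>The number is even by orthogonality, at most 5, and not 4.\<close>

lemma thin_le2:
  assumes "v \<noteq> w"
  shows "card (N v \<inter> N w) \<le> 2"
proof (cases "v \<in> V")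
  case True
  obtain xs where st: "star (v, False) xs" using star_exists[of "(v, False)"] True by auto
  obtain a b c d e where xs: "xs = [a, b, c, d, e]" using st list5 star_def by blast
  let ?B = "B (w, False)"
  have ne: "fst (w, False) \<noteq> fst (v, False)" using assms by auto
  have card: "int (card (N v \<inter> N w)) = \<bar>?B a\<bar> + \<bar>?B b\<bar> + \<bar>?B c\<bar> + \<bar>?B d\<bar> + \<bar>?B e\<bar>"
    using card_common[OF st, of "(w, False)"] xs by (simp add: N_def Int_def)
  moreover have "?B a + ?B b + ?B c + ?B d + ?B e = 0"
    using star_orth[OF st ne] xs by simp
  ultimately have "int (card (N v \<inter> N w)) =
      (\<bar>?B a\<bar> + ?B a) + (\<bar>?B b\<bar> + ?B b) + (\<bar>?B c\<bar> + ?B c) + (\<bar>?B d\<bar> + ?B d) + (\<bar>?B e\<bar> + ?B e)"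
    by simp
  moreover have "even (\<bar>z\<bar> + z)" for z :: int by (cases "0 \<le> z") simp_all
  ultimately have "even (int (card (N v \<inter> N w)))" by simp
  moreover have "int (card (N v \<inter> N w)) \<le> 5" unfolding card abs_B by simp
  moreover have "card (N v \<inter> N w) \<noteq> 4" using thin[of v w] assms by (simp add: D_def)
  ultimately have "even (card (N v \<inter> N w))" "card (N v \<inter> N w) \<le> 5" "card (N v \<inter> N w) \<noteq> 4" by simp_all
  moreover have "k \<le> 2" if "even k" "k \<le> 5" "k \<noteq> 4" for k :: nat using that by presburger
  ultimately show ?thesis by blast
next
  case False
  then have "N v = {}" using N_in_V(1) by blast
  then show ?thesis by simp
qed

lemma thin_sum:
  assumes st: "star u [a, b, c, d, e]" and ne: "fst y \<noteq> fst u"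
  shows "B y a + B y b + B y c + B y d + B y e = 0"
    "\<bar>B y a\<bar> + \<bar>B y b\<bar> + \<bar>B y c\<bar> + \<bar>B y d\<bar> + \<bar>B y e\<bar> \<le> 2"
proof -
  show "B y a + B y b + B y c + B y d + B y e = 0" using star_orth[OF st ne] by simp
  have "int (card (N (fst u) \<inter> N (fst y))) = \<bar>B y a\<bar> + \<bar>B y b\<bar> + \<bar>B y c\<bar> + \<bar>B y d\<bar> + \<bar>B y e\<bar>"
    using card_common[OF st, of y] by (simp add: N_def Int_def)
  then show "\<bar>B y a\<bar> + \<bar>B y b\<bar> + \<bar>B y c\<bar> + \<bar>B y d\<bar> + \<bar>B y e\<bar> \<le> 2"
    using thin_le2[of "fst u" "fst y"] ne by auto
qed

lemma no3:
  assumes "B v a \<noteq> 0" "B v b \<noteq> 0" "B v c \<noteq> 0" "B w a \<noteq> 0" "B w b \<noteq> 0" "B w c \<noteq> 0"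
    and "fst a \<noteq> fst b" "fst a \<noteq> fst c" "fst b \<noteq> fst c"
  shows "fst v = fst w"
proof (rule ccontr)
  assume ne: "fst v \<noteq> fst w"
  have "{fst a, fst b, fst c} \<subseteq> N (fst v) \<inter> N (fst w)" using assms B_N by auto
  then have "card {fst a, fst b, fst c} \<le> card (N (fst v) \<inter> N (fst w))" by (intro card_mono) auto
  then show False using thin_le2[OF ne] assms(7-9) by simp
qed

text \<open>The entry of \<open>w\<close> at \<open>a\<close> has to be cancelled, and only one
  further entry can be nonzero.\<close>

lemma other_common:
  assumes "B v a = 1" "B w a = 1" "fst v \<noteq> fst w"
  shows "\<exists>!q. B v q = 1 \<and> B w q = -1"
proof -
  have "\<exists>ys. length ys = 4 \<and> star v ([a] @ ys)"
    using star_extend[of v "[a]"] assms B_in_V(1)[of v a] by simp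
  then obtain b c d e where st: "star v [a, b, c, d, e]"
    by (auto simp: numeral_eq_Suc length_Suc_conv)
  have vb: "B v b = 1" "B v c = 1" "B v d = 1" "B v e = 1" using st by (simp_all add: star_def)
  note h = thin_sum[OF st, of w] assms B_vals[of w b] B_vals[of w c] B_vals[of w d] B_vals[of w e]
  have "B w b = -1 \<or> B w c = -1 \<or> B w d = -1 \<or> B w e = -1"
    using h by auto
  then have "\<exists>q. B v q = 1 \<and> B w q = -1" using vb by blast
  moreover have "q = q'" if q: "B v q = 1 \<and> B w q = -1" "B v q' = 1 \<and> B w q' = -1" for q q'
  proof -
    have *: "fst z \<noteq> fst a" if "B v z = 1 \<and> B w z = -1" for z
      using fst_eq_imp[of z a] that assms by auto
    have "fst q = fst q'"
    proof (rule ccontr)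
      assume "fst q \<noteq> fst q'"
      then have "fst v = fst w" using no3[of v a q q' w] *[OF q(1)] *[OF q(2)] q assms by simp
      then show False using assms by simp
    qed
    then show ?thesis using fst_eq_imp[of q q'] q by auto
  qed
  ultimately show ?thesis by blast
qed

end

text \<open>
  The neighbourhood of a vertex \<open>u\<close> with neighbours \<open>n i\<close> in the thin case: \<open>r i j\<close> is the second
  common neighbour of \<open>n i\<close> and \<open>n j\<close>, thought of as an edge of the complete graph on \<open>{..<5}\<close>
  oriented from \<open>i\<close> to \<open>j\<close>. A further vertex \<open>y\<close> assigns \<open>B y (r i j)\<close> to this edge, which is a
  flow with at most two nonzero values at each point, that is, an oriented cycle. Every path
  \<open>i \<rightarrow> j \<rightarrow> k\<close> lies on exactly one such cycle, namely that of \<open>C i j k\<close>.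
\<close>

definition edges :: "nat list \<Rightarrow> (nat \<times> nat) set" where
  "edges c = set (zip c (rotate1 c))"

lemma edges_simps [simp]:
  "edges [i, j, k] = {(i, j), (j, k), (k, i)}"
  "edges [i, j, k, l] = {(i, j), (j, k), (k, l), (l, i)}"
  "edges [i, j, k, l, m] = {(i, j), (j, k), (k, l), (l, m), (m, i)}"
  by (auto simp: edges_def)

section \<open>Cycles seen from the neighbourhood of a vertex\<close>

locale nbhd = thin +
  fixes u :: "'a \<times> bool" and n :: "nat \<Rightarrow> 'a \<times> bool"
  assumes star_u: "star u [n 0, n 1, n 2, n 3, n 4]"
begin

lemma less5: "i < 5 \<Longrightarrow> i = 0 \<or> i = 1 \<or> i = 2 \<or> i = 3 \<or> i = (4::nat)"
  by linarith

lemma B_u_n: "i < 5 \<Longrightarrow> B u (n i) = 1" and B_n_u: "i < 5 \<Longrightarrow> B (n i) u = 1"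
  using star_u B_sym less5[of i] by (auto simp: star_def)

lemma n_inj: "i < 5 \<Longrightarrow> j < 5 \<Longrightarrow> fst (n i) = fst (n j) \<Longrightarrow> i = j"
  using star_u less5[of i] less5[of j] by (auto simp: star_def)

lemma u_nbr: "B u y \<noteq> 0 \<Longrightarrow> \<exists>i<5. fst y = fst (n i)"
proof -
  assume "B u y \<noteq> 0"
  then have "fst y \<in> (\<lambda>i. fst (n i)) ` {0, 1, 2, 3, 4}" using star_mem[OF star_u, of y] by simp
  then obtain i where "i \<in> {0, 1, 2, 3, 4}" "fst y = fst (n i)" by blast
  moreover from this have "i < 5" by auto
  ultimately show ?thesis by blast
qed

lemma u_neq_n: "i < 5 \<Longrightarrow> fst u \<noteq> fst (n i)"
  using B_u_n[of i] B_nz_fst[of u "n i"] by auto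

definition r :: "nat \<Rightarrow> nat \<Rightarrow> 'a \<times> bool" where
  "r i j = (THE q. B (n j) q = 1 \<and> B (n i) q = -1)"

lemma r_unique: "i < 5 \<Longrightarrow> j < 5 \<Longrightarrow> i \<noteq> j \<Longrightarrow> \<exists>!q. B (n j) q = 1 \<and> B (n i) q = -1"
  by (rule other_common[of "n j" u "n i"]) (use B_n_u n_inj in auto)

lemma r_eq:
  assumes "i < 5" "j < 5" "i \<noteq> j" "B q (n j) = 1" "B q (n i) = -1"
  shows "q = r i j"
  unfolding r_def
  by (rule the1_equality[OF r_unique[OF assms(1-3)], symmetric])
    (simp add: assms(4,5) B_sym[of "n j" q] B_sym[of "n i" q])

lemma B_r_n:
  assumes "i < 5" "j < 5" "i \<noteq> j"
  shows "B (r i j) (n j) = 1" "B (r i j) (n i) = -1"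
  using theI'[OF r_unique[OF assms]] B_sym[of "r i j" "n j"] B_sym[of "r i j" "n i"]
  by (simp_all add: r_def)

lemma r_neg:
  assumes "i < 5" "j < 5" "i \<noteq> j"
  shows "r j i = neg (r i j)"
  using r_eq[of j i "neg (r i j)"] B_r_n[OF assms] assms by simp

lemma B_r_neg:
  assumes "i < 5" "j < 5" "i \<noteq> j"
  shows "B y (r j i) = - B y (r i j)"
  by (simp add: r_neg[OF assms])

lemma r_neq_u:
  assumes "i < 5" "j < 5" "i \<noteq> j"
  shows "fst (r i j) \<noteq> fst u"
  using fst_eq_imp[of "r i j" u] B_r_n[OF assms] B_u_n assms by auto

lemma B_r_n0:
  assumes "i < 5" "j < 5" "i \<noteq> j" "k < 5" "k \<noteq> i" "k \<noteq> j"
  shows "B (r i j) (n k) = 0"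
proof (rule ccontr)
  assume "B (r i j) (n k) \<noteq> 0"
  then have "fst (r i j) = fst u"
    using no3[of "r i j" "n i" "n j" "n k" u] B_r_n[OF assms(1-3)] B_u_n assms n_inj by force
  then show False using r_neq_u assms by blast
qed

lemma B_r_n_iff:
  assumes "i < 5" "j < 5" "i \<noteq> j" "k < 5"
  shows "B (r i j) (n k) \<noteq> 0 \<longleftrightarrow> k = i \<or> k = j"
  using B_r_n[OF assms(1-3)] B_r_n0[OF assms] by auto

lemma r_inj:
  assumes "i < 5" "j < 5" "i \<noteq> j" "k < 5" "l < 5" "k \<noteq> l" "fst (r i j) = fst (r k l)"
  shows "{i, j} = {k, l}"
proof -
  have "B (r i j) (n a) = 0 \<longleftrightarrow> B (r k l) (n a) = 0" for a
    using B_fst_cong[OF assms(7), of "n a"] B_sym[of "n a" "r i j"] B_sym[of "n a" "r k l"] by simp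
  then have "a = i \<or> a = j \<longleftrightarrow> a = k \<or> a = l" if "a < 5" for a
    using B_r_n_iff[OF assms(1-3) that] B_r_n_iff[OF assms(4-6) that] by blast
  then show ?thesis using assms(1,2,4,5) by blast
qed

lemma star_n:
  assumes "perm5 i j k l m"
  shows "star (n i) [u, r j i, r k i, r l i, r m i]"
proof -
  note d = perm5_neq[OF assms] and l = perm5_less[OF assms]
  have R: "fst (r a i) \<noteq> fst (r b i)" if "a < 5" "b < 5" "a \<noteq> b" "a \<noteq> i" "b \<noteq> i" for a b
    using r_inj[of a i b i] that l(1) by auto
  have U: "fst (r a i) \<noteq> fst u" "fst u \<noteq> fst (r a i)" if "a < 5" "a \<noteq> i" for a
    using r_neq_u[of a i] that l(1) by auto
  have E: "B (n i) (r a i) = 1" if "a < 5" "a \<noteq> i" for a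
    using B_r_n(1)[of a i] that l(1) B_sym[of "n i" "r a i"] by simp
  show ?thesis
    using d l by (simp add: star_def R U E B_n_u)
qed

lemma n_nbr:
  assumes "i < 5" "B (n i) y \<noteq> 0" "fst y \<noteq> fst u"
  obtains j where "j < 5" "j \<noteq> i" "fst y = fst (r j i)"
proof -
  obtain j k l m where p: "perm5 i j k l m" using perm5_ex1[OF assms(1)] .
  show ?thesis
    using star_mem[OF star_n[OF p] assms(2)] assms(3) that perm5_distinct[OF p] perm5_less[OF p] by auto
qed

text \<open>Candidates for columns of a bipartite adjacency matrix that has \<open>u\<close> and the
  \<open>r i j\<close> among its rows and the \<open>n i\<close> among its columns. As the entry at
  \<open>u\<close> is 0, the row of \<open>n i\<close> becomes conservation of flow at i.\<close>

definition col :: "'a \<times> bool \<Rightarrow> bool" where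
  "col y \<longleftrightarrow> B y u = 0 \<and> (\<forall>i<5. fst y \<noteq> fst (n i))"

lemma col_neg [simp]: "col (neg y) \<longleftrightarrow> col y"
  by (simp add: col_def)

lemma colI:
  assumes "\<And>i. i < 5 \<Longrightarrow> fst y \<noteq> fst (n i)"
  shows "col y"
  unfolding col_def using u_nbr[of y] assms B_sym[of y u] by auto

lemma col_sum:
  assumes "col y" "perm5 i j k l m"
  shows "B y (r j i) + B y (r k i) + B y (r l i) + B y (r m i) = 0"
    "\<bar>B y (r j i)\<bar> + \<bar>B y (r k i)\<bar> + \<bar>B y (r l i)\<bar> + \<bar>B y (r m i)\<bar> \<le> 2"
  using thin_sum[OF star_n[OF assms(2)], of y] assms(1) perm5_less(1)[OF assms(2)] by (auto simp: col_def)

lemma r_common_n: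
  assumes "i < 5" "j < 5" "k < 5" "i \<noteq> j" "j \<noteq> k" "i \<noteq> k"
  shows "\<exists>!q. B (r i j) q = 1 \<and> B (r k j) q = -1"
  by (rule other_common[of "r i j" "n j" "r k j"])
    (use B_r_n assms r_inj[of i j k j] in \<open>auto simp: doubleton_eq_iff\<close>)

definition C :: "nat \<Rightarrow> nat \<Rightarrow> nat \<Rightarrow> 'a \<times> bool" where
  "C i j k = (THE q. B (r i j) q = 1 \<and> B (r k j) q = -1)"

lemma C_eq:
  assumes "i < 5" "j < 5" "k < 5" "i \<noteq> j" "j \<noteq> k" "i \<noteq> k" "B q (r i j) = 1" "B q (r j k) = 1"
  shows "q = C i j k"
proof -
  have "B (r i j) q = 1 \<and> B (r k j) q = -1"
    using assms B_r_neg[of j k q] B_sym[of q "r i j"] B_sym[of q "r k j"] by simp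
  then show ?thesis
    unfolding C_def by (rule the1_equality[OF r_common_n[OF assms(1-6)], symmetric])
qed

lemma B_C:
  assumes "i < 5" "j < 5" "k < 5" "i \<noteq> j" "j \<noteq> k" "i \<noteq> k"
  shows "B (C i j k) (r i j) = 1" "B (C i j k) (r j k) = 1"
proof -
  have "B (r i j) (C i j k) = 1 \<and> B (r k j) (C i j k) = -1"
    unfolding C_def by (rule theI'[OF r_common_n[OF assms]])
  then show "B (C i j k) (r i j) = 1" "B (C i j k) (r j k) = 1"
    using B_r_neg[of k j "C i j k"] assms B_sym[of "C i j k" "r i j"] B_sym[of "C i j k" "r k j"] by simp_all
qed

lemma col_C:
  assumes "i < 5" "j < 5" "k < 5" "i \<noteq> j" "j \<noteq> k" "i \<noteq> k"
  shows "col (C i j k)"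
proof (rule colI)
  fix a :: nat assume a: "a < 5"
  show "fst (C i j k) \<noteq> fst (n a)"
  proof
    assume eq: "fst (C i j k) = fst (n a)"
    then have "B (r i j) (n a) \<noteq> 0" "B (r j k) (n a) \<noteq> 0"
      using B_C[OF assms] B_fst_cong[OF eq, of "r i j"] B_fst_cong[OF eq, of "r j k"]
        B_sym[of "C i j k" "r i j"] B_sym[of "C i j k" "r j k"] by simp_all
    then have "a = j" using B_r_n_iff[of i j a] B_r_n_iff[of j k a] assms a by auto
    then have "B (C i j k) (r i j) = - B (C i j k) (r j k)"
      using fst_eq_imp[OF eq] B_r_n(1)[of i j] B_r_n(2)[of j k] assms
        B_sym[of "n j" "r i j"] B_sym[of "n j" "r j k"] by auto
    then show False using B_C[OF assms] by simp
  qed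
qed

definition cyc :: "'a \<times> bool \<Rightarrow> nat list \<Rightarrow> bool" where
  "cyc y c \<longleftrightarrow> col y \<and> (\<forall>a<5. \<forall>b<5. a \<noteq> b \<longrightarrow>
     B y (r a b) = (if (a, b) \<in> edges c then 1 else if (b, a) \<in> edges c then -1 else 0))"

text \<open>The rows of \<open>n i\<close>, ..., \<open>n m\<close> at \<open>C i j k\<close> are
  exactly the hypotheses of \<open>flow_cases\<close>, once antisymmetry of \<open>r\<close> has
  oriented all edges along the order i, j, k, l, m.\<close>

lemma C_cases:
  assumes p: "perm5 i j k l m"
  obtains "cyc (C i j k) [i, j, k]" | "cyc (C i j k) [i, j, k, l]" | "cyc (C i j k) [i, j, k, m]"
    | "cyc (C i j k) [i, j, k, l, m]" | "cyc (C i j k) [i, j, k, m, l]"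
proof -
  note d = perm5_neq[OF p] and less = perm5_less[OF p]
  let ?y = "C i j k"
  have c: "col ?y" using col_C d less by auto
  have ps: "perm5 i j k l m" "perm5 j i k l m" "perm5 k i j l m" "perm5 l i j k m" "perm5 m i j k l"
    using p unfolding perm5_def by auto
  have neg: "B ?y (r b a) = - B ?y (r a b)" if "a < 5" "b < 5" "a \<noteq> b" for a b
    using B_r_neg that by blast
  have ne: "B ?y (r j i) = - B ?y (r i j)" "B ?y (r k i) = - B ?y (r i k)" "B ?y (r l i) = - B ?y (r i l)"
    "B ?y (r m i) = - B ?y (r i m)" "B ?y (r k j) = - B ?y (r j k)" "B ?y (r l j) = - B ?y (r j l)"
    "B ?y (r m j) = - B ?y (r j m)" "B ?y (r l k) = - B ?y (r k l)" "B ?y (r m k) = - B ?y (r k m)"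
    "B ?y (r m l) = - B ?y (r l m)"
    by (rule neg, rule less, rule less, rule d)+
  have v: "\<bar>B ?y z\<bar> \<le> 1" for z using B_vals[of ?y z] by auto
  have y1: "B ?y (r i j) = 1" "B ?y (r j k) = 1" using B_C d less by auto
  have s1: "B ?y (r i j) + B ?y (r i k) + B ?y (r i l) + B ?y (r i m) = 0"
    using col_sum(1)[OF c ps(1), unfolded ne abs_minus_cancel] by simp
  have s2: "\<bar>B ?y (r i j)\<bar> + \<bar>B ?y (r i k)\<bar> + \<bar>B ?y (r i l)\<bar> + \<bar>B ?y (r i m)\<bar> \<le> 2"
    using col_sum(2)[OF c ps(1), unfolded ne abs_minus_cancel] by simp
  have s3: "- B ?y (r i j) + B ?y (r j k) + B ?y (r j l) + B ?y (r j m) = 0"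
    using col_sum(1)[OF c ps(2), unfolded ne abs_minus_cancel] by simp
  have s4: "\<bar>B ?y (r i j)\<bar> + \<bar>B ?y (r j k)\<bar> + \<bar>B ?y (r j l)\<bar> + \<bar>B ?y (r j m)\<bar> \<le> 2"
    using col_sum(2)[OF c ps(2), unfolded ne abs_minus_cancel] by simp
  have s5: "- B ?y (r i k) - B ?y (r j k) + B ?y (r k l) + B ?y (r k m) = 0"
    using col_sum(1)[OF c ps(3), unfolded ne abs_minus_cancel] by simp
  have s6: "\<bar>B ?y (r i k)\<bar> + \<bar>B ?y (r j k)\<bar> + \<bar>B ?y (r k l)\<bar> + \<bar>B ?y (r k m)\<bar> \<le> 2"
    using col_sum(2)[OF c ps(3), unfolded ne abs_minus_cancel] by simp
  have s7: "- B ?y (r i l) - B ?y (r j l) - B ?y (r k l) + B ?y (r l m) = 0"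
    using col_sum(1)[OF c ps(4), unfolded ne abs_minus_cancel] by simp
  have s8: "\<bar>B ?y (r i l)\<bar> + \<bar>B ?y (r j l)\<bar> + \<bar>B ?y (r k l)\<bar> + \<bar>B ?y (r l m)\<bar> \<le> 2"
    using col_sum(2)[OF c ps(4), unfolded ne abs_minus_cancel] by simp
  have s9: "- B ?y (r i m) - B ?y (r j m) - B ?y (r k m) - B ?y (r l m) = 0"
    using col_sum(1)[OF c ps(5), unfolded ne abs_minus_cancel] by simp
  have s10: "\<bar>B ?y (r i m)\<bar> + \<bar>B ?y (r j m)\<bar> + \<bar>B ?y (r k m)\<bar> + \<bar>B ?y (r l m)\<bar> \<le> 2"
    using col_sum(2)[OF c ps(5), unfolded ne abs_minus_cancel] by simp
  note f = flow_cases[OF y1 v v v v v v v v s1 s2 s3 s4 s5 s6 s7 s8 s9 s10]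
  \<comment> \<open>One orientation of each of the ten edges. The second conjunct below forbids both
    orientations in \<open>c\<close>, so that antisymmetry yields the remaining ten values.\<close>
  let ?S = "{(i, j), (i, k), (i, l), (i, m), (j, k), (j, l), (j, m), (k, l), (k, m), (l, m)}"
  have cycI: "cyc ?y c" if S: "\<forall>(a, b)\<in>?S.
      B ?y (r a b) = (if (a, b) \<in> edges c then 1 else if (b, a) \<in> edges c then -1 else 0) \<and>
      \<not> ((a, b) \<in> edges c \<and> (b, a) \<in> edges c)" for c
    unfolding cyc_def
  proof (intro conjI allI impI)
    show "col ?y" by (rule c)
    fix a b :: nat assume ab: "a < 5" "b < 5" "a \<noteq> b"
    have "(a, b) \<in> ?S \<or> (b, a) \<in> ?S"
      using perm5_cases[OF p ab(1)] perm5_cases[OF p ab(2)] ab(3) by (elim disjE) simp_all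
    then show "B ?y (r a b) = (if (a, b) \<in> edges c then 1 else if (b, a) \<in> edges c then -1 else 0)"
    proof
      assume "(b, a) \<in> ?S"
      then show ?thesis using bspec[OF S] neg[of b a] ab by fastforce
    next
      assume "(a, b) \<in> ?S"
      then show ?thesis using bspec[OF S] by fastforce
    qed
  qed
  have jlm: "B ?y (r j l) = 0" "B ?y (r j m) = 0" using f by simp_all
  from conjunct2[OF conjunct2[OF f]] show ?thesis
  proof (elim disjE conjE, goal_cases)
    case 1
    have "cyc ?y [i, j, k]" by (rule cycI) (use 1 y1 jlm d in auto)
    then show ?thesis using that(1) by blast
  next
    case 2
    have "cyc ?y [i, j, k, l]" by (rule cycI) (use 2 y1 jlm d in auto)
    then show ?thesis using that(2) by blast
  next
    case 3
    have "cyc ?y [i, j, k, m]" by (rule cycI) (use 3 y1 jlm d in auto)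
    then show ?thesis using that(3) by blast
  next
    case 4
    have "cyc ?y [i, j, k, l, m]" by (rule cycI) (use 4 y1 jlm d in auto)
    then show ?thesis using that(4) by blast
  next
    case 5
    have "cyc ?y [i, j, k, m, l]" by (rule cycI) (use 5 y1 jlm d in auto)
    then show ?thesis using that(5) by blast
  qed
qed

lemma cyc_path:
  assumes "cyc y c" "(i, j) \<in> edges c" "(j, k) \<in> edges c" "i < 5" "j < 5" "k < 5" "i \<noteq> j" "j \<noteq> k" "i \<noteq> k"
  shows "y = C i j k"
  by (rule C_eq) (use assms in \<open>auto simp: cyc_def\<close>)

lemma cyc_col: "cyc y c \<Longrightarrow> col y"
  by (simp add: cyc_def)

lemma cyc_B:
  assumes "cyc y c" "a < 5" "b < 5" "a \<noteq> b"
  shows "B y (r a b) = (if (a, b) \<in> edges c then 1 else if (b, a) \<in> edges c then -1 else 0)"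
  using assms by (simp add: cyc_def)

lemma cyc_neg:
  assumes "cyc y c" "\<And>a b. (a, b) \<in> edges c' \<longleftrightarrow> (b, a) \<in> edges c" "\<And>a b. \<not> ((a, b) \<in> edges c \<and> (b, a) \<in> edges c)"
  shows "cyc (neg y) c'"
  using assms unfolding cyc_def by auto

lemma cyc_edges:
  assumes "cyc y c" "edges c' = edges c"
  shows "cyc y c'"
  using assms by (simp add: cyc_def)

text \<open>Disjoint edges on a cycle lie on a second cycle, with the opposite relative orientation.\<close>

lemma opposite:
  assumes p: "perm5 i j k l m" and y: "B y (r i j) = 1" "B y (r k l) = 1"
  obtains q where "col q" "B q (r i j) = 1" "B q (r l k) = 1"
proof -
  note d = perm5_neq[OF p] and less = perm5_less[OF p]
  have "fst (r i j) \<noteq> fst (r k l)" using r_inj[of i j k l] d less by (auto simp: doubleton_eq_iff)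
  then obtain q where q: "B (r i j) q = 1" "B (r k l) q = -1"
    using other_common[of "r i j" y "r k l"] y B_sym[of y "r i j"] B_sym[of y "r k l"] by auto
  have "col q"
  proof (rule colI)
    fix a :: nat assume a: "a < 5"
    show "fst q \<noteq> fst (n a)"
    proof
      assume eq: "fst q = fst (n a)"
      then have "B (r i j) (n a) \<noteq> 0" "B (r k l) (n a) \<noteq> 0"
        using B_fst_cong[OF eq, of "r i j"] B_fst_cong[OF eq, of "r k l"] q by simp_all
      then show False using B_r_n_iff[of i j a] B_r_n_iff[of k l a] a d less by auto
    qed
  qed
  then show ?thesis using that[of q] q B_r_neg[of k l q] B_sym[of q] d less by auto
qed

text \<open>The second cycle runs from i to j and from l to k. After j it cannot go to k, or it
  would be \<open>y\<close>, which runs from k to l. Among the cycles that go on to l or m, three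
  contain the step from l to k.\<close>

lemma opposite_cases:
  assumes p: "perm5 i j k l m" and y: "cyc y c" "(i, j) \<in> edges c" "(j, k) \<in> edges c" "(k, l) \<in> edges c"
  obtains q where "cyc q [i, j, l, k]" | q where "cyc q [i, j, l, k, m]" | q where "cyc q [i, j, m, l, k]"
proof -
  note d = perm5_neq[OF p] and less = perm5_less[OF p]
  have "B y (r i j) = 1" "B y (r k l) = 1" using cyc_B[OF y(1)] y d less by auto
  then obtain q where q: "col q" "B q (r i j) = 1" "B q (r l k) = 1" using opposite[OF p] by blast
  have yC: "y = C i j k" by (rule cyc_path[OF y(1-3)]) (use d less in auto)
  have "perm5 j i k l m" using p unfolding perm5_def by auto
  note sum = col_sum(1)[OF q(1) this]
  have neg: "B q (r k j) = - B q (r j k)" "B q (r l j) = - B q (r j l)" "B q (r m j) = - B q (r j m)"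
    by (rule B_r_neg, rule less, rule less, rule d)+
  have "B q (r j k) = 1 \<or> B q (r j l) = 1 \<or> B q (r j m) = 1"
  proof (rule ccontr)
    assume no: "\<not> ?thesis"
    then have "B q (r j k) \<le> 0" "B q (r j l) \<le> 0" "B q (r j m) \<le> 0"
      using B_vals[of q "r j k"] B_vals[of q "r j l"] B_vals[of q "r j m"] by auto
    then show False using sum[unfolded neg] q(2) by linarith
  qed
  moreover have "q = C i j k" if "B q (r j k) = 1" by (intro C_eq q(2) less d that)
  moreover have "q = C i j l" if "B q (r j l) = 1" by (intro C_eq q(2) less d that)
  moreover have "q = C i j m" if "B q (r j m) = 1" by (intro C_eq q(2) less d that)
  ultimately consider "q = C i j k" | "q = C i j l" | "q = C i j m" by blast
  note split = this
  have key: "(l, k) \<in> edges c" if "cyc q c" for c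
    using cyc_B[OF that less(4,3) d(15)] q(3) by (simp split: if_splits)
  from split show ?thesis
  proof cases
    case 1
    then have "B y (r l k) = 1" using q yC by simp
    moreover have "B y (r k l) = 1" using cyc_B[OF y(1)] y d less by auto
    ultimately show ?thesis using B_r_neg[of k l y] d less by simp
  next
    case 2
    have p': "perm5 i j l k m" using p unfolding perm5_def by auto
    from C_cases[OF p', folded 2] show ?thesis
    proof cases
      case 1
      then show ?thesis using key[OF 1] d by simp
    next
      case 2
      then show ?thesis by (rule that(1))
    next
      case 3
      then show ?thesis using key[OF 3] d by simp
    next
      case 4
      then show ?thesis by (rule that(2))
    next
      case 5
      then show ?thesis using key[OF 5] d by simp
    qed
  next
    case 3
    have p': "perm5 i j m k l" using p unfolding perm5_def by auto
    from C_cases[OF p', folded 3] show ?thesis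
    proof cases
      case 1
      then show ?thesis using key[OF 1] d by simp
    next
      case 2
      then show ?thesis using key[OF 2] d by simp
    next
      case 3
      then show ?thesis using key[OF 3] d by simp
    next
      case 4
      then show ?thesis using key[OF 4] d by simp
    next
      case 5
      then show ?thesis by (rule that(3))
    qed
  qed
qed

end

text \<open>At a point with a nonzero value there is one 1 and one -1. So the nonzero edges form
  cycles with alternating signs, of even length; on five points such a cycle has length 4, and j and
  k have a second common neighbour on it.\<close>

lemma alt_cases:
  fixes ij ik il im jk jl jm kl km lm :: int
  assumes v: "ij = 1" "ik = -1" "\<bar>jk\<bar> \<le> 1" "\<bar>il\<bar> \<le> 1" "\<bar>im\<bar> \<le> 1" "\<bar>jl\<bar> \<le> 1" "\<bar>jm\<bar> \<le> 1"
      "\<bar>kl\<bar> \<le> 1" "\<bar>km\<bar> \<le> 1" "\<bar>lm\<bar> \<le> 1"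
    and i: "ij + ik + il + im = 0" "\<bar>ij\<bar> + \<bar>ik\<bar> + \<bar>il\<bar> + \<bar>im\<bar> \<le> 2"
    and j: "ij + jk + jl + jm = 0" "\<bar>ij\<bar> + \<bar>jk\<bar> + \<bar>jl\<bar> + \<bar>jm\<bar> \<le> 2"
    and k: "ik + jk + kl + km = 0" "\<bar>ik\<bar> + \<bar>jk\<bar> + \<bar>kl\<bar> + \<bar>km\<bar> \<le> 2"
    and l: "il + jl + kl + lm = 0" "\<bar>il\<bar> + \<bar>jl\<bar> + \<bar>kl\<bar> + \<bar>lm\<bar> \<le> 2"
    and m: "im + jm + km + lm = 0" "\<bar>im\<bar> + \<bar>jm\<bar> + \<bar>km\<bar> + \<bar>lm\<bar> \<le> 2"
  shows "jl \<noteq> 0 \<and> kl \<noteq> 0 \<or> jm \<noteq> 0 \<and> km \<noteq> 0"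
proof -
  have "\<bar>il\<bar> + \<bar>im\<bar> \<le> 0" using i(2) v(1,2) by simp
  then have ilm: "il = 0" "im = 0" by simp_all
  have "jk = 0"
  proof (rule ccontr)
    assume "jk \<noteq> 0"
    then have jk: "\<bar>jk\<bar> = 1" using v(3) by linarith
    have "\<bar>jl\<bar> + \<bar>jm\<bar> \<le> 0" using j(2) v(1) jk by simp
    then have "jl = 0" "jm = 0" by simp_all
    moreover have "\<bar>kl\<bar> + \<bar>km\<bar> \<le> 0" using k(2) v(2) jk by simp
    then have "kl = 0" "km = 0" by simp_all
    ultimately show False using j(1) k(1) v(1,2) by simp
  qed
  then have "jl + jm = -1" "\<bar>jl\<bar> + \<bar>jm\<bar> \<le> 1" "kl + km = 1" "\<bar>kl\<bar> + \<bar>km\<bar> \<le> 1"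
    using j k v(1,2) by simp_all
  then have "jl = -1 \<and> jm = 0 \<or> jl = 0 \<and> jm = -1" "kl = 1 \<and> km = 0 \<or> kl = 0 \<and> km = 1"
    by arith+
  then show ?thesis
    using l(1) m(1) ilm by auto
qed

lemma perm5I:
  assumes "distinct [i, j, k, l, m]" "i < 5" "j < 5" "k < 5" "l < 5" "m < 5"
  shows "perm5 i j k l m"
  unfolding perm5_def
  by (rule card_seteq) (use assms in auto)

context ortho5
begin

text \<open>Injectivity on the side \<open>s\<close> determines the neighbourhoods of the images of
  the other side, and \<open>dist\<close> says that they separate its vertices. The alternative is
  that the images of both sides coincide with \<open>V\<close>.\<close>

lemma recognize_one_side:
  fixes s :: "'b \<Rightarrow> bool"
  assumes fin: "finite (pverts (ugraph \<Gamma>'))" and ne: "pverts (ugraph \<Gamma>') \<noteq> {}"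
    and M: "\<And>i j. i \<in> pverts (ugraph \<Gamma>') \<Longrightarrow> j \<in> pverts (ugraph \<Gamma>') \<Longrightarrow> signed_adj \<Gamma>' i j \<noteq> 0 \<Longrightarrow>
      s i \<noteq> s j \<and> B (f i) (f j) = signed_adj \<Gamma>' i j"
    and card: "\<And>i. i \<in> pverts (ugraph \<Gamma>') \<Longrightarrow> card {j\<in>pverts (ugraph \<Gamma>'). signed_adj \<Gamma>' i j \<noteq> 0} \<ge> 5"
    and inj: "inj_on (fst \<circ> f) {i\<in>pverts (ugraph \<Gamma>'). s i}"
    and dist: "\<And>i j. i \<in> pverts (ugraph \<Gamma>') \<Longrightarrow> j \<in> pverts (ugraph \<Gamma>') \<Longrightarrow> \<not> s i \<Longrightarrow> \<not> s j \<Longrightarrow>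
      \<forall>k\<in>pverts (ugraph \<Gamma>'). signed_adj \<Gamma>' i k \<noteq> 0 \<longrightarrow> signed_adj \<Gamma>' j k \<noteq> 0 \<Longrightarrow> i = j"
  shows "equiv_to \<Gamma>' \<or> card V \<le> card {i\<in>pverts (ugraph \<Gamma>'). s i}"
proof -
  let ?I = "pverts (ugraph \<Gamma>')" and ?M = "signed_adj \<Gamma>'"
  have N: "{y. A (fst (f i)) y \<noteq> 0} = fst ` f ` {j\<in>?I. ?M i j \<noteq> 0}" if "i \<in> ?I" "\<not> s i" for i
    by (rule signed_image_nbrs)
      (use card[OF that(1)] fin M that in \<open>auto intro: inj_on_subset[OF inj]\<close>)
  have inj': "inj_on (fst \<circ> f) {i\<in>?I. \<not> s i}"
  proof (rule inj_onI)
    fix i j assume i: "i \<in> {i\<in>?I. \<not> s i}" and j: "j \<in> {i\<in>?I. \<not> s i}" and eq: "(fst \<circ> f) i = (fst \<circ> f) j"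
    have "?M j k \<noteq> 0" if k: "k \<in> ?I" "?M i k \<noteq> 0" for k
    proof -
      have "fst (f k) \<in> {y. A (fst (f i)) y \<noteq> 0}" using N[of i] i k by blast
      moreover have "{y. A (fst (f i)) y \<noteq> 0} = fst ` f ` {k\<in>?I. ?M j k \<noteq> 0}"
        using N[of j] eq j by simp
      ultimately have "fst (f k) \<in> fst ` f ` {k\<in>?I. ?M j k \<noteq> 0}" by blast
      then obtain k' where k': "k' \<in> ?I" "?M j k' \<noteq> 0" "fst (f k) = fst (f k')" by blast
      moreover have "s k" "s k'" using M[of i k] M[of j k'] i j k k' by auto
      ultimately have "k = k'" using inj_onD[OF inj, of k k'] k by simp
      then show ?thesis using k' by simp
    qed
    then show "i = j" using dist[of i j] i j by blast
  qed
  have "inj_on (fst \<circ> f) {i\<in>?I. s i = b}" for b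
    using inj inj' by (cases b) simp_all
  from recognize_bipartite[OF fin ne M card this]
  show ?thesis
  proof
    assume inj_I: "inj_on (fst \<circ> f) ?I"
    have "equiv_to \<Gamma>'"
    proof (rule equiv_toI[OF fin ne inj_I])
      show "B (f i) (f j) = signed_adj \<Gamma>' i j" if "i \<in> ?I" "j \<in> ?I" "signed_adj \<Gamma>' i j \<noteq> 0" for i j
        using M[OF that] by simp
      show "5 \<le> card {j\<in>?I. signed_adj \<Gamma>' i j \<noteq> 0}" if "i \<in> ?I" for i by (rule card[OF that])
    qed
    then show ?thesis by blast
  next
    assume "\<forall>b. V = fst ` f ` {i\<in>?I. s i = b}"
    from spec[OF this, of True] have "V = fst ` f ` {i\<in>?I. s i}" by simp
    then have "card V \<le> card {i\<in>?I. s i}"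
      using fin card_image_le[of "{i\<in>?I. s i}" "fst \<circ> f"] by (simp add: image_comp)
    then show ?thesis by blast
  qed
qed

end

section \<open>Rows, columns and relabelling\<close>

context nbhd
begin

text \<open>An edge between neighbours of \<open>u\<close> produces by \<open>alt_cases\<close> a
  4-cycle among them; two opposite vertices of it then share \<open>u\<close> and the other
  two.\<close>

lemma n_nonadjacent:
  assumes "i < 5" "j < 5"
  shows "B (n i) (n j) = 0"
proof (rule ccontr)
  assume nz: "B (n i) (n j) \<noteq> 0"
  then have ij: "i \<noteq> j" by auto
  let ?h = "\<lambda>a b. B (n a) (n b)"
  have st: "star u [n i, n j, n k, n l, n m]" if "perm5 i j k l m" for i j k l m
  proof -
    have "fst (n a) \<noteq> fst (n b)" if "a < 5" "b < 5" "a \<noteq> b" for a b using n_inj that by blast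
    then show ?thesis using perm5_less[OF that] perm5_neq[OF that] B_u_n by (simp add: star_def)
  qed
  have sum: "?h i j + ?h i k + ?h i l + ?h i m = 0"
    "\<bar>?h i j\<bar> + \<bar>?h i k\<bar> + \<bar>?h i l\<bar> + \<bar>?h i m\<bar> \<le> 2" if "perm5 i j k l m" for i j k l m
    using thin_sum[OF st[OF that], of "n i"] u_neq_n[of i] perm5_less(1)[OF that] by auto
  obtain k l m where p: "perm5 i j k l m" using perm5_ex2 assms ij by metis
  note d = perm5_neq[OF p] and less = perm5_less[OF p]
  have "\<exists>a\<in>{j, k, l, m}. ?h i a = 1"
  proof (rule ccontr)
    assume "\<not> ?thesis"
    then have "?h i j \<noteq> 1" "?h i k \<noteq> 1" "?h i l \<noteq> 1" "?h i m \<noteq> 1" by blast+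
    then have "?h i j \<le> 0" "?h i k \<le> 0" "?h i l \<le> 0" "?h i m \<le> 0"
      using B_vals[of "n i" "n j"] B_vals[of "n i" "n k"] B_vals[of "n i" "n l"] B_vals[of "n i" "n m"] by linarith+
    then show False using sum(1)[OF p] nz by linarith
  qed
  then obtain a where a: "a \<in> {j, k, l, m}" "?h i a = 1" by blast
  have "\<exists>b\<in>{j, k, l, m}. ?h i b = -1"
  proof (rule ccontr)
    assume "\<not> ?thesis"
    then have "?h i j \<noteq> -1" "?h i k \<noteq> -1" "?h i l \<noteq> -1" "?h i m \<noteq> -1" by blast+
    then have "?h i j \<ge> 0" "?h i k \<ge> 0" "?h i l \<ge> 0" "?h i m \<ge> 0"
      using B_vals[of "n i" "n j"] B_vals[of "n i" "n k"] B_vals[of "n i" "n l"] B_vals[of "n i" "n m"] by linarith+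
    then show False using sum(1)[OF p] nz by linarith
  qed
  then obtain b where b: "b \<in> {j, k, l, m}" "?h i b = -1" by blast
  have ab: "a < 5" "b < 5" "i \<noteq> a" "i \<noteq> b" "a \<noteq> b" using a b less d by auto
  obtain c e where q: "perm5 i a b c e" using perm5_ex3[OF less(1) ab(1,2,3,4,5)] .
  note d' = perm5_neq[OF q] and less' = perm5_less[OF q]
  have q': "perm5 a i b c e" "perm5 b i a c e" "perm5 c i a b e" "perm5 e i a b c"
    using q unfolding perm5_def by auto
  have v: "\<bar>?h x y\<bar> \<le> 1" for x y using B_vals[of "n x" "n y"] by auto
  have sy: "?h a i = ?h i a" "?h b i = ?h i b" "?h c i = ?h i c" "?h e i = ?h i e" "?h b a = ?h a b"
    "?h c a = ?h a c" "?h e a = ?h a e" "?h c b = ?h b c" "?h e b = ?h b e" "?h e c = ?h c e"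
    by (rule B_sym)+
  have four: "\<not> (?h a c \<noteq> 0 \<and> ?h b c \<noteq> 0)" if "c < 5" "c \<noteq> i" for c
  proof
    assume h: "?h a c \<noteq> 0 \<and> ?h b c \<noteq> 0"
    have "fst (n i) = fst (n c)"
      by (rule no3[of "n i" u "n a" "n b" "n c"])
        (use h a b ab that less B_n_u u_neq_n n_inj B_sym[of "n c" "n a"] B_sym[of "n c" "n b"] in auto)
    then show False using n_inj that less by blast
  qed
  from alt_cases[OF a(2) b(2) v v v v v v v v sum[OF q] sum[OF q'(1), unfolded sy] sum[OF q'(2), unfolded sy]
      sum[OF q'(3), unfolded sy] sum[OF q'(4), unfolded sy]]
  show False using four[of c] four[of e] d' less' by blast
qed

lemma r_neq_n:
  assumes "i < 5" "j < 5" "i \<noteq> j" "k < 5"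
  shows "fst (r i j) \<noteq> fst (n k)"
proof
  assume "fst (r i j) = fst (n k)"
  from B_fst_cong[OF this, of "n j"] show False
    using B_r_n(1)[OF assms(1-3)] n_nonadjacent[of j k] assms B_sym[of "n j" "r i j"] by simp
qed

text \<open>The vertex, its neighbours and the vertices \<open>r i j\<close> with \<open>i < j\<close>.\<close>

definition near :: "nat \<times> nat \<Rightarrow> 'a \<times> bool" where
  "near v = (if fst v = 5 then u else if fst v = snd v then n (fst v) else r (fst v) (snd v))"

definition near_index :: "(nat \<times> nat) set" where
  "near_index = insert (5, 5) {(i, j). i \<le> j \<and> j < 5}"

lemma card_near_index: "finite near_index" "card near_index = 16"
proof -
  have "{(i, j). i \<le> j \<and> j < (5::nat)} = (SIGMA j:{..<5}. {..j})\<inverse>" by auto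
  then have "finite {(i, j). i \<le> j \<and> j < (5::nat)}" "card {(i, j). i \<le> j \<and> j < (5::nat)} = 15"
    by (simp_all add: card_inverse numeral_eq_Suc lessThan_Suc)
  then show "finite near_index" "card near_index = 16" by (simp_all add: near_index_def)
qed

lemma inj_near: "inj_on (fst \<circ> near) near_index"
proof (rule inj_onI)
  fix v w assume v: "v \<in> near_index" and w: "w \<in> near_index" and eq: "(fst \<circ> near) v = (fst \<circ> near) w"
  obtain i j k l where vw: "v = (i, j)" "w = (k, l)" by fastforce
  have v': "i = 5 \<and> j = 5 \<or> i < 5 \<and> j = i \<or> i < j \<and> i < 5 \<and> j < 5" using v vw by (auto simp: near_index_def)
  have w': "k = 5 \<and> l = 5 \<or> k < 5 \<and> l = k \<or> k < l \<and> k < 5 \<and> l < 5" using w vw by (auto simp: near_index_def)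
  from v' w' show "v = w"
    using eq vw u_neq_n[of i] u_neq_n[of k] r_neq_u[of i j] r_neq_u[of k l] n_inj[of i k]
      r_neq_n[of i j k] r_neq_n[of k l i] r_inj[of i j k l]
    by (elim disjE conjE) (simp_all add: near_def, auto simp: doubleton_eq_iff)
qed

lemma near_in_V: "v \<in> near_index \<Longrightarrow> fst (near v) \<in> V"
proof -
  assume v: "v \<in> near_index"
  have "fst (r i j) \<in> V" if "i < 5" "j < 5" "i \<noteq> j" for i j
    using B_in_V(1)[of "r i j" "n j"] B_r_n(1)[OF that] by simp
  moreover have "fst (n i) \<in> V" if "i < 5" for i
    using B_in_V[of u "n i"] B_u_n[OF that] by simp
  moreover have "fst u \<in> V" using star_in_V[OF star_u] .
  ultimately show ?thesis using v by (auto simp: near_index_def near_def)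
qed

text \<open>There are 1 + 5 + 10 vertices near \<open>u\<close>. In applications of
  \<open>recognize_one_side\<close> to sides with fewer than 16 vertices, this rules out a
  quotient.\<close>

lemma card_V: "16 \<le> card V"
proof -
  have "card ((fst \<circ> near) ` near_index) = 16" using card_image[OF inj_near] card_near_index by simp
  moreover have "(fst \<circ> near) ` near_index \<subseteq> V" using near_in_V by auto
  ultimately show ?thesis using card_mono[OF finite_V] by metis
qed

text \<open>A common vertex would have three nonzero edges at the point j: one entering and two
  leaving.\<close>

lemma C_neq:
  assumes "perm5 i j k l m"
  shows "fst (C i j k) \<noteq> fst (C i j l)"
proof
  note d = perm5_neq[OF assms] and less = perm5_less[OF assms]
  assume eq: "fst (C i j k) = fst (C i j l)"
  have C: "B (C i j k) (r i j) = 1" "B (C i j k) (r j k) = 1" "B (C i j l) (r i j) = 1" "B (C i j l) (r j l) = 1"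
    using B_C[of i j k] B_C[of i j l] less d by simp_all
  have "C i j k = C i j l"
    using fst_eq_imp[OF eq] C by auto
  then have b: "B (C i j k) (r j l) = 1" using C by simp
  have "perm5 j i k l m" using assms unfolding perm5_def by auto
  from col_sum(2)[OF col_C this, of i j k]
  show False using b C less d B_r_neg[of j k "C i j k"] B_r_neg[of j l "C i j k"] by simp
qed

lemma star_r:
  assumes p: "perm5 i j k l m"
  shows "star (r i j) [n j, neg (n i), C i j k, C i j l, C i j m]"
proof -
  note d = perm5_neq[OF assms] and less = perm5_less[OF assms]
  have p': "perm5 i j k m l" "perm5 i j l m k" using p unfolding perm5_def by auto
  have c: "col (C i j k)" "col (C i j l)" "col (C i j m)" using col_C less d by simp_all
  have B: "B (r i j) (C i j k) = 1" "B (r i j) (C i j l) = 1" "B (r i j) (C i j m) = 1"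
    using B_C(1)[of i j] less d B_sym[of "r i j"] by simp_all
  have nn: "fst (n j) \<noteq> fst (n i)" using n_inj less d by blast
  have cn: "fst (n a) \<noteq> fst (C i j b)" if "a < 5" "b = k \<or> b = l \<or> b = m" for a b
    using c that unfolding col_def by metis
  show ?thesis
    using B B_r_n[of i j] less d nn cn C_neq[OF p] C_neq[OF p'(1)] C_neq[OF p'(2)]
    by (simp add: star_def)
qed

text \<open>The remaining candidates for rows. Neighbours of the \<open>n i\<close> are
  \<open>u\<close> and the \<open>r a b\<close> only, so such a vertex sees just the three
  \<open>C\<close> in the star of \<open>r i j\<close>.\<close>

definition row :: "'a \<times> bool \<Rightarrow> bool" where
  "row s \<longleftrightarrow> fst s \<noteq> fst u \<and> (\<forall>a<5. \<forall>b<5. a \<noteq> b \<longrightarrow> fst s \<noteq> fst (r a b))"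

lemma row_n: "row s \<Longrightarrow> a < 5 \<Longrightarrow> B s (n a) = 0"
  using n_nbr[of a s] B_sym[of s "n a"] unfolding row_def by metis

lemma row_sum:
  assumes "row s" and p: "perm5 i j k l m"
  shows "B s (C i j k) + B s (C i j l) + B s (C i j m) = 0"
    "\<bar>B s (C i j k)\<bar> + \<bar>B s (C i j l)\<bar> + \<bar>B s (C i j m)\<bar> \<le> 2"
proof -
  have "fst s \<noteq> fst (r i j)" using assms(1) perm5_less[OF p] perm5_neq[OF p] by (simp add: row_def)
  from thin_sum[OF star_r[OF p] this] show "B s (C i j k) + B s (C i j l) + B s (C i j m) = 0"
    "\<bar>B s (C i j k)\<bar> + \<bar>B s (C i j l)\<bar> + \<bar>B s (C i j m)\<bar> \<le> 2"
    using row_n[OF assms(1)] perm5_less[OF p] by simp_all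
qed

text \<open>The five edges of a 5-cycle already use up the degree of its vertex.\<close>

lemma star_cyc5:
  assumes p: "perm5 i j k l m" and y: "cyc y [i, j, k, l, m]"
  shows "star y [r i j, r j k, r k l, r l m, r m i]"
proof -
  note d = perm5_neq[OF p] and less = perm5_less[OF p]
  have "fst (r a b) \<noteq> fst (r c e)" if "a < 5" "b < 5" "c < 5" "e < 5" "a \<noteq> b" "c \<noteq> e" "{a, b} \<noteq> {c, e}" for a b c e
    using r_inj[of a b c e] that by blast
  then show ?thesis
    using cyc_B[OF y] d less by (simp add: star_def doubleton_eq_iff)
qed

lemma row_cyc5:
  assumes "row s" and p: "perm5 i j k l m" and "cyc y [i, j, k, l, m]"
  shows "B s y = 0"
  using star_zero[OF star_cyc5[OF p assms(3)], of s] assms(1) B_sym[of s y] perm5_neq[OF p] perm5_less[OF p]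
  by (simp add: row_def)

text \<open>A 4-cycle leaves one neighbour open, and another \<open>r a b\<close> in its place would
  be a fifth edge of the cycle.\<close>

lemma row_cyc4:
  assumes p: "perm5 i j k l m" and y: "cyc y [i, j, k, l]"
  obtains s where "star y [r i j, r j k, r k l, r l i, s]" "row s" "B s y = 1"
proof -
  note d = perm5_neq[OF p] and less = perm5_less[OF p]
  have ne: "fst (r a b) \<noteq> fst (r c e)" if "a < 5" "b < 5" "c < 5" "e < 5" "a \<noteq> b" "c \<noteq> e" "{a, b} \<noteq> {c, e}" for a b c e
    using r_inj[of a b c e] that by blast
  have e: "B y (r i j) = 1" "B y (r j k) = 1" "B y (r k l) = 1" "B y (r l i) = 1"
    using cyc_B[OF y] d less by simp_all
  have "distinct (map fst [r i j, r j k, r k l, r l i])"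
    using ne d less by (simp add: doubleton_eq_iff)
  moreover have "fst y \<in> V" using B_in_V(1)[of y "r i j"] e by simp
  ultimately have "\<exists>ys. length ys = 1 \<and> star y ([r i j, r j k, r k l, r l i] @ ys)"
    using star_extend[of y "[r i j, r j k, r k l, r l i]"] e by simp
  then obtain s where st: "star y [r i j, r j k, r k l, r l i, s]" by (auto simp: length_Suc_conv)
  have ys: "B y s = 1" and sd: "fst s \<notin> {fst (r i j), fst (r j k), fst (r k l), fst (r l i)}"
    using st by (auto simp: star_def)
  have "row s"
    unfolding row_def
  proof (intro conjI allI impI)
    show "fst s \<noteq> fst u"
      using B_fst_cong[of s u y] ys cyc_col[OF y] by (auto simp: col_def)
    fix a b :: nat assume ab: "a < 5" "b < 5" "a \<noteq> b"
    show "fst s \<noteq> fst (r a b)"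
    proof
      assume eq: "fst s = fst (r a b)"
      then have "B y (r a b) \<noteq> 0" using B_fst_cong[OF eq, of y] ys by simp
      then have "(a, b) \<in> edges [i, j, k, l] \<or> (b, a) \<in> edges [i, j, k, l]"
        using cyc_B[OF y ab] by (simp del: edges_simps split: if_splits)
      moreover have "fst (r b a) = fst (r a b)" using r_neg[OF ab] by simp
      ultimately show False using sd eq by auto
    qed
  qed
  then show ?thesis using that st ys B_sym[of s y] by simp
qed

text \<open>The points 0, ..., 4 may be renamed at will, so the cases below can be treated for one
  fixed labelling.\<close>

lemma relabel:
  assumes p: "perm5 i j k l m"
  defines "\<iota> \<equiv> (\<lambda>a. [i, j, k, l, m] ! a)"
  shows "nbhd V A u (n \<circ> \<iota>)"
    and "set c \<subseteq> {..<5} \<Longrightarrow> cyc y (map \<iota> c) \<Longrightarrow> nbhd.cyc A u (n \<circ> \<iota>) y c"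
proof -
  note d = perm5_neq[OF p] and less = perm5_less[OF p]
  show nb: "nbhd V A u (n \<circ> \<iota>)"
  proof
    have "fst (n a) \<noteq> fst (n b)" if "a < 5" "b < 5" "a \<noteq> b" for a b using n_inj that by blast
    then show "star u [(n \<circ> \<iota>) 0, (n \<circ> \<iota>) 1, (n \<circ> \<iota>) 2, (n \<circ> \<iota>) 3, (n \<circ> \<iota>) 4]"
      using d less B_u_n by (simp add: \<iota>_def star_def)
  qed
  then interpret L: nbhd V A u "n \<circ> \<iota>" .
  have \<iota>: "\<iota> a < 5" if "a < 5" for a
    using L.less5[OF that] less by (auto simp: \<iota>_def)
  have \<iota>_inj: "a = b" if "a < 5" "b < 5" "\<iota> a = \<iota> b" for a b
    using L.less5[OF that(1)] L.less5[OF that(2)] that(3) d unfolding \<iota>_def by (elim disjE) simp_all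
  have r: "L.r a b = r (\<iota> a) (\<iota> b)" for a b
    by (simp add: L.r_def r_def)
  assume c: "set c \<subseteq> {..<5}" and y: "cyc y (map \<iota> c)"
  have e: "(\<iota> a, \<iota> b) \<in> edges (map \<iota> c) \<longleftrightarrow> (a, b) \<in> edges c" if ab: "a < 5" "b < 5" for a b
  proof -
    have eq: "edges (map \<iota> c) = map_prod \<iota> \<iota> ` edges c"
      unfolding edges_def rotate1_map zip_map_map by (auto simp: map_prod_def image_iff split_def)
    have c5: "x < 5 \<and> y < 5" if "(x, y) \<in> edges c" for x y
      using that c set_zip_leftD[of x y c "rotate1 c"] set_zip_rightD[of x y c "rotate1 c"]
      by (auto simp: edges_def)
    show ?thesis
    proof
      assume "(\<iota> a, \<iota> b) \<in> edges (map \<iota> c)"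
      then obtain x y where xy: "(x, y) \<in> edges c" "\<iota> x = \<iota> a" "\<iota> y = \<iota> b" unfolding eq by auto
      then have "x = a" "y = b" using \<iota>_inj c5[OF xy(1)] ab by blast+
      then show "(a, b) \<in> edges c" using xy(1) by simp
    next
      assume "(a, b) \<in> edges c"
      then have "map_prod \<iota> \<iota> (a, b) \<in> map_prod \<iota> \<iota> ` edges c" by (rule imageI)
      then show "(\<iota> a, \<iota> b) \<in> edges (map \<iota> c)" unfolding eq by simp
    qed
  qed
  show "L.cyc y c"
    unfolding L.cyc_def
  proof (intro conjI allI impI)
    show "L.col y" using cyc_col[OF y] \<iota> by (simp add: L.col_def col_def)
    fix a b :: nat assume "a < 5" "b < 5" "a \<noteq> b"
    then show "B y (L.r a b) = (if (a, b) \<in> edges c then 1 else if (b, a) \<in> edges c then -1 else 0)"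
      using cyc_B[OF y, of "\<iota> a" "\<iota> b"] \<iota> \<iota>_inj e unfolding r by metis
  qed
qed

end

section \<open>Weight and rows of weighing matrices\<close>

lemma count_nonzero:
  fixes g :: "'b \<Rightarrow> int"
  assumes "finite I" "\<And>i. i \<in> I \<Longrightarrow> g i \<in> {-1, 0, 1}"
  shows "int (card {i\<in>I. g i \<noteq> 0}) = (\<Sum>i\<in>I. g i * g i)"
proof -
  have "(\<Sum>i\<in>I. g i * g i) = (\<Sum>i\<in>I. if g i \<noteq> 0 then 1 else 0)"
  proof (rule sum.cong[OF refl])
    fix i assume "i \<in> I"
    from assms(2)[OF this] show "g i * g i = (if g i \<noteq> 0 then 1 else 0)" by auto
  qed
  then show ?thesis using assms(1) by (simp add: sum.If_cases Int_def)
qed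

lemma weighing_card:
  assumes W: "weighing_matrix I m k W" and i: "i \<in> I"
  shows "card {j\<in>I. W i j \<noteq> 0} = k"
proof -
  have "int (card {j\<in>I. W i j \<noteq> 0}) = (\<Sum>j\<in>I. W i j * W i j)"
    by (rule count_nonzero) (use W i in \<open>auto simp: weighing_matrix_def\<close>)
  also have "\<dots> = int k"
    using W i by (simp add: weighing_matrix_def mat_prod_def mat_transpose_def)
  finally show ?thesis by simp
qed

text \<open>Modulo 2, the product of the two rows agrees with the square of the first one, which is
  the odd weight; for distinct rows it would be 0.\<close>

lemma weighing_distinct:
  assumes W: "weighing_matrix I m k W" and k: "odd k" and i: "i \<in> I" "j \<in> I"
    and sub: "\<forall>z\<in>I. W i z \<noteq> 0 \<longrightarrow> W j z \<noteq> 0"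
  shows "i = j"
proof (rule ccontr)
  assume "i \<noteq> j"
  have fin: "finite I" and v: "\<And>i j. i \<in> I \<Longrightarrow> j \<in> I \<Longrightarrow> W i j \<in> {-1, 0, 1}"
    using W by (simp_all add: weighing_matrix_def)
  have "(\<Sum>z\<in>I. W i z * W j z) = 0"
    using W i \<open>i \<noteq> j\<close> by (simp add: weighing_matrix_def mat_prod_def mat_transpose_def)
  moreover have "even (\<Sum>z\<in>I. W i z * W j z) \<longleftrightarrow> even (\<Sum>z\<in>I. W i z * W i z)"
  proof -
    have "even (W i z * W j z - W i z * W i z)" if "z \<in> I" for z
      using v[OF i(1) that] v[OF i(2) that] sub that by auto
    then have "even (\<Sum>z\<in>I. W i z * W j z - W i z * W i z)" by (rule dvd_sum)
    then show ?thesis by (simp add: sum_subtractf)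
  qed
  moreover have "(\<Sum>z\<in>I. W i z * W i z) = int k"
    using W i by (simp add: weighing_matrix_def mat_prod_def mat_transpose_def)
  ultimately show False using k by simp
qed

lemma weighing_matrix_W12_5_transpose: "weighing_matrix ico_indices 12 5 (mat_transpose W12_5)"
proof -
  have "{..<5::nat} = {0, 1, 2, 3, 4}" by auto
  then have eq: "ico_indices =
      {Infty, Infty', Up 0, Up 1, Up 2, Up 3, Up 4, Lo 0, Lo 1, Lo 2, Lo 3, Lo 4}"
    unfolding ico_indices_def by auto
  show ?thesis
    unfolding eq by (simp add: weighing_matrix_def mat_prod_def mat_transpose_def)
qed

section \<open>A 5-cycle occurs: the matrix \<open>W12_5\<close>\<close>

context nbhd
begin

lemma r_fst_iff:
  assumes "a < 5" "b < 5" "a \<noteq> b" "c < 5" "d < 5" "c \<noteq> d"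
  shows "fst (r a b) = fst (r c d) \<longleftrightarrow> a = c \<and> b = d \<or> a = d \<and> b = c"
  using r_inj[OF assms] r_neg[OF assms(4-6)] by (auto simp: doubleton_eq_iff)

text \<open>The key is the binary code of a set of points: the empty set for \<open>u\<close>, a
  singleton for \<open>s\<close>, and the pair {a, b} for \<open>r a b\<close>.\<close>

lemma row_key:
  assumes s: "row s" and z: "z = u \<and> k = 0 \<or> z = s \<and> k = 1 \<or>
      (\<exists>a b. a < 5 \<and> b < 5 \<and> a \<noteq> b \<and> z = r a b \<and> k = 2 ^ a + 2 ^ b)"
    and z': "z' = u \<and> k' = 0 \<or> z' = s \<and> k' = 1 \<or>
      (\<exists>a b. a < 5 \<and> b < 5 \<and> a \<noteq> b \<and> z' = r a b \<and> k' = 2 ^ a + 2 ^ b)"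
    and eq: "fst z = fst z'"
  shows "k = (k' :: nat)"
proof -
  have su: "fst s \<noteq> fst u" and sr: "\<And>a b. a < 5 \<Longrightarrow> b < 5 \<Longrightarrow> a \<noteq> b \<Longrightarrow> fst s \<noteq> fst (r a b)"
    using s by (simp_all add: row_def)
  from z show ?thesis
  proof (elim disjE exE conjE)
    assume "z = u" "k = 0"
    then show ?thesis using z' eq su r_neq_u by metis
  next
    assume "z = s" "k = 1"
    then show ?thesis using z' eq su sr by metis
  next
    fix a b assume ab: "a < 5" "b < 5" "a \<noteq> b" "z = r a b" "k = 2 ^ a + 2 ^ b"
    then obtain c d where cd: "c < 5" "d < 5" "c \<noteq> d" "z' = r c d" "k' = 2 ^ c + 2 ^ d"
      using z' eq r_neq_u[OF ab(1-3)] sr[OF ab(1-3)] by metis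
    then have "{a, b} = {c, d}" using r_inj[OF ab(1-3) cd(1-3)] eq ab by simp
    then show ?thesis using ab cd by (auto simp: doubleton_eq_iff)
  qed
qed

text \<open>The two 5-cycles allowed by \<open>opposite_cases\<close> share a path of two edges with
  \<open>y\<close>, one of them after reversal. They would therefore be \<open>y\<close> up to sign,
  but they disagree with it on another edge.\<close>

lemma pent_square:
  assumes p: "perm5 i j k l m" and y: "cyc y [i, j, k, l, m]"
  shows "cyc (C i j l) [i, j, l, k]"
proof -
  note d = perm5_neq[OF p] and less = perm5_less[OF p]
  have path: "q = y" if "cyc q c" "(a, b) \<in> edges c" "(b, e) \<in> edges c"
    "(a, b) \<in> edges [i, j, k, l, m]" "(b, e) \<in> edges [i, j, k, l, m]" "a < 5" "b < 5" "e < 5" "a \<noteq> b" "b \<noteq> e" "a \<noteq> e"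
    for q c a b e
    using cyc_path[OF that(1-3)] cyc_path[OF y that(4,5)] that by simp
  from p y _ _ _ show ?thesis
  proof (rule opposite_cases)
    show "(i, j) \<in> edges [i, j, k, l, m]" "(j, k) \<in> edges [i, j, k, l, m]" "(k, l) \<in> edges [i, j, k, l, m]" by simp_all
  next
    fix q assume q: "cyc q [i, j, l, k]"
    have "q = C i j l" by (rule cyc_path[OF q]) (use d less in simp_all)
    then show ?thesis using q by simp
  next
    fix q assume q: "cyc q [i, j, l, k, m]"
    have "q = y" by (rule path[OF q, of m i j]) (use d less in simp_all)
    moreover have "B q (r l k) = 1" using cyc_B[OF q] d less by simp
    moreover have "B y (r l k) = -1" using cyc_B[OF y] d less by simp
    ultimately show ?thesis by simp
  next
    fix q assume q: "cyc q [i, j, m, l, k]"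
    have q': "cyc (neg q) [k, l, m, j, i]" by (rule cyc_neg[OF q]) (use d in auto)
    have "neg q = y" by (rule path[OF q', of k l m]) (use d less in simp_all)
    moreover have "B (neg q) (r i j) = -1" using cyc_B[OF q] d less by simp
    moreover have "B y (r i j) = 1" using cyc_B[OF y] d less by simp
    ultimately show ?thesis by simp
  qed
qed

text \<open>The rows are \<open>u\<close>, the ten \<open>r\<close> and one further row
  \<open>s\<close>; the columns are the five \<open>n\<close>, the 5-cycle \<open>Y\<close>, the
  pentagram \<open>Z\<close> and five 4-cycles \<open>Q\<close>. Twelve rows are too few to cover
  \<open>V\<close>.\<close>

lemma pent_result:
  assumes y: "cyc (C 0 1 2) [0, 1, 2, 3, 4]"
  shows "equiv_to (bipartite_signed_graph ico_indices W12_5)"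
proof -
  define Y where "Y = C 0 1 2"
  have Y: "cyc Y [0, 1, 2, 3, 4]" using y by (simp add: Y_def)
  have Yr: "cyc Y [1, 2, 3, 4, 0]" "cyc Y [2, 3, 4, 0, 1]" "cyc Y [3, 4, 0, 1, 2]" "cyc Y [4, 0, 1, 2, 3]"
    by (rule cyc_edges[OF Y], auto)+
  have p: "perm5 0 1 2 3 4" "perm5 1 2 3 4 0" "perm5 2 3 4 0 1" "perm5 3 4 0 1 2" "perm5 4 0 1 2 3"
    by (rule perm5I; simp)+
  define Q where "Q i = [C 0 1 3, C 1 2 4, C 2 3 0, C 3 4 1, C 4 0 2] ! i" for i
  have Q: "cyc (Q 0) [0, 1, 3, 2]" "cyc (Q 1) [1, 2, 4, 3]" "cyc (Q 2) [2, 3, 0, 4]"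
    "cyc (Q 3) [3, 4, 1, 0]" "cyc (Q 4) [4, 0, 2, 1]"
    using pent_square[OF p(1) Y] pent_square[OF p(2) Yr(1)] pent_square[OF p(3) Yr(2)]
      pent_square[OF p(4) Yr(3)] pent_square[OF p(5) Yr(4)] by (simp_all add: Q_def)
  have nQ: "cyc (neg (Q 2)) [4, 0, 3, 2]" "cyc (neg (Q 3)) [0, 1, 4, 3]"
    by (rule cyc_neg[OF Q(3)], auto) (rule cyc_neg[OF Q(4)], auto)
  \<comment> \<open>Any cycle through 0, 2, 4 other than the pentagram shares a path with some
    \<open>Q\<close> and hence equals it up to sign, although that \<open>Q\<close> avoids the edge
    between 0 and 2.\<close>
  define Z where "Z = C 0 2 4"
  have same: "y = z" if "cyc y c" "cyc z c'" "(a, b) \<in> edges c" "(b, e) \<in> edges c"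
    "(a, b) \<in> edges c'" "(b, e) \<in> edges c'" "a < 5" "b < 5" "e < 5" "a \<noteq> b" "b \<noteq> e" "a \<noteq> e" for y z c c' a b e
    using cyc_path[OF that(1,3,4)] cyc_path[OF that(2,5,6)] that by simp
  have Z02: "B Z (r 0 2) = 1" unfolding Z_def using B_C(1)[of 0 2 4] by simp
  have Q02: "B (Q 1) (r 0 2) = 0" "B (Q 2) (r 0 2) = 0" "B (Q 3) (r 0 2) = 0"
    using cyc_B[OF Q(2), of 0 2] cyc_B[OF Q(3), of 0 2] cyc_B[OF Q(4), of 0 2] by simp_all
  have "perm5 0 2 4 1 3" by (rule perm5I) simp_all
  from C_cases[OF this, folded Z_def] have Z: "cyc Z [0, 2, 4, 1, 3]"
  proof cases
    case 1
    have "Z = neg (Q 2)" by (rule same[OF 1 nQ(1), of 2 4 0]) simp_all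
    then show ?thesis using Z02 Q02 by simp
  next
    case 2
    have "Z = Q 3" by (rule same[OF 2 Q(4), of 4 1 0]) simp_all
    then show ?thesis using Z02 Q02 by simp
  next
    case 3
    have "Z = neg (Q 3)" by (rule same[OF 3 nQ(2), of 4 3 0]) simp_all
    then show ?thesis using Z02 Q02 by simp
  next
    case 5
    have "Z = Q 1" by (rule same[OF 5 Q(2), of 2 4 3]) simp_all
    then show ?thesis using Z02 Q02 by simp
  qed
  have p': "perm5 0 1 3 2 4" by (rule perm5I) simp_all
  obtain s where s: "row s" "B s (Q 0) = 1" using row_cyc4[OF p' Q(1)] by metis
  have sY: "B s Y = 0" by (rule row_cyc5[OF s(1) p(1) Y])
  \<comment> \<open>\<open>Y\<close> contributes 0 to the row sum at the edge from i to j. The other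
    two terms therefore cancel, and one of them is a 4-cycle read backwards; so the entry of
    \<open>s\<close> passes from one \<open>Q\<close> to the next.\<close>
  have step: "B s (C i j l) = B s (C l m j)" if p: "perm5 i j k l m" and Y': "cyc Y [i, j, k, l, m]" for i j k l m
  proof -
    note d = perm5_neq[OF p] and less = perm5_less[OF p]
    have "perm5 l m i j k" "cyc Y [l, m, i, j, k]"
      using p cyc_edges[OF Y', of "[l, m, i, j, k]"] unfolding perm5_def by auto
    from pent_square[OF this] have q: "cyc (C l m j) [l, m, j, i]" .
    have q': "cyc (neg (C l m j)) [i, j, m, l]" by (rule cyc_neg[OF q]) (use d in auto)
    have "neg (C l m j) = C i j m" by (rule cyc_path[OF q']) (use d less in simp_all)
    moreover have "Y = C i j k" by (rule cyc_path[OF Y']) (use d less in simp_all)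
    ultimately show ?thesis using row_sum(1)[OF s(1) p] sY by (metis B_neg(2) add.commute add_0 add_eq_0_iff minus_minus)
  qed
  have sQ: "B s (Q 0) = B s (Q 3)" "B s (Q 3) = B s (Q 1)" "B s (Q 1) = B s (Q 4)" "B s (Q 4) = B s (Q 2)"
    using step[OF p(1) Y] step[OF p(4) Yr(3)] step[OF p(2) Yr(1)] step[OF p(5) Yr(4)] by (simp_all add: Q_def)
  \<comment> \<open>Modulo 5, \<open>Up i\<close> is the chord from i - 1 to i + 1 and
    \<open>Lo i\<close> the side from i - 1 to i. The 4-cycle \<open>Q (i + 3)\<close> visits i + 3,
    i + 4, i + 1, i, so it contains the chord of \<open>Up i\<close>; hence the shift by 3.\<close>
  define f where "f z = (case z of
      Inl Infty \<Rightarrow> u | Inl Infty' \<Rightarrow> s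
    | Inl (Up i) \<Rightarrow> r ((i + 4) mod 5) ((i + 1) mod 5) | Inl (Lo i) \<Rightarrow> r ((i + 4) mod 5) i
    | Inr Infty \<Rightarrow> Z | Inr Infty' \<Rightarrow> Y | Inr (Up i) \<Rightarrow> n i | Inr (Lo i) \<Rightarrow> Q ((i + 3) mod 5))" for z
  let ?\<Gamma> = "bipartite_signed_graph ico_indices W12_5"
  let ?I = "pverts (ugraph ?\<Gamma>)"
  have five: "{..<5::nat} = {0, 1, 2, 3, 4}" by auto
  have ico: "ico_indices = {Infty, Infty', Up 0, Up 1, Up 2, Up 3, Up 4, Lo 0, Lo 1, Lo 2, Lo 3, Lo 4}"
    unfolding ico_indices_def five by auto
  have V: "?I = ico_indices <+> ico_indices" by (simp add: bipartite_signed_graph_def)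
  have M: "signed_adj ?\<Gamma> v w = (if v \<in> ?I \<and> w \<in> ?I then bipartite_matrix W12_5 v w else 0)" for v w
    by (simp add: bipartite_signed_graph_def signed_adj_of)
  have edge: "W12_5 i j \<noteq> 0 \<longrightarrow> B (f (Inl i)) (f (Inr j)) = W12_5 i j"
    if "i \<in> ico_indices" "j \<in> ico_indices" for i j
  proof -
    note Bc = cyc_B[OF Y] cyc_B[OF Z] cyc_B[OF Q(1)] cyc_B[OF Q(2)] cyc_B[OF Q(3)] cyc_B[OF Q(4)] cyc_B[OF Q(5)]
    have "\<forall>i\<in>ico_indices. \<forall>j\<in>ico_indices. W12_5 i j \<noteq> 0 \<longrightarrow> B (f (Inl i)) (f (Inr j)) = W12_5 i j"
      unfolding ico using s(2) sQ
      by (simp add: f_def B_u_n B_r_n B_sym[of "r _ _" Y] B_sym[of "r _ _" Z] B_sym[of "r _ _" "Q _"]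
          Bc[unfolded One_nat_def] flip: numeral_2_eq_2)
    then show ?thesis using that by blast
  qed
  have "equiv_to ?\<Gamma> \<or> card V \<le> card {v\<in>?I. isl v}"
  proof (rule recognize_one_side)
    show "finite ?I" "?I \<noteq> {}" unfolding V by (simp_all add: ico)
    show "isl v \<noteq> isl w \<and> B (f v) (f w) = signed_adj ?\<Gamma> v w" if vw: "v \<in> ?I" "w \<in> ?I" "signed_adj ?\<Gamma> v w \<noteq> 0" for v w
      using vw edge B_sym[of "f v" "f w"] unfolding M
      by (cases v; cases w) (auto simp: V mat_transpose_def)
    show "5 \<le> card {w\<in>?I. signed_adj ?\<Gamma> v w \<noteq> 0}" if v: "v \<in> ?I" for v
    proof (cases v)
      case (Inl i)
      then have "{w\<in>?I. signed_adj ?\<Gamma> v w \<noteq> 0} = Inr ` {j\<in>ico_indices. W12_5 i j \<noteq> 0}"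
        using v unfolding M by (auto simp: V)
      moreover have "i \<in> ico_indices" using v Inl by (auto simp: V)
      ultimately show ?thesis using weighing_card[OF weighing_matrix_W12_5, of i] by (simp add: card_image)
    next
      case (Inr i)
      then have "{w\<in>?I. signed_adj ?\<Gamma> v w \<noteq> 0} = Inl ` {j\<in>ico_indices. mat_transpose W12_5 i j \<noteq> 0}"
        using v unfolding M by (auto simp: V)
      moreover have "i \<in> ico_indices" using v Inr by (auto simp: V)
      ultimately show ?thesis
        using weighing_card[OF weighing_matrix_W12_5_transpose, of i] by (simp add: card_image)
    qed
    have sr: "fst (r a b) \<noteq> fst s" "fst s \<noteq> fst (r a b)" "fst (r a b) \<noteq> fst u" "fst u \<noteq> fst (r a b)"
      "fst s \<noteq> fst u" "fst u \<noteq> fst s" if "a < 5" "b < 5" "a \<noteq> b" for a b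
      using s(1) r_neq_u[OF that] that unfolding row_def by metis+
    define key :: "ico \<Rightarrow> nat" where "key i = (case i of Infty \<Rightarrow> 0 | Infty' \<Rightarrow> 1
      | Up i \<Rightarrow> 2 ^ ((i + 4) mod 5) + 2 ^ ((i + 1) mod 5) | Lo i \<Rightarrow> 2 ^ ((i + 4) mod 5) + 2 ^ i)" for i
    have rep: "i = Infty \<and> f (Inl i) = u \<or> i = Infty' \<and> f (Inl i) = s \<or>
        (\<exists>a b. a < 5 \<and> b < 5 \<and> a \<noteq> b \<and> f (Inl i) = r a b \<and> key i = 2 ^ a + 2 ^ b)" if i: "i \<in> ico_indices" for i
    proof (cases i)
      case (Up k)
      then have "(k + 4) mod 5 \<noteq> (k + 1) mod 5" by presburger
      then show ?thesis unfolding Up f_def key_def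
        by (intro disjI2 exI[of _ "(k + 4) mod 5"] exI[of _ "(k + 1) mod 5"]) simp
    next
      case (Lo k)
      then have "k < 5" using i by (auto simp: ico_indices_def)
      moreover from this have "(k + 4) mod 5 \<noteq> k" by presburger
      ultimately show ?thesis unfolding Lo f_def key_def
        by (intro disjI2 exI[of _ "(k + 4) mod 5"] exI[of _ k]) simp
    qed (simp_all add: f_def)
    have "key i = key j" if ij: "i \<in> ico_indices" "j \<in> ico_indices" "fst (f (Inl i)) = fst (f (Inl j))" for i j
      by (rule row_key[OF s(1) _ _ ij(3)]) (use rep[OF ij(1)] rep[OF ij(2)] in \<open>auto simp: key_def\<close>)
    moreover have "inj_on key ico_indices"
      unfolding ico inj_on_def by (simp add: key_def)
    ultimately have "inj_on (\<lambda>i. fst (f (Inl i))) ico_indices"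
      by (meson inj_on_def)
    then have "inj_on (fst \<circ> f) (Inl ` ico_indices)"
      by (intro inj_on_imageI) (simp add: comp_def)
    moreover have "{v\<in>?I. isl v} = Inl ` ico_indices" by (auto simp: V)
    ultimately show "inj_on (fst \<circ> f) {v\<in>?I. isl v}" by simp
    show "v = w" if vw: "v \<in> ?I" "w \<in> ?I" "\<not> isl v" "\<not> isl w"
      "\<forall>z\<in>?I. signed_adj ?\<Gamma> v z \<noteq> 0 \<longrightarrow> signed_adj ?\<Gamma> w z \<noteq> 0" for v w
    proof -
      obtain i j where ij: "v = Inr i" "w = Inr j" "i \<in> ico_indices" "j \<in> ico_indices"
        using vw by (cases v; cases w) (auto simp: V)
      have "\<forall>z\<in>ico_indices. mat_transpose W12_5 i z \<noteq> 0 \<longrightarrow> mat_transpose W12_5 j z \<noteq> 0"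
      proof
        fix z assume z: "z \<in> ico_indices"
        have I: "Inl z \<in> ?I" "Inr i \<in> ?I" "Inr j \<in> ?I" using z ij by (auto simp: V)
        from bspec[OF vw(5) I(1)]
        show "mat_transpose W12_5 i z \<noteq> 0 \<longrightarrow> mat_transpose W12_5 j z \<noteq> 0"
          unfolding ij(1,2) M by (simp add: I)
      qed
      then show ?thesis
        using weighing_distinct[OF weighing_matrix_W12_5_transpose _ ij(3,4)] ij by simp
    qed
  qed
  moreover have "card {v\<in>?I. isl v} < 16"
  proof -
    have "{v\<in>?I. isl v} = Inl ` ico_indices" by (auto simp: V)
    then show ?thesis by (simp add: card_image ico)
  qed
  ultimately show ?thesis using card_V by linarith
qed

end

section \<open>Weighing matrices from products and bipartite graphs\<close>

text \<open>The off-diagonal blocks of the product are the difference of \<open>M\<close> and its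
  transpose; the identity blocks add 1 to the weight.\<close>

lemma weighing_box:
  assumes W: "weighing_matrix I m k M" and sym: "\<And>i j. i \<in> I \<Longrightarrow> j \<in> I \<Longrightarrow> M i j = M j i"
  shows "weighing_matrix (I \<times> UNIV) (2 * m) (Suc k) (box_K2_matrix M)"
  unfolding weighing_matrix_def
proof (intro conjI ballI)
  have fin: "finite I" and v: "\<And>i j. i \<in> I \<Longrightarrow> j \<in> I \<Longrightarrow> M i j \<in> {-1, 0, 1}"
    and orth: "\<And>i j. i \<in> I \<Longrightarrow> j \<in> I \<Longrightarrow> (\<Sum>z\<in>I. M i z * M j z) = (if i = j then int k else 0)"
    using W by (simp_all add: weighing_matrix_def mat_prod_def mat_transpose_def)
  show "finite (I \<times> (UNIV :: bool set))" using fin by simp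
  show "card (I \<times> (UNIV :: bool set)) = 2 * m" using W by (simp add: weighing_matrix_def card_cartesian_product)
  fix x y assume xy: "x \<in> I \<times> (UNIV :: bool set)" "y \<in> I \<times> (UNIV :: bool set)"
  obtain a c b d where e: "x = (a, c)" "y = (b, d)" by fastforce
  have ab: "a \<in> I" "b \<in> I" using xy e by auto
  show "box_K2_matrix M x y \<in> {-1, 0, 1}"
    using v[OF ab] unfolding e by (cases c; cases d) auto
  have split: "(\<Sum>z\<in>I \<times> UNIV. f z) = (\<Sum>z\<in>I. f (z, False) + f (z, True))" for f :: "'a \<times> bool \<Rightarrow> int"
  proof -
    have "(\<Sum>z\<in>I \<times> UNIV. f z) = (\<Sum>z\<in>I. \<Sum>e\<in>UNIV. f (z, e))" by (simp add: sum.cartesian_product)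
    then show ?thesis by (simp add: UNIV_bool add.commute)
  qed
  have d1: "(\<Sum>z\<in>I. g z * (if a = z then 1 else 0)) = g a" "(\<Sum>z\<in>I. g z * (if b = z then 1 else 0)) = g b"
    "(\<Sum>z\<in>I. (if a = z then 1 else 0) * g z) = g a" "(\<Sum>z\<in>I. (if b = z then 1 else 0) * g z) = g b" for g :: "'a \<Rightarrow> int"
    using fin ab by (simp_all add: if_distrib[of "\<lambda>x. _ * x"] if_distrib[of "\<lambda>x. x * _"] cong: if_cong)
  show "mat_prod (I \<times> UNIV) (box_K2_matrix M) (mat_transpose (box_K2_matrix M)) x y = (if x = y then int (Suc k) else 0)"
    unfolding mat_prod_def mat_transpose_def split e
    using orth[OF ab] sym[OF ab] d1
    by (cases c; cases d) (simp_all add: sum.distrib sum_negf sum_subtractf)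
qed

lemma weighing_bipartite:
  assumes W: "weighing_matrix I m k W" and Wt: "weighing_matrix I m k (mat_transpose W)"
  shows "weighing_matrix (I <+> I) (2 * m) k (bipartite_matrix W)"
  unfolding weighing_matrix_def
proof (intro conjI ballI)
  have fin: "finite I" and v: "\<And>i j. i \<in> I \<Longrightarrow> j \<in> I \<Longrightarrow> W i j \<in> {-1, 0, 1}"
    and o1: "\<And>i j. i \<in> I \<Longrightarrow> j \<in> I \<Longrightarrow> (\<Sum>z\<in>I. W i z * W j z) = (if i = j then int k else 0)"
    and o2: "\<And>i j. i \<in> I \<Longrightarrow> j \<in> I \<Longrightarrow> (\<Sum>z\<in>I. W z i * W z j) = (if i = j then int k else 0)"
    using W Wt by (simp_all add: weighing_matrix_def mat_prod_def mat_transpose_def)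
  show "finite (I <+> I)" using fin by simp
  show "card (I <+> I) = 2 * m" using W fin by (simp add: weighing_matrix_def card_Plus)
  fix x y assume xy: "x \<in> I <+> I" "y \<in> I <+> I"
  show "bipartite_matrix W x y \<in> {-1, 0, 1}"
    using xy v by (cases x; cases y) (auto simp: mat_transpose_def)
  have split: "(\<Sum>z\<in>I <+> I. f z) = (\<Sum>z\<in>I. f (Inl z)) + (\<Sum>z\<in>I. f (Inr z))" for f :: "_ \<Rightarrow> int"
    using fin by (simp add: sum.Plus)
  show "mat_prod (I <+> I) (bipartite_matrix W) (mat_transpose (bipartite_matrix W)) x y = (if x = y then int k else 0)"
    unfolding mat_prod_def mat_transpose_def split
    using xy o1 o2 by (cases x; cases y) (auto simp: mat_transpose_def)
qed

lemma weighing_cong: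
  assumes "weighing_matrix I m k M" "\<And>i j. i \<in> I \<Longrightarrow> j \<in> I \<Longrightarrow> M' i j = M i j"
  shows "weighing_matrix I m k M'"
proof -
  have "mat_prod I M' (mat_transpose M') i j = mat_prod I M (mat_transpose M) i j" if "i \<in> I" "j \<in> I" for i j
    unfolding mat_prod_def mat_transpose_def by (rule sum.cong) (use assms(2) that in auto)
  then show ?thesis using assms by (simp add: weighing_matrix_def)
qed

text \<open>For a weighing matrix of odd weight, \<open>weighing_distinct\<close> separates the
  vertices of the second side, and symmetry leaves only the entries in one direction to
  check.\<close>

lemma (in ortho5) recognize_weighing:
  fixes s :: "'b \<Rightarrow> bool"
  assumes W: "weighing_matrix (pverts (ugraph \<Gamma>')) m 5 (signed_adj \<Gamma>')" and ne: "pverts (ugraph \<Gamma>') \<noteq> {}"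
    and sym: "\<And>i j. signed_adj \<Gamma>' i j = signed_adj \<Gamma>' j i"
    and s: "\<And>i j. i \<in> pverts (ugraph \<Gamma>') \<Longrightarrow> j \<in> pverts (ugraph \<Gamma>') \<Longrightarrow> signed_adj \<Gamma>' i j \<noteq> 0 \<Longrightarrow> s i \<noteq> s j"
    and M: "\<And>i j. i \<in> pverts (ugraph \<Gamma>') \<Longrightarrow> j \<in> pverts (ugraph \<Gamma>') \<Longrightarrow> s i \<Longrightarrow> \<not> s j \<Longrightarrow> signed_adj \<Gamma>' i j \<noteq> 0 \<Longrightarrow>
      B (f i) (f j) = signed_adj \<Gamma>' i j"
    and inj: "inj_on (fst \<circ> f) {i\<in>pverts (ugraph \<Gamma>'). s i}"
  shows "equiv_to \<Gamma>' \<or> card V \<le> card {i\<in>pverts (ugraph \<Gamma>'). s i}"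
proof (rule recognize_one_side)
  let ?I = "pverts (ugraph \<Gamma>')"
  show "finite ?I" using W by (simp add: weighing_matrix_def)
  show "?I \<noteq> {}" by (rule ne)
  show "s i \<noteq> s j \<and> B (f i) (f j) = signed_adj \<Gamma>' i j" if ij: "i \<in> ?I" "j \<in> ?I" "signed_adj \<Gamma>' i j \<noteq> 0" for i j
  proof -
    have n: "s i \<noteq> s j" using s ij by blast
    show ?thesis
    proof (cases "s i")
      case True
      then show ?thesis using n M[OF ij(1,2)] ij(3) by simp
    next
      case False
      then have "B (f j) (f i) = signed_adj \<Gamma>' j i" using n M[OF ij(2,1)] ij(3) sym[of i j] by simp
      then show ?thesis using n sym[of i j] B_sym[of "f i" "f j"] by simp
    qed
  qed
  show "5 \<le> card {j\<in>?I. signed_adj \<Gamma>' i j \<noteq> 0}" if "i \<in> ?I" for i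
    using weighing_card[OF W that] by simp
  show "inj_on (fst \<circ> f) {i\<in>?I. s i}" by (rule inj)
  show "i = j" if "i \<in> ?I" "j \<in> ?I" "\<forall>k\<in>?I. signed_adj \<Gamma>' i k \<noteq> 0 \<longrightarrow> signed_adj \<Gamma>' j k \<noteq> 0" for i j
    using weighing_distinct[OF W _ that] by simp
qed

lemma weighing_matrix_W7_4_transpose: "weighing_matrix {..<7} 7 4 (mat_transpose W7_4)"
proof -
  have "{..<7::nat} = {0, 1, 2, 3, 4, 5, 6}" by auto
  then show ?thesis
    by (simp add: weighing_matrix_def mat_prod_def mat_transpose_def W7_4_def)
qed

section \<open>A 4-cycle but no 5-cycle: the matrix \<open>W7_4\<close>\<close>

context nbhd
begin

text \<open>Points are below 5, so 5 and 6 are free as first components to mark \<open>u\<close> and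
  the further rows \<open>S j\<close>; a label (a, b) with a < b stands for
  \<open>r a b\<close>.\<close>

definition row_labels :: "nat \<Rightarrow> (nat \<times> nat) set" where
  "row_labels m = insert (5, 5) ({(a, b). a < b \<and> b < 5} \<union> {(6, j) | j. j < m})"

definition row_at :: "(nat \<Rightarrow> 'a \<times> bool) \<Rightarrow> nat \<times> nat \<Rightarrow> 'a \<times> bool" where
  "row_at S v = (if fst v = 5 then u else if fst v = 6 then S (snd v) else r (fst v) (snd v))"

lemma inj_rows:
  assumes S: "\<And>i. i < m \<Longrightarrow> row (S i)" "\<And>i j. i < m \<Longrightarrow> j < m \<Longrightarrow> fst (S i) = fst (S j) \<Longrightarrow> i = j"
    and lab: "inj_on lab I" "lab ` I \<subseteq> row_labels m"
    and f: "\<And>v. v \<in> I \<Longrightarrow> fst (f v) = fst (row_at S (lab v))"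
  shows "inj_on (fst \<circ> f) I"
proof -
  have "inj_on (fst \<circ> row_at S) (row_labels m)"
  proof (rule inj_onI)
    fix v w assume v: "v \<in> row_labels m" and w: "w \<in> row_labels m" and eq: "(fst \<circ> row_at S) v = (fst \<circ> row_at S) w"
    obtain a b c d where vw: "v = (a, b)" "w = (c, d)" by fastforce
    have v': "a = 5 \<and> b = 5 \<or> a = 6 \<and> b < m \<or> a < b \<and> a < 5 \<and> b < 5"
      and w': "c = 5 \<and> d = 5 \<or> c = 6 \<and> d < m \<or> c < d \<and> c < 5 \<and> d < 5"
      using v w vw by (auto simp: row_labels_def)
    have S': "fst (S i) \<noteq> fst u" "\<And>a b. a < 5 \<Longrightarrow> b < 5 \<Longrightarrow> a \<noteq> b \<Longrightarrow> fst (S i) \<noteq> fst (r a b)" if "i < m" for i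
      using S(1)[OF that] by (auto simp: row_def)
    have eq': "fst (row_at S (a, b)) = fst (row_at S (c, d))" using eq vw by simp
    have u: "fst (row_at S (a, b)) = fst u \<longleftrightarrow> a = 5"
      if "a = 5 \<and> b = 5 \<or> a = 6 \<and> b < m \<or> a < b \<and> a < 5 \<and> b < 5" for a b
      using that S'(1)[of b] r_neq_u[of a b] by (elim disjE conjE) (simp_all add: row_at_def)
    have s: "fst (row_at S (a, b)) = fst (S d) \<longleftrightarrow> a = 6 \<and> b = d"
      if "a = 5 \<and> b = 5 \<or> a = 6 \<and> b < m \<or> a < b \<and> a < 5 \<and> b < 5" "d < m" for a b d
      using that(1) S'(1)[OF that(2)] S'(2)[OF that(2), of a b] S(2)[of b d] that(2)
      by (elim disjE conjE) (auto simp: row_at_def)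
    from w' show "v = w"
    proof (elim disjE conjE)
      assume c: "c = 5" "d = 5"
      then have "a = 5" using eq' u[OF v'] by (simp add: row_at_def)
      then show ?thesis using v' c vw by auto
    next
      assume c: "c = 6" "d < m"
      then show ?thesis using eq' s[OF v' c(2)] vw by (simp add: row_at_def)
    next
      assume c: "c < d" "c < 5" "d < 5"
      have "a \<noteq> 5" using eq' u[OF v'] u[OF w'] c by auto
      moreover have "a \<noteq> 6"
      proof
        assume "a = 6"
        then have "b < m" "fst (row_at S (c, d)) = fst (S b)" using v' eq' by (auto simp: row_at_def)
        then show False using s[OF w', of b] c by simp
      qed
      ultimately have a: "a < b" "a < 5" "b < 5" using v' by auto
      then have "fst (r a b) = fst (r c d)" using eq' c by (simp add: row_at_def)
      then show ?thesis using r_fst_iff[of a b c d] a c vw by auto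
    qed
  qed
  then have "inj_on ((fst \<circ> row_at S) \<circ> lab) I"
    using comp_inj_on[OF lab(1)] inj_on_subset lab(2) by blast
  then show ?thesis
    using f by (simp add: inj_on_def)
qed

definition no_pent :: bool where
  "no_pent \<longleftrightarrow> (\<forall>i j k l m. perm5 i j k l m \<longrightarrow> \<not> cyc (C i j k) [i, j, k, l, m])"

lemma cyc4_rotate: "cyc y [i, j, k, l] \<Longrightarrow> cyc y [j, k, l, i]"
  by (erule cyc_edges) auto

text \<open>Without 5-cycles only the first alternative of \<open>opposite_cases\<close>
  survives.\<close>

lemma square_square:
  assumes p: "perm5 i j k l m" and y: "cyc y [i, j, k, l]"
    and no: no_pent
  shows "cyc (C i j l) [i, j, l, k]"
proof -
  note d = perm5_neq[OF p] and less = perm5_less[OF p]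
  from p y _ _ _ show ?thesis
  proof (rule opposite_cases)
    show "(i, j) \<in> edges [i, j, k, l]" "(j, k) \<in> edges [i, j, k, l]" "(k, l) \<in> edges [i, j, k, l]" by simp_all
  next
    fix q assume q: "cyc q [i, j, l, k]"
    have "q = C i j l" by (rule cyc_path[OF q]) (use d less in simp_all)
    then show ?thesis using q by simp
  next
    fix q assume q: "cyc q [i, j, l, k, m]"
    have "q = C i j l" by (rule cyc_path[OF q]) (use d less in simp_all)
    moreover have "perm5 i j l k m" using p unfolding perm5_def by auto
    ultimately show ?thesis using q no unfolding no_pent_def by metis
  next
    fix q assume q: "cyc q [i, j, m, l, k]"
    have "q = C i j m" by (rule cyc_path[OF q]) (use d less in simp_all)
    moreover have "perm5 i j m l k" using p unfolding perm5_def by auto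
    ultimately show ?thesis using q no unfolding no_pent_def by metis
  qed
qed

text \<open>Rotating a 4-cycle and exchanging its last two points by \<open>square_square\<close>
  generate all orders of the points 0, 1, 2, 3.\<close>

lemma square_all:
  assumes y: "cyc (C 0 1 2) [0, 1, 2, 3]"
    and no: no_pent
    and p: "perm5 i j k l 4"
  shows "cyc (C i j k) [i, j, k, l]"
proof -
  define G where "G i j k l \<longleftrightarrow> perm5 i j k l 4 \<and> cyc (C i j k) [i, j, k, l]" for i j k l
  have rot: "G j k l i" if "G i j k l" for i j k l
  proof -
    have p: "perm5 i j k l 4" and c: "cyc (C i j k) [j, k, l, i]"
      using that cyc4_rotate by (auto simp: G_def)
    have "C i j k = C j k l" by (rule cyc_path[OF c]) (use perm5_neq[OF p] perm5_less[OF p] in simp_all)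
    moreover have "perm5 j k l i 4" using p unfolding perm5_def by auto
    ultimately show ?thesis using c by (simp add: G_def)
  qed
  have s34: "G i j l k" if "G i j k l" for i j k l
  proof -
    have "perm5 i j k l 4" "cyc (C i j k) [i, j, k, l]" using that by (simp_all add: G_def)
    moreover have "perm5 i j l k 4" using calculation(1) unfolding perm5_def by auto
    ultimately show ?thesis using square_square[OF _ _ no] by (simp add: G_def)
  qed
  have s12: "G j i k l" if "G i j k l" for i j k l using rot[OF rot[OF s34[OF rot[OF rot[OF that]]]]] .
  have s23: "G i k j l" if "G i j k l" for i j k l using rot[OF s34[OF rot[OF rot[OF rot[OF that]]]]] .
  have "perm5 0 1 2 3 4" by (rule perm5I) simp_all
  then have G0: "G 0 1 2 3" using y by (simp add: G_def)
  \<comment> \<open>The 24 orders, each obtained from an earlier one by an adjacent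
    transposition.\<close>
  note g1 = s12[OF G0]
  note g2 = s23[OF G0]
  note g3 = s34[OF G0]
  note g4 = s23[OF g1]
  note g5 = s34[OF g1]
  note g6 = s12[OF g2]
  note g7 = s34[OF g2]
  note g8 = s23[OF g3]
  note g9 = s12[OF g4]
  note g10 = s34[OF g4]
  note g11 = s23[OF g5]
  note g12 = s34[OF g6]
  note g13 = s23[OF g7]
  note g14 = s12[OF g8]
  note g15 = s34[OF g9]
  note g16 = s23[OF g10]
  note g17 = s12[OF g11]
  note g18 = s23[OF g12]
  note g19 = s12[OF g13]
  note g20 = s23[OF g15]
  note g21 = s12[OF g16]
  note g22 = s12[OF g18]
  note g23 = s12[OF g20]
  have lt: "a = 0 \<or> a = 1 \<or> a = 2 \<or> a = 3" if "a < 5" "a \<noteq> 4" for a :: nat using that by linarith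
  have "i = 0 \<or> i = 1 \<or> i = 2 \<or> i = 3" "j = 0 \<or> j = 1 \<or> j = 2 \<or> j = 3"
    "k = 0 \<or> k = 1 \<or> k = 2 \<or> k = 3" "l = 0 \<or> l = 1 \<or> l = 2 \<or> l = 3"
    using lt perm5_less[OF p] perm5_neq[OF p] by blast+
  moreover have "distinct [i, j, k, l]" using perm5_neq[OF p] by simp
  ultimately have "G i j k l"
    by (elim disjE) (simp_all del: One_nat_def add: G0 g1 g2 g3 g4 g5 g6 g7 g8 g9 g10 g11 g12 g13 g14 g15 g16 g17 g18 g19 g20 g21 g22 g23)
  then show ?thesis by (simp add: G_def)
qed

text \<open>The rows are \<open>u\<close>, ten \<open>r\<close> and three \<open>S\<close>; the
  columns are five \<open>n\<close>, three 4-cycles \<open>Q\<close> and six triangles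
  \<open>T\<close> through 4. The point 4 is the direction of the factor K_2: it joins
  \<open>u\<close> to \<open>n 4\<close>, \<open>n a\<close> to \<open>r a 4\<close>,
  \<open>r a b\<close> to \<open>T a b\<close> and \<open>Q\<close> to \<open>S\<close>. What does
  not involve 4 forms the copy of \<open>W7_4\<close>.\<close>

lemma square_result:
  assumes y: "cyc (C 0 1 2) [0, 1, 2, 3]"
    and no: no_pent
  shows "equiv_to (box_K2 (bipartite_signed_graph {..<7} W7_4))"
proof -
  note all = square_all[OF y no]
  \<comment> \<open>A 4-cycle through i, j, 4, k would give one through i, j, k, 4; but the path i,
    j, k belongs to the 4-cycle avoiding 4.\<close>
  have tri: "cyc (C i j 4) [i, j, 4]" if p: "perm5 i j k l 4" for i j k l
  proof -
    note d = perm5_neq[OF p] and less = perm5_less[OF p]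
    have bad: False if q: "perm5 i j k l 4" and c: "cyc (C i j 4) [i, j, 4, k]" for k l
    proof -
      note d = perm5_neq[OF q] and less = perm5_less[OF q]
      have "perm5 i j 4 k l" using q unfolding perm5_def by auto
      from square_square[OF this c no] have "cyc (C i j k) [i, j, k, 4]" by blast
      then have "B (C i j k) (r k 4) = 1" using cyc_B[of _ _ k 4] d less by simp
      moreover have "B (C i j k) (r k 4) = 0" using cyc_B[OF all[OF q], of k 4] d less by simp
      ultimately show ?thesis by simp
    qed
    have ps: "perm5 i j 4 k l" "perm5 i j 4 l k" "perm5 i j l k 4" using p unfolding perm5_def by auto
    from C_cases[OF ps(1)] show ?thesis
    proof cases
      case 2 then show ?thesis using bad[OF p] by blast
    next
      case 3 then show ?thesis using bad[OF ps(3)] by blast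
    qed (use no ps in \<open>unfold no_pent_def, blast\<close>)+
  qed
  \<comment> \<open>Two 4-cycles on the same points share two disjoint edges, hence two neighbours
    \<open>r\<close>, and \<open>s\<close> would be a third one.\<close>
  have sC0: "B s (C i j l) = 0" if p: "perm5 i j k l 4" and c: "cyc y [i, j, k, l]" and s: "row s" "B s y = 1" for i j k l y s
  proof (rule ccontr)
    note d = perm5_neq[OF p] and less = perm5_less[OF p]
    have p': "perm5 i j l k 4" using p unfolding perm5_def by auto
    have yC: "y = C i j k" by (rule cyc_path[OF c]) (use d less in simp_all)
    have c': "cyc (C i j l) [i, j, l, k]" by (rule all[OF p'])
    assume nz: "B s (C i j l) \<noteq> 0"
    have sr: "fst (r i j) \<noteq> fst s" "fst (r k l) \<noteq> fst s" "fst (r i j) \<noteq> fst (r k l)"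
      using s(1) d less r_fst_iff[of i j k l] unfolding row_def by metis+
    have "B y (r i j) = 1" "B y (r k l) = 1" "B (C i j l) (r i j) = 1" "B (C i j l) (r k l) = -1"
      using cyc_B[OF c, of i j] cyc_B[OF c, of k l] cyc_B[OF c', of i j] cyc_B[OF c', of k l] d less by simp_all
    then have "fst y = fst (C i j l)"
      by (intro no3[of y "r i j" "r k l" s]) (use sr s(2) nz B_sym[of y s] B_sym[of "C i j l" s] in simp_all)
    then show False using C_neq[OF p] yC by simp
  qed
  have sC: "B s (C i j 4) = -1" if p: "perm5 i j k l 4" and c: "cyc y [i, j, k, l]" and s: "row s" "B s y = 1" for i j k l y s
  proof -
    have "y = C i j k" by (rule cyc_path[OF c]) (use perm5_neq[OF p] perm5_less[OF p] in simp_all)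
    then show ?thesis using row_sum(1)[OF s(1) p] s(2) sC0[OF p c s] by simp
  qed
  \<comment> \<open>The three cyclic orders of four points up to direction.\<close>
  define Q where "Q k = [C 0 1 2, C 0 1 3, C 1 2 0] ! k" for k
  have p: "perm5 0 1 2 3 4" "perm5 1 2 3 0 4" "perm5 2 3 0 1 4" "perm5 3 0 1 2 4"
    "perm5 0 1 3 2 4" "perm5 1 3 2 0 4" "perm5 3 2 0 1 4" "perm5 2 0 1 3 4"
    "perm5 1 2 0 3 4" "perm5 2 0 3 1 4" "perm5 0 3 1 2 4" "perm5 3 1 2 0 4"
    "perm5 0 2 1 3 4" "perm5 2 3 1 0 4" "perm5 1 3 0 2 4"
    by (rule perm5I; simp)+
  have Q: "cyc (Q 0) [0, 1, 2, 3]" "cyc (Q 1) [0, 1, 3, 2]" "cyc (Q 2) [1, 2, 0, 3]"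
    using all[OF p(1)] all[OF p(5)] all[OF p(9)] by (simp_all add: Q_def)
  define T where "T i j = C i j 4" for i j
  have T: "cyc (T 0 1) [0, 1, 4]" "cyc (T 0 2) [0, 2, 4]" "cyc (T 0 3) [0, 3, 4]" "cyc (T 1 2) [1, 2, 4]"
    "cyc (T 1 3) [1, 3, 4]" "cyc (T 2 3) [2, 3, 4]"
    using tri[OF p(1)] tri[OF p(13)] tri[OF p(11)] tri[OF p(2)] tri[OF p(15)] tri[OF p(14)] p
    unfolding T_def by blast+
  have Tneg: "T j i = neg (T i j)" if q: "perm5 i j k l 4" for i j k l
  proof -
    note d = perm5_neq[OF q] and less = perm5_less[OF q]
    have "cyc (neg (C i j 4)) [j, i, 4]" by (rule cyc_neg[OF tri[OF q]]) (use d in auto)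
    from cyc_path[OF this, of j i 4] show ?thesis unfolding T_def using d less by simp
  qed
  obtain s0 where s0: "row s0" "B s0 (Q 0) = 1" using row_cyc4[OF p(1) Q(1)] by metis
  obtain s1 where s1: "row s1" "B s1 (Q 1) = 1" using row_cyc4[OF p(5) Q(2)] by metis
  obtain s2 where s2: "row s2" "B s2 (Q 2) = 1" using row_cyc4[OF p(9) Q(3)] by metis
  note r4 = cyc4_rotate
  have sT0: "B s0 (T 0 1) = -1" "B s0 (T 1 2) = -1" "B s0 (T 2 3) = -1" "B s0 (T 3 0) = -1"
    using sC[OF p(1) Q(1) s0] sC[OF p(2) r4[OF Q(1)] s0] sC[OF p(3) r4[OF r4[OF Q(1)]] s0]
      sC[OF p(4) r4[OF r4[OF r4[OF Q(1)]]] s0] by (simp_all add: T_def)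
  have sT1: "B s1 (T 0 1) = -1" "B s1 (T 1 3) = -1" "B s1 (T 3 2) = -1" "B s1 (T 2 0) = -1"
    using sC[OF p(5) Q(2) s1] sC[OF p(6) r4[OF Q(2)] s1] sC[OF p(7) r4[OF r4[OF Q(2)]] s1]
      sC[OF p(8) r4[OF r4[OF r4[OF Q(2)]]] s1] by (simp_all add: T_def)
  have sT2: "B s2 (T 1 2) = -1" "B s2 (T 2 0) = -1" "B s2 (T 0 3) = -1" "B s2 (T 3 1) = -1"
    using sC[OF p(9) Q(3) s2] sC[OF p(10) r4[OF Q(3)] s2] sC[OF p(11) r4[OF r4[OF Q(3)]] s2]
      sC[OF p(12) r4[OF r4[OF r4[OF Q(3)]]] s2] by (simp_all add: T_def)
  have Tn: "T 3 0 = neg (T 0 3)" "T 3 2 = neg (T 2 3)" "T 2 0 = neg (T 0 2)" "T 3 1 = neg (T 1 3)"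
    by (rule Tneg, rule p)+
  define S where "S k = [s0, s1, s2] ! k" for k
  have sT: "B (S 0) (T 0 1) = -1" "B (S 0) (T 1 2) = -1" "B (S 0) (T 2 3) = -1" "B (S 0) (T 0 3) = 1"
    "B (S 1) (T 0 1) = -1" "B (S 1) (T 1 3) = -1" "B (S 1) (T 2 3) = 1" "B (S 1) (T 0 2) = 1"
    "B (S 2) (T 1 2) = -1" "B (S 2) (T 0 2) = 1" "B (S 2) (T 0 3) = -1" "B (S 2) (T 1 3) = 1"
    "B (S 0) (Q 0) = 1" "B (S 1) (Q 1) = 1" "B (S 2) (Q 2) = 1"
    using sT0 sT1 sT2 s0 s1 s2 by (simp_all add: S_def Tn del: One_nat_def)
  let ?F = "bipartite_signed_graph {..<7} W7_4"
  let ?G = "box_K2 ?F"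
  let ?I = "pverts (ugraph ?G)" and ?M = "signed_adj ?G"
  let ?J = "{..<7::nat} <+> {..<7::nat}"
  let ?W = "box_K2_matrix (bipartite_matrix W7_4)"
  have I: "?I = ?J \<times> UNIV" by (simp add: box_K2_def bipartite_signed_graph_def)
  have M: "?M v w = (if v \<in> ?I \<and> w \<in> ?I then ?W v w else 0)" for v w
    by (cases v; cases w; cases "snd v"; cases "snd w")
      (auto simp: box_K2_def bipartite_signed_graph_def signed_adj_of)
  have bsym: "bipartite_matrix W7_4 v w = bipartite_matrix W7_4 w v" for v w
    by (cases v; cases w) (simp_all add: mat_transpose_def)
  have sym: "?M v w = ?M w v" for v w
    unfolding M using bsym by (cases v; cases w; cases "snd v"; cases "snd w") auto
  have W: "weighing_matrix ?I 28 5 ?M"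
  proof (rule weighing_cong)
    show "weighing_matrix ?I 28 5 ?W"
      using weighing_box[OF weighing_bipartite[OF weighing_matrix_W7_4 weighing_matrix_W7_4_transpose] bsym]
      unfolding I by simp
  qed (simp add: M)
  define side where "side v = (isl (fst v) \<noteq> snd v)" for v :: "(nat + nat) \<times> bool"
  define f where "f v = (case v of
      (Inl i, False) \<Rightarrow> [u, r 1 2, r 2 3, r 0 3, neg (r 1 3), r 0 2, r 0 1] ! i
    | (Inl i, True) \<Rightarrow> [n 4, T 1 2, T 2 3, T 0 3, neg (T 1 3), T 0 2, T 0 1] ! i
    | (Inr i, False) \<Rightarrow> [neg (n 0), n 1, n 2, Q 0, n 3, Q 2, neg (Q 1)] ! i
    | (Inr i, True) \<Rightarrow> [r 0 4, neg (r 1 4), neg (r 2 4), S 0, neg (r 3 4), S 2, neg (S 1)] ! i)" for v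
  have seven: "{..<7::nat} = {0, 1, 2, 3, 4, 5, 6}" by auto
  have edge: "\<forall>i\<in>{..<7}. \<forall>j\<in>{..<7}.
      (W7_4 i j \<noteq> 0 \<longrightarrow> B (f (Inl i, False)) (f (Inr j, False)) = W7_4 i j) \<and>
      (W7_4 j i \<noteq> 0 \<longrightarrow> B (f (Inr i, True)) (f (Inl j, True)) = - W7_4 j i) \<and>
      (i = j \<longrightarrow> B (f (Inl i, False)) (f (Inl j, True)) = 1) \<and>
      (i = j \<longrightarrow> B (f (Inr i, True)) (f (Inr j, False)) = 1)"
  proof -
    note Bc = cyc_B[OF Q(1)] cyc_B[OF Q(2)] cyc_B[OF Q(3)] cyc_B[OF T(1)] cyc_B[OF T(2)] cyc_B[OF T(3)]
      cyc_B[OF T(4)] cyc_B[OF T(5)] cyc_B[OF T(6)]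
    show ?thesis
      unfolding seven using sT
      by (simp add: f_def W7_4_def B_u_n B_r_n B_sym[of "r _ _" "T _ _"] B_sym[of "r _ _" "Q _"] Bc[unfolded One_nat_def])
  qed
  define lab :: "(nat + nat) \<times> bool \<Rightarrow> nat \<times> nat" where "lab v = (case v of
      (Inl i, _) \<Rightarrow> [(5, 5), (1, 2), (2, 3), (0, 3), (1, 3), (0, 2), (0, 1)] ! i
    | (Inr i, _) \<Rightarrow> [(0, 4), (1, 4), (2, 4), (6, 0), (3, 4), (6, 2), (6, 1)] ! i)" for v
  have rows: "{v\<in>?I. side v} = {(Inl 0, False), (Inl 1, False), (Inl 2, False), (Inl 3, False), (Inl 4, False),
      (Inl 5, False), (Inl 6, False), (Inr 0, True), (Inr 1, True), (Inr 2, True), (Inr 3, True), (Inr 4, True),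
      (Inr 5, True), (Inr 6, True)}"
  proof -
    have "{v\<in>?I. side v} = (\<lambda>i. (Inr i, True)) ` {..<7} \<union> (\<lambda>i. (Inl i, False)) ` {..<7}"
      unfolding I side_def by (auto simp: isl_def)
    then show ?thesis unfolding seven by simp
  qed
  have S_row: "row (S i)" if "i < 3" for i
    using that s0 s1 s2 less_Suc_eq by (auto simp: S_def numeral_eq_Suc less_Suc_eq)
  have Q2: "C 2 0 3 = Q 2" "C 1 2 0 = Q 2" "C 0 1 3 = Q 1"
    using cyc_path[OF Q(3), of 2 0 3] by (simp_all add: Q_def)
  have "B s0 (Q 1) = 0" "B s0 (Q 2) = 0" "B s1 (Q 2) = 0"
    using sC0[OF p(1) Q(1) s0] sC0[OF p(2) r4[OF Q(1)] s0] sC0[OF p(8) r4[OF r4[OF r4[OF Q(2)]]] s1]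
    unfolding Q2 by blast+
  then have "fst s0 \<noteq> fst s1" "fst s0 \<noteq> fst s2" "fst s1 \<noteq> fst s2"
    using fst_eq_imp[of s0 s1] fst_eq_imp[of s0 s2] fst_eq_imp[of s1 s2] s0(2) s1(2) s2(2) by auto
  then have S_neq: "i = j" if "i < 3" "j < 3" "fst (S i) = fst (S j)" for i j
    using that by (auto simp: S_def numeral_eq_Suc less_Suc_eq)
  have "equiv_to ?G \<or> card V \<le> card {v\<in>?I. side v}"
  proof (rule recognize_weighing[OF W _ sym])
    show "?I \<noteq> {}" by (auto simp: I lessThan_empty_iff)
    show "side v \<noteq> side w" if vw: "v \<in> ?I" "w \<in> ?I" "?M v w \<noteq> 0" for v w
      using vw(3) unfolding M
      by (cases v; cases w; cases "fst v"; cases "fst w"; cases "snd v"; cases "snd w") (auto simp: side_def split: if_splits)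
    show "B (f v) (f w) = ?M v w" if vw: "v \<in> ?I" "w \<in> ?I" "side v" "\<not> side w" "?M v w \<noteq> 0" for v w
      using vw edge unfolding M
      by (cases v; cases w; cases "fst v"; cases "fst w"; cases "snd v"; cases "snd w")
        (auto simp: I side_def mat_transpose_def split: if_splits)
    show "inj_on (fst \<circ> f) {v\<in>?I. side v}"
    proof (rule inj_rows[where S = S and m = 3 and lab = lab])
      show "inj_on lab {v\<in>?I. side v}" unfolding rows by (simp add: lab_def)
      show "lab ` {v\<in>?I. side v} \<subseteq> row_labels 3" unfolding rows by (simp add: lab_def row_labels_def)
      show "fst (f v) = fst (row_at S (lab v))" if "v \<in> {v\<in>?I. side v}" for v
        using that unfolding rows by (elim insertE) (simp_all add: lab_def f_def row_at_def)
    qed (use S_row S_neq in auto)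
  qed
  moreover have "card {v\<in>?I. side v} < 16" unfolding rows by simp
  ultimately show ?thesis using card_V by linarith
qed

end

section \<open>Signed hypercubes as weighing matrices\<close>

text \<open>An edge changing one coordinate has sign -1 exactly if an odd number of
  \<open>True\<close> entries precedes it; this unfolds the iterated \<open>box_K2\<close>.\<close>

fun hypercube_matrix :: "bool list \<Rightarrow> bool list \<Rightarrow> int" where
  "hypercube_matrix (a # x) (b # y) =
     (if a = b then if a then - hypercube_matrix x y else hypercube_matrix x y
      else if x = y then 1 else 0)"
| "hypercube_matrix _ _ = 0"

lemma hypercube_matrix_sym: "hypercube_matrix x y = hypercube_matrix y x"
  by (induction x y rule: hypercube_matrix.induct) auto

lemma Cons_lists: "{b # x | b x. length x = m} = {x. length x = Suc m}"
  by (auto simp: length_Suc_conv)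

lemma signed_hypercube:
  "pverts (ugraph (signed_hypercube m)) = {x. length x = m}"
  "signed_adj (signed_hypercube m) x y = (if length x = m \<and> length y = m then hypercube_matrix x y else 0)"
proof (induction m arbitrary: x y)
  case 0
  {
    case 1 show ?case by auto
  next
    case 2 show ?case by (auto simp: signed_adj_of)
  }
next
  case (Suc m)
  {
    case 1 show ?case using Suc(1) Cons_lists[of m] by simp
  next
    case 2
    have V: "pverts (ugraph (signed_hypercube m)) = {x. length x = m}" by (rule Suc(1))
    have A: "signed_adj (signed_hypercube m) u v = (if length u = m \<and> length v = m then hypercube_matrix u v else 0)" for u v
      by (rule Suc(2))
    have box: "signed_adj (box_K2 (signed_hypercube m)) (u, c) (v, d) = hypercube_matrix (c # u) (d # v)"
      if "length u = m" "length v = m" for u v c d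
      using that unfolding box_K2_def signed_adj_of by (cases c; cases d) (auto simp: V A)
    show ?case
      unfolding signed_hypercube.simps signed_adj_of V mem_Collect_eq
      using box by (cases x; cases y) (auto simp: length_Suc_conv)
  }
qed

lemma weighing_bij:
  assumes W: "weighing_matrix I m k M" and b: "bij_betw g J I" and M': "\<And>i j. i \<in> J \<Longrightarrow> j \<in> J \<Longrightarrow> M' i j = M (g i) (g j)"
  shows "weighing_matrix J m k M'"
  unfolding weighing_matrix_def
proof (intro conjI ballI)
  show "finite J" "card J = m"
    using W b bij_betw_finite bij_betw_same_card by (metis weighing_matrix_def)+
  fix i j assume ij: "i \<in> J" "j \<in> J"
  then have g: "g i \<in> I" "g j \<in> I" using b by (auto simp: bij_betw_def)
  show "M' i j \<in> {-1, 0, 1}" using W g M'[OF ij] by (simp add: weighing_matrix_def)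
  have "(\<Sum>z\<in>J. M' i z * M' j z) = (\<Sum>z\<in>J. M (g i) (g z) * M (g j) (g z))"
    by (rule sum.cong) (use M' ij in auto)
  also have "\<dots> = (\<Sum>z\<in>I. M (g i) z * M (g j) z)" by (rule sum.reindex_bij_betw[OF b])
  also have "\<dots> = (if g i = g j then int k else 0)"
    using W g by (simp add: weighing_matrix_def mat_prod_def mat_transpose_def)
  also have "\<dots> = (if i = j then int k else 0)" using b ij by (auto simp: bij_betw_def inj_on_def)
  finally show "mat_prod J M' (mat_transpose M') i j = (if i = j then int k else 0)"
    by (simp add: mat_prod_def mat_transpose_def)
qed

lemma weighing_hypercube: "weighing_matrix {x. length x = m} (2 ^ m) m hypercube_matrix"
proof (induction m)
  case 0
  have "{x. length x = 0} = {[] :: bool list}" by auto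
  then show ?case by (simp add: weighing_matrix_def mat_prod_def mat_transpose_def)
next
  case (Suc m)
  from weighing_box[OF Suc hypercube_matrix_sym]
  have W: "weighing_matrix ({x. length x = m} \<times> UNIV) (2 ^ Suc m) (Suc m) (box_K2_matrix hypercube_matrix)" by simp
  show ?case
  proof (rule weighing_bij[OF W])
    show "bij_betw (\<lambda>x. (tl x, hd x)) {x. length x = Suc m} ({x. length x = m} \<times> UNIV)"
      by (rule bij_betw_byWitness[where f' = "\<lambda>(x, b). b # x"]) (auto simp: length_Suc_conv)
    fix x y :: "bool list" assume "x \<in> {x. length x = Suc m}" "y \<in> {x. length x = Suc m}"
    then show "hypercube_matrix x y = box_K2_matrix hypercube_matrix (tl x, hd x) (tl y, hd y)"
      by (cases x; cases y; cases "hd x"; cases "hd y") auto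
  qed
qed

fun even_weight :: "bool list \<Rightarrow> bool" where
  "even_weight [] = True"
| "even_weight (b # x) = (even_weight x \<noteq> b)"

lemma hypercube_parity: "hypercube_matrix x y \<noteq> 0 \<Longrightarrow> length x = length y \<Longrightarrow> even_weight x \<noteq> even_weight y"
  by (induction x y rule: hypercube_matrix.induct) (auto split: if_splits)

text \<open>One dimension above \<open>flow_cases\<close>: \<open>ijk\<close> is the value on an
  oriented triangle, the values around each edge sum to 0, and at most two at an edge are nonzero.
  Such a closed surface through two triangles at the edge i j is the boundary of a tetrahedron or
  has at least six triangles.\<close>

lemma tetra_cases:
  fixes ijk ijl ijm ikl ikm ilm jkl jkm jlm klm :: int
  assumes v: "ijk = -1" "ijl = 1"
    and ij: "\<bar>ijk\<bar> + \<bar>ijl\<bar> + \<bar>ijm\<bar> \<le> 2"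
    and ik: "- ijk + ikl + ikm = 0" "\<bar>ijk\<bar> + \<bar>ikl\<bar> + \<bar>ikm\<bar> \<le> 2"
    and il: "- ijl - ikl + ilm = 0"
    and jk: "ijk + jkl + jkm = 0" "\<bar>ijk\<bar> + \<bar>jkl\<bar> + \<bar>jkm\<bar> \<le> 2"
    and jl: "ijl - jkl + jlm = 0"
    and kl: "ikl + jkl + klm = 0"
  shows "ijm = 0 \<and>
    ((ikl = -1 \<and> ikm = 0 \<and> ilm = 0 \<and> jkl = 1 \<and> jkm = 0 \<and> jlm = 0 \<and> klm = 0) \<or>
     (ikl \<noteq> 0 \<and> jkm \<noteq> 0 \<and> jlm \<noteq> 0 \<and> klm \<noteq> 0) \<or>
     (ikm \<noteq> 0 \<and> ilm \<noteq> 0 \<and> jkl \<noteq> 0 \<and> klm \<noteq> 0) \<or>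
     (ikm \<noteq> 0 \<and> ilm \<noteq> 0 \<and> jkm \<noteq> 0 \<and> jlm \<noteq> 0))"
proof -
  have z: "ijm = 0" using ij v by simp
  have "ikl + ikm = -1" "\<bar>ikl\<bar> + \<bar>ikm\<bar> \<le> 1" using ik v by simp_all
  then have a: "ikl = -1 \<and> ikm = 0 \<or> ikl = 0 \<and> ikm = -1" by arith
  have "jkl + jkm = 1" "\<bar>jkl\<bar> + \<bar>jkm\<bar> \<le> 1" using jk v by simp_all
  then have b: "jkl = 1 \<and> jkm = 0 \<or> jkl = 0 \<and> jkm = 1" by arith
  have "ilm = 1 + ikl" "jlm = jkl - 1" "klm = - ikl - jkl" using il jl kl v by simp_all
  with a b z show ?thesis by (elim disjE conjE) simp_all
qed

section \<open>Only triangles: the 5-cube or a quotient\<close>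

context nbhd
begin

definition all_tri :: bool where
  "all_tri \<longleftrightarrow> (\<forall>i j k l m. perm5 i j k l m \<longrightarrow> cyc (C i j k) [i, j, k])"

lemma all_triD: "all_tri \<Longrightarrow> perm5 i j k l m \<Longrightarrow> cyc (C i j k) [i, j, k]"
  unfolding all_tri_def by blast

lemma tri_rotate:
  assumes t: all_tri and p: "perm5 i j k l m"
  shows "C j k i = C i j k" "C k i j = C i j k"
proof -
  note d = perm5_neq[OF p] and less = perm5_less[OF p]
  have c: "cyc (C i j k) [i, j, k]" by (rule all_triD[OF t p])
  show "C j k i = C i j k" "C k i j = C i j k"
    using cyc_path[OF c, of j k i] cyc_path[OF c, of k i j] d less by simp_all
qed

lemma tri_swap:
  assumes t: all_tri and p: "perm5 i j k l m"
  shows "C j i k = neg (C i j k)"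
proof -
  note d = perm5_neq[OF p] and less = perm5_less[OF p]
  have c: "cyc (C i j k) [i, j, k]" by (rule all_triD[OF t p])
  have "cyc (neg (C i j k)) [j, i, k]" by (rule cyc_neg[OF c]) (use d in auto)
  from cyc_path[OF this, of j i k] show ?thesis using d less by simp
qed

lemma tri_perm:
  assumes t: all_tri and p: "perm5 i j k l m"
  shows "C j k i = C i j k" "C k i j = C i j k" "C j i k = neg (C i j k)" "C i k j = neg (C i j k)" "C k j i = neg (C i j k)"
proof -
  have p': "perm5 j k i l m" "perm5 k i j l m" using p unfolding perm5_def by auto
  show "C j k i = C i j k" "C k i j = C i j k" by (rule tri_rotate[OF t p])+
  show "C j i k = neg (C i j k)" by (rule tri_swap[OF t p])
  show "C i k j = neg (C i j k)" "C k j i = neg (C i j k)"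
    using tri_swap[OF t p'(1)] tri_swap[OF t p'(2)] tri_rotate[OF t p] by simp_all
qed

lemma tri_fst:
  assumes t: all_tri and p: "perm5 i j k l m" and q: "perm5 i' j' k' l' m'" and eq: "fst (C i j k) = fst (C i' j' k')"
  shows "{i, j, k} \<subseteq> {i', j', k'}"
proof -
  note d = perm5_neq[OF p] and less = perm5_less[OF p]
  have c: "cyc (C i j k) [i, j, k]" "cyc (C i' j' k') [i', j', k']" by (rule all_triD[OF t p], rule all_triD[OF t q])
  have "a \<in> {i', j', k'} \<and> b \<in> {i', j', k'}" if "(a, b) \<in> edges [i, j, k]" for a b
  proof -
    have ab: "a < 5" "b < 5" "a \<noteq> b" using that d less by auto
    have "B (C i j k) (r a b) \<noteq> 0" using cyc_B[OF c(1) ab] that by simp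
    then have "B (C i' j' k') (r a b) \<noteq> 0"
      using B_fst_cong[OF eq, of "r a b"] B_sym[of "r a b" "C i j k"] B_sym[of "r a b" "C i' j' k'"] by simp
    then show ?thesis using cyc_B[OF c(2) ab] by (auto split: if_splits)
  qed
  from this[of i j] this[of j k] show ?thesis by simp
qed

text \<open>The row is the second common neighbour of the two triangles at the edge from i to j. As
  it has only five neighbours, \<open>tetra_cases\<close> leaves the boundary of the tetrahedron i,
  j, k, l.\<close>

lemma tetra:
  assumes t: all_tri and p: "perm5 i j k l m"
  obtains s where "row s" "B s (C j k l) = 1" "B s (C i k l) = -1" "B s (C i j l) = 1" "B s (C i j k) = -1"
    "B s (C i j m) = 0" "B s (C i k m) = 0" "B s (C i l m) = 0" "B s (C j k m) = 0" "B s (C j l m) = 0" "B s (C k l m) = 0"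
proof -
  note d = perm5_neq[OF p] and less = perm5_less[OF p]
  have p': "perm5 i j l k m" using p unfolding perm5_def by auto
  have c: "cyc (C i j k) [i, j, k]" "cyc (C i j l) [i, j, l]" by (rule all_triD[OF t p], rule all_triD[OF t p'])
  obtain s where s: "B (C i j l) s = 1" "B (C i j k) s = -1"
    using other_common[of "C i j l" "r i j" "C i j k"] B_C(1)[of i j] C_neq[OF p] less d by auto
  have s': "B s (C i j l) = 1" "B s (C i j k) = -1" using s B_sym[of s] by simp_all
  have "row s"
    unfolding row_def
  proof (intro conjI allI impI)
    show "fst s \<noteq> fst u"
      using B_fst_cong[of s u "C i j l"] s cyc_col[OF c(2)] by (auto simp: col_def)
    fix a b :: nat assume ab: "a < 5" "b < 5" "a \<noteq> b"
    show "fst s \<noteq> fst (r a b)"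
    proof
      assume eq: "fst s = fst (r a b)"
      have "B (C i j l) (r a b) \<noteq> 0" "B (C i j k) (r a b) \<noteq> 0"
        using B_fst_cong[OF eq, of "C i j l"] B_fst_cong[OF eq, of "C i j k"] s by simp_all
      then have "(a = i \<and> b = j) \<or> (a = j \<and> b = i)"
        using cyc_B[OF c(1) ab] cyc_B[OF c(2) ab] d by (auto split: if_splits)
      then have "fst s = fst (r i j)" using eq r_neg[of i j] d less by auto
      then have "B (C i j l) s = B (C i j k) s"
        using fst_eq_imp[of s "r i j"] B_C(1)[of i j] d less by auto
      then show False using s by simp
    qed
  qed
  note sum = row_sum[OF this]
  have ps: "perm5 i j k l m" "perm5 i j l k m" "perm5 i j m k l" "perm5 i k l j m" "perm5 i k m j l" "perm5 i l m j k" "perm5 j k l i m" "perm5 j k m i l" "perm5 j l m i k" "perm5 k l m i j"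
    using p unfolding perm5_def by auto
  note tp = tri_perm[OF t ps(1)] tri_perm[OF t ps(2)] tri_perm[OF t ps(3)] tri_perm[OF t ps(4)] tri_perm[OF t ps(5)] tri_perm[OF t ps(6)] tri_perm[OF t ps(7)] tri_perm[OF t ps(8)] tri_perm[OF t ps(9)] tri_perm[OF t ps(10)]
  have qs: "perm5 i j k l m" "perm5 i k j l m" "perm5 i l j k m" "perm5 j k i l m" "perm5 j l i k m" "perm5 k l i j m"
    using p unfolding perm5_def by auto
  note cases = tetra_cases[OF s'(2,1) sum(2)[OF qs(1)] sum(1)[OF qs(2), unfolded tp B_neg] sum(2)[OF qs(2), unfolded tp B_neg abs_minus_cancel]
      sum(1)[OF qs(3), unfolded tp B_neg, folded diff_conv_add_uminus]
      sum(1)[OF qs(4), unfolded tp B_neg] sum(2)[OF qs(4), unfolded tp B_neg abs_minus_cancel]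
      sum(1)[OF qs(5), unfolded tp B_neg, folded diff_conv_add_uminus] sum(1)[OF qs(6), unfolded tp B_neg]]
  let ?T = "{(i, j, k), (i, j, l), (i, j, m), (i, k, l), (i, k, m), (i, l, m), (j, k, l), (j, k, m), (j, l, m), (k, l, m)}"
  let ?C = "\<lambda>(a, b, c). fst (C a b c)"
  have inj: "inj_on ?C ?T"
  proof (rule inj_onI)
    fix v w assume v: "v \<in> ?T" and w: "w \<in> ?T" and eq: "?C v = ?C w"
    obtain a b c a' b' c' where vw: "v = (a, b, c)" "w = (a', b', c')" by (metis prod_cases3)
    have "\<exists>x y. perm5 a b c x y" "\<exists>x y. perm5 a' b' c' x y" using v w ps unfolding vw by auto
    then have "{a, b, c} = {a', b', c'}" using tri_fst[OF t] eq unfolding vw by fastforce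
    then have mem: "x \<in> {a, b, c} \<longleftrightarrow> x \<in> {a', b', c'}" for x by simp
    show "v = w"
      using v w mem[of i] mem[of j] mem[of k] mem[of l] mem[of m] unfolding vw
      by (elim insertE emptyE) (simp_all add: d)
  qed
  \<comment> \<open>Different triangles are different vertices, so six nonzero values would exceed
    the degree.\<close>
  have six: False if "U \<subseteq> ?T" "card U = 6" "\<forall>(a, b, c)\<in>U. B s (C a b c) \<noteq> 0" for U
  proof -
    have "?C ` U \<subseteq> N (fst s)" using that(3) B_N[of s] by auto
    then have "card (?C ` U) \<le> 5" by (rule N_le)
    then show False using card_image[OF inj_on_subset[OF inj that(1)]] that(2) by simp
  qed
  have c6: "card {(i, j, k), (i, j, l), a, b, c, e} = 6"
    if "distinct [(i, j, k), (i, j, l), a, b, c, e]" for a b c e :: "nat \<times> nat \<times> nat"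
    using that distinct_card[OF that] by simp
  have "B s (C i k l) = -1 \<and> B s (C i k m) = 0 \<and> B s (C i l m) = 0 \<and> B s (C j k l) = 1 \<and> B s (C j k m) = 0 \<and>
      B s (C j l m) = 0 \<and> B s (C k l m) = 0"
    using conjunct2[OF cases]
  proof (elim disjE)
    assume "B s (C i k l) \<noteq> 0 \<and> B s (C j k m) \<noteq> 0 \<and> B s (C j l m) \<noteq> 0 \<and> B s (C k l m) \<noteq> 0"
    then show ?thesis
      using six[OF _ c6, of "(i, k, l)" "(j, k, m)" "(j, l, m)" "(k, l, m)"] s' d by simp
  next
    assume "B s (C i k m) \<noteq> 0 \<and> B s (C i l m) \<noteq> 0 \<and> B s (C j k l) \<noteq> 0 \<and> B s (C k l m) \<noteq> 0"
    then show ?thesis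
      using six[OF _ c6, of "(i, k, m)" "(i, l, m)" "(j, k, l)" "(k, l, m)"] s' d by simp
  next
    assume "B s (C i k m) \<noteq> 0 \<and> B s (C i l m) \<noteq> 0 \<and> B s (C j k m) \<noteq> 0 \<and> B s (C j l m) \<noteq> 0"
    then show ?thesis
      using six[OF _ c6, of "(i, k, m)" "(i, l, m)" "(j, k, m)" "(j, l, m)"] s' d by simp
  qed blast
  then show ?thesis using that[OF \<open>row s\<close>] s' conjunct1[OF cases] by blast
qed

end

lemma hypercube_neighbour:
  "hypercube_matrix x y \<noteq> 0 \<Longrightarrow> length x = length y \<Longrightarrow> \<exists>i<length x. y = x[i := \<not> x ! i]"
proof (induction x arbitrary: y)
  case (Cons a x)
  then obtain b z where y: "y = b # z" by (cases y) simp_all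
  show ?case
  proof (cases "a = b")
    case True
    then have "hypercube_matrix x z \<noteq> 0" using Cons.prems(1) y by (cases b) simp_all
    moreover have "length x = length z" using Cons.prems(2) y by simp
    ultimately obtain i where "i < length x" "z = x[i := \<not> x ! i]" using Cons.IH by blast
    then show ?thesis using True y by (intro exI[of _ "Suc i"]) simp
  next
    case False
    then have "x = z" using Cons.prems(1) y by (simp split: if_splits)
    then show ?thesis using False y by (intro exI[of _ 0]) simp
  qed
qed simp

lemma hypercube_neighbour5:
  assumes "hypercube_matrix [a, b, c, d, e] y \<noteq> 0" "length y = 5"
  shows "y = [\<not> a, b, c, d, e] \<or> y = [a, \<not> b, c, d, e] \<or> y = [a, b, \<not> c, d, e] \<or>
    y = [a, b, c, \<not> d, e] \<or> y = [a, b, c, d, \<not> e]"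
proof -
  have "length [a, b, c, d, e] = length y" using assms(2) by simp
  from hypercube_neighbour[OF assms(1) this] obtain i
    where i: "i < length [a, b, c, d, e]" "y = [a, b, c, d, e][i := \<not> [a, b, c, d, e] ! i]" by blast
  then have "i = 0 \<or> i = 1 \<or> i = 2 \<or> i = 3 \<or> i = 4" by auto
  with i(2) show ?thesis by (elim disjE) (simp_all add: numeral_eq_Suc)
qed

context nbhd
begin

text \<open>The 5-cube appears as the lattice of subsets of the points: \<open>u\<close>, the
  \<open>n i\<close>, the \<open>r i j\<close>, the \<open>C i j k\<close>, for each 4-set the row
  missing one point, and a last vertex \<open>z\<close> for the full set. The even sets number 16,
  so here the two sides may really coincide.\<close>

lemma tri_result:
  assumes t: all_tri
  shows "equiv_to (signed_hypercube 5) \<or> card V \<le> 16"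
proof -
  have ps: "perm5 0 1 2 3 4" "perm5 0 1 3 2 4" "perm5 0 1 4 2 3" "perm5 0 2 3 1 4" "perm5 0 2 4 1 3" "perm5 0 3 4 1 2" "perm5 1 2 3 0 4" "perm5 1 2 4 0 3" "perm5 1 3 4 0 2" "perm5 2 3 4 0 1"
    by (rule perm5I; simp)+
  have cC: "cyc (C 0 1 2) [0, 1, 2]" "cyc (C 0 1 3) [0, 1, 3]" "cyc (C 0 1 4) [0, 1, 4]" "cyc (C 0 2 3) [0, 2, 3]" "cyc (C 0 2 4) [0, 2, 4]" "cyc (C 0 3 4) [0, 3, 4]" "cyc (C 1 2 3) [1, 2, 3]" "cyc (C 1 2 4) [1, 2, 4]" "cyc (C 1 3 4) [1, 3, 4]" "cyc (C 2 3 4) [2, 3, 4]"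
    using t ps unfolding all_tri_def by blast+
  have pt: "perm5 1 2 3 4 0" "perm5 0 2 3 4 1" "perm5 0 1 3 4 2" "perm5 0 1 2 4 3" "perm5 0 1 2 3 4"
    by (rule perm5I; simp)+
  obtain s0 where s0: "row s0" "B s0 (C 2 3 4) = 1" "B s0 (C 1 3 4) = -1" "B s0 (C 1 2 4) = 1" "B s0 (C 1 2 3) = -1"
    "B s0 (C 1 2 0) = 0" "B s0 (C 1 3 0) = 0" "B s0 (C 1 4 0) = 0" "B s0 (C 2 3 0) = 0" "B s0 (C 2 4 0) = 0" "B s0 (C 3 4 0) = 0"
    using tetra[OF t pt(1)] .
  obtain s1 where s1: "row s1" "B s1 (C 2 3 4) = 1" "B s1 (C 0 3 4) = -1" "B s1 (C 0 2 4) = 1" "B s1 (C 0 2 3) = -1"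
    "B s1 (C 0 2 1) = 0" "B s1 (C 0 3 1) = 0" "B s1 (C 0 4 1) = 0" "B s1 (C 2 3 1) = 0" "B s1 (C 2 4 1) = 0" "B s1 (C 3 4 1) = 0"
    using tetra[OF t pt(2)] .
  obtain s2 where s2: "row s2" "B s2 (C 1 3 4) = 1" "B s2 (C 0 3 4) = -1" "B s2 (C 0 1 4) = 1" "B s2 (C 0 1 3) = -1"
    "B s2 (C 0 1 2) = 0" "B s2 (C 0 3 2) = 0" "B s2 (C 0 4 2) = 0" "B s2 (C 1 3 2) = 0" "B s2 (C 1 4 2) = 0" "B s2 (C 3 4 2) = 0"
    using tetra[OF t pt(3)] .
  obtain s3 where s3: "row s3" "B s3 (C 1 2 4) = 1" "B s3 (C 0 2 4) = -1" "B s3 (C 0 1 4) = 1" "B s3 (C 0 1 2) = -1"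
    "B s3 (C 0 1 3) = 0" "B s3 (C 0 2 3) = 0" "B s3 (C 0 4 3) = 0" "B s3 (C 1 2 3) = 0" "B s3 (C 1 4 3) = 0" "B s3 (C 2 4 3) = 0"
    using tetra[OF t pt(4)] .
  obtain s4 where s4: "row s4" "B s4 (C 1 2 3) = 1" "B s4 (C 0 2 3) = -1" "B s4 (C 0 1 3) = 1" "B s4 (C 0 1 2) = -1"
    "B s4 (C 0 1 4) = 0" "B s4 (C 0 2 4) = 0" "B s4 (C 0 3 4) = 0" "B s4 (C 1 2 4) = 0" "B s4 (C 1 3 4) = 0" "B s4 (C 2 3 4) = 0"
    using tetra[OF t pt(5)] .
  note tp = tri_perm[OF t ps(1)] tri_perm[OF t ps(2)] tri_perm[OF t ps(3)] tri_perm[OF t ps(4)] tri_perm[OF t ps(5)]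
    tri_perm[OF t ps(6)] tri_perm[OF t ps(7)] tri_perm[OF t ps(8)] tri_perm[OF t ps(9)] tri_perm[OF t ps(10)]
  note sz = s0[unfolded tp B_neg neg_equal_0_iff_equal] s1[unfolded tp B_neg neg_equal_0_iff_equal] s2[unfolded tp B_neg neg_equal_0_iff_equal]
    s3[unfolded tp B_neg neg_equal_0_iff_equal] s4[unfolded tp B_neg neg_equal_0_iff_equal]
  have ne: "fst (C 2 3 4) \<noteq> fst (C 1 3 4)" "fst (C 2 3 4) \<noteq> fst (C 1 2 4)" "fst (C 2 3 4) \<noteq> fst (C 1 2 3)"
    "fst (C 1 3 4) \<noteq> fst (C 1 2 4)" "fst (C 1 3 4) \<noteq> fst (C 1 2 3)" "fst (C 1 2 4) \<noteq> fst (C 1 2 3)"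
    using tri_fst[OF t ps(10) ps(9)] tri_fst[OF t ps(10) ps(8)] tri_fst[OF t ps(10) ps(7)]
      tri_fst[OF t ps(9) ps(8)] tri_fst[OF t ps(9) ps(7)] tri_fst[OF t ps(8) ps(7)] by auto
  have "fst s0 \<in> V" using B_in_V(1)[of s0 "C 2 3 4"] s0 by simp
  then have "\<exists>ys. length ys = 1 \<and> star s0 ([C 2 3 4, neg (C 1 3 4), C 1 2 4, neg (C 1 2 3)] @ ys)"
    using star_extend[of s0 "[C 2 3 4, neg (C 1 3 4), C 1 2 4, neg (C 1 2 3)]"] s0 ne by simp
  then obtain z where st: "star s0 [C 2 3 4, neg (C 1 3 4), C 1 2 4, neg (C 1 2 3), z]"
    by (auto simp: length_Suc_conv)
  \<comment> \<open>Each of the other rows has a single nonzero entry on the four tetrahedron faces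
    of \<open>s0\<close>, so it must be adjacent to \<open>z\<close> with a determined sign.\<close>
  have orth: "B y z = - B y (C 2 3 4) + B y (C 1 3 4) - B y (C 1 2 4) + B y (C 1 2 3)" if "fst y \<noteq> fst s0" for y
    using star_orth[OF st that] by simp
  define S where "S m = [s0, s1, s2, s3, s4] ! m" for m
  have sepr: "fst x \<noteq> fst y" if "B x w = 0" "B y w \<noteq> 0" for x y w
    using that B_fst_cong[of x y w] B_sym[of x w] B_sym[of y w] by auto
  have sd: "fst s0 \<noteq> fst s1" "fst s0 \<noteq> fst s2" "fst s0 \<noteq> fst s3" "fst s0 \<noteq> fst s4" "fst s1 \<noteq> fst s2" "fst s1 \<noteq> fst s3" "fst s1 \<noteq> fst s4" "fst s2 \<noteq> fst s3" "fst s2 \<noteq> fst s4" "fst s3 \<noteq> fst s4"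

  proof -
    show "fst s0 \<noteq> fst s1" by (rule sepr[of _ "C 0 2 3"]) (simp_all add: sz del: One_nat_def)
    show "fst s0 \<noteq> fst s2" by (rule sepr[of _ "C 0 1 3"]) (simp_all add: sz del: One_nat_def)
    show "fst s0 \<noteq> fst s3" by (rule sepr[of _ "C 0 1 2"]) (simp_all add: sz del: One_nat_def)
    show "fst s0 \<noteq> fst s4" by (rule sepr[of _ "C 0 1 2"]) (simp_all add: sz del: One_nat_def)
    show "fst s1 \<noteq> fst s2" by (rule sepr[of _ "C 0 1 3"]) (simp_all add: sz del: One_nat_def)
    show "fst s1 \<noteq> fst s3" by (rule sepr[of _ "C 0 1 2"]) (simp_all add: sz del: One_nat_def)
    show "fst s1 \<noteq> fst s4" by (rule sepr[of _ "C 0 1 2"]) (simp_all add: sz del: One_nat_def)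
    show "fst s2 \<noteq> fst s3" by (rule sepr[of _ "C 0 1 2"]) (simp_all add: sz del: One_nat_def)
    show "fst s2 \<noteq> fst s4" by (rule sepr[of _ "C 0 1 2"]) (simp_all add: sz del: One_nat_def)
    show "fst s3 \<noteq> fst s4" by (rule sepr[of _ "C 0 1 3"]) (simp_all add: sz del: One_nat_def)
  qed
  have Sz: "B s0 z = 1" "B s1 z = -1" "B s2 z = 1" "B s3 z = -1" "B s4 z = 1"
    using st orth[of s1] orth[of s2] orth[of s3] orth[of s4] by (simp_all add: sz sd sd[symmetric] star_def del: One_nat_def)
  have Sb: "B (S 0) z = 1" "B (S 1) z = -1" "B (S 2) z = 1" "B (S 3) z = -1" "B (S 4) z = 1"
    "B (S 0) (C 1 2 3) = -1" "B (S 0) (C 1 2 4) = 1" "B (S 0) (C 1 3 4) = -1" "B (S 0) (C 2 3 4) = 1" "B (S 1) (C 0 2 3) = -1" "B (S 1) (C 0 2 4) = 1" "B (S 1) (C 0 3 4) = -1" "B (S 1) (C 2 3 4) = 1" "B (S 2) (C 0 1 3) = -1" "B (S 2) (C 0 1 4) = 1" "B (S 2) (C 0 3 4) = -1" "B (S 2) (C 1 3 4) = 1" "B (S 3) (C 0 1 2) = -1" "B (S 3) (C 0 1 4) = 1" "B (S 3) (C 0 2 4) = -1" "B (S 3) (C 1 2 4) = 1" "B (S 4) (C 0 1 2) = -1" "B (S 4) (C 0 1 3) = 1" "B (S 4) (C 0 2 3) = -1" "B (S 4) (C 1 2 3) = 1"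
    by (simp_all add: S_def Sz s0 s1 s2 s3 s4 del: One_nat_def)
  have S_row: "row (S m)" if "m < 5" for m
    using less5[OF that] s0(1) s1(1) s2(1) s3(1) s4(1) by (auto simp: S_def)
  have S_neq: "i = j" if "i < 5" "j < 5" "fst (S i) = fst (S j)" for i j
    using less5[OF that(1)] less5[OF that(2)] that(3) sd by (elim disjE) (simp_all add: S_def)
  define idx :: "bool list \<Rightarrow> nat" where "idx x = (\<Sum>i<5. if x ! i then 2 ^ i else 0)" for x
  \<comment> \<open>The subsets in binary order, coordinate i having weight
    \<open>2 ^ i\<close>.\<close>
  define f where "f x = [u, n 0, n 1, r 0 1, n 2, r 0 2, r 1 2, C 0 1 2, n 3, r 0 3, r 1 3, C 0 1 3, r 2 3, C 0 2 3, C 1 2 3, S 4, n 4, r 0 4, r 1 4, C 0 1 4, r 2 4, C 0 2 4, C 1 2 4, S 3, r 3 4, C 0 3 4, C 1 3 4, S 2, C 2 3 4, S 1, S 0, z] ! idx x" for x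
  \<comment> \<open>The entries \<open>(7, 0)\<close> mark the subsets of odd size, that is, the
    columns.\<close>
  define lab :: "bool list \<Rightarrow> nat \<times> nat" where "lab x = [(5, 5), (7, 0), (7, 0), (0, 1), (7, 0), (0, 2), (1, 2), (7, 0), (7, 0), (0, 3), (1, 3), (7, 0), (2, 3), (7, 0), (7, 0), (6, 4), (7, 0), (0, 4), (1, 4), (7, 0), (2, 4), (7, 0), (7, 0), (6, 3), (3, 4), (7, 0), (7, 0), (6, 2), (7, 0), (6, 1), (6, 0), (7, 0)] ! idx x" for x
  have idx: "idx [a, b, c, d, e] = of_bool a + 2 * of_bool b + 4 * of_bool c + 8 * of_bool d + 16 * of_bool e" for a b c d e
    by (simp add: idx_def numeral_eq_Suc)
  have f: "f [False, False, False, False, False] = u" "f [True, False, False, False, False] = n 0" "f [False, True, False, False, False] = n 1" "f [True, True, False, False, False] = r 0 1" "f [False, False, True, False, False] = n 2" "f [True, False, True, False, False] = r 0 2" "f [False, True, True, False, False] = r 1 2" "f [True, True, True, False, False] = C 0 1 2" "f [False, False, False, True, False] = n 3" "f [True, False, False, True, False] = r 0 3" "f [False, True, False, True, False] = r 1 3" "f [True, True, False, True, False] = C 0 1 3" "f [False, False, True, True, False] = r 2 3" "f [True, False, True, True, False] = C 0 2 3" "f [False, True, True, True, False] = C 1 2 3" "f [True, True, True, True, False] = S 4" "f [False, False, False, False, True] = n 4" "f [True, False, False, False, True] = r 0 4" "f [False, True, False, False, True] = r 1 4" "f [True, True, False, False, True] = C 0 1 4" "f [False, False, True, False, True] = r 2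 4" "f [True, False, True, False, True] = C 0 2 4" "f [False, True, True, False, True] = C 1 2 4" "f [True, True, True, False, True] = S 3" "f [False, False, False, True, True] = r 3 4" "f [True, False, False, True, True] = C 0 3 4" "f [False, True, False, True, True] = C 1 3 4" "f [True, True, False, True, True] = S 2" "f [False, False, True, True, True] = C 2 3 4" "f [True, False, True, True, True] = S 1" "f [False, True, True, True, True] = S 0" "f [True, True, True, True, True] = z"
    by (simp_all add: f_def idx)
  let ?G = "signed_hypercube 5"
  let ?I = "pverts (ugraph ?G)" and ?M = "signed_adj ?G"
  have I: "?I = {x. length x = 5}" by (rule signed_hypercube(1))
  have M: "?M x y = (if length x = 5 \<and> length y = 5 then hypercube_matrix x y else 0)" for x y
    by (rule signed_hypercube(2))
  have W: "weighing_matrix ?I (2 ^ 5) 5 ?M"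
    by (rule weighing_cong[OF weighing_hypercube[of 5, folded I]]) (simp add: I M)
  have rows: "{x\<in>?I. even_weight x} = {[False, False, False, False, False], [True, True, False, False, False], [True, False, True, False, False], [False, True, True, False, False], [True, False, False, True, False], [False, True, False, True, False], [False, False, True, True, False], [True, True, True, True, False], [True, False, False, False, True], [False, True, False, False, True], [False, False, True, False, True], [True, True, True, False, True], [False, False, False, True, True], [True, True, False, True, True], [True, False, True, True, True], [False, True, True, True, True]}"
  proof (intro subset_antisym subsetI)
    fix x assume x: "x \<in> {x\<in>?I. even_weight x}"
    then obtain a b c d e where "x = [a, b, c, d, e]" using I list5[of x] by auto
    with x show "x \<in> {[False, False, False, False, False], [True, True, False, False, False], [True, False, True, False, False], [False, True, True, False, False], [True, False, False, True, False], [False, True, False, True, False], [False, False, True, True, False], [True, True, True, True, False], [True, False, False, False, True], [False, True, False, False, True], [False, False, True, False, True], [True, True, True, False, True], [False, False, False, True, True], [True, True, False, True, True], [True, False, True, True, True], [False, True, True, True, True]}"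
      by (cases a; cases b; cases c; cases d; cases e; simp)
  qed (auto simp: I)
  have edge: "B (f x) (f y) = hypercube_matrix x y"
    if x: "x \<in> {[False, False, False, False, False], [True, True, False, False, False], [True, False, True, False, False], [False, True, True, False, False], [True, False, False, True, False], [False, True, False, True, False], [False, False, True, True, False], [True, True, True, True, False], [True, False, False, False, True], [False, True, False, False, True], [False, False, True, False, True], [True, True, True, False, True], [False, False, False, True, True], [True, True, False, True, True], [True, False, True, True, True], [False, True, True, True, True]}" and y: "length y = 5" and nz: "hypercube_matrix x y \<noteq> 0" for x y
  proof -
    note Bc = cyc_B[OF cC(1)] cyc_B[OF cC(2)] cyc_B[OF cC(3)] cyc_B[OF cC(4)] cyc_B[OF cC(5)]
      cyc_B[OF cC(6)] cyc_B[OF cC(7)] cyc_B[OF cC(8)] cyc_B[OF cC(9)] cyc_B[OF cC(10)]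
    have E: "B u (n 0) = 1" "B u (n 1) = 1" "B u (n 2) = 1" "B u (n 3) = 1" "B u (n 4) = 1" "B (r 0 1) (n 1) = 1" "B (r 0 1) (n 0) = -1" "B (C 0 1 2) (r 0 1) = 1" "B (C 0 1 3) (r 0 1) = 1" "B (C 0 1 4) (r 0 1) = 1" "B (r 0 2) (n 2) = 1" "B (C 0 1 2) (r 0 2) = -1" "B (r 0 2) (n 0) = -1" "B (C 0 2 3) (r 0 2) = 1" "B (C 0 2 4) (r 0 2) = 1" "B (C 0 1 2) (r 1 2) = 1" "B (r 1 2) (n 2) = 1" "B (r 1 2) (n 1) = -1" "B (C 1 2 3) (r 1 2) = 1" "B (C 1 2 4) (r 1 2) = 1" "B (r 0 3) (n 3) = 1" "B (C 0 1 3) (r 0 3) = -1" "B (C 0 2 3) (r 0 3) = -1" "B (r 0 3) (n 0) = -1" "B (C 0 3 4) (r 0 3) = 1" "B (C 0 1 3) (r 1 3) = 1" "B (r 1 3) (n 3) = 1" "B (C 1 2 3) (r 1 3) = -1" "B (r 1 3) (n 1) = -1" "B (C 1 3 4) (r 1 3) = 1" "B (C 0 2 3) (r 2 3) = 1" "B (C 1 2 3) (r 2 3) = 1" "B (r 2 3) (n 3) = 1" "B (r 2 3) (n 2) = -1" "B (C 2 3 4) (r 2 3) = 1" "B (S 4) (C 1 2 3) = 1" "B (S 4) (C 0 2 3) = -1" "B (S 4) (C 0 1 3) = 1" "B (S 4) (C 0 1 2) = -1" "B (S 4) z = 1" "B (r 0 4) (n 4) = 1" "B (C 0 1 4) (r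 0 4) = -1" "B (C 0 2 4) (r 0 4) = -1" "B (C 0 3 4) (r 0 4) = -1" "B (r 0 4) (n 0) = -1" "B (C 0 1 4) (r 1 4) = 1" "B (r 1 4) (n 4) = 1" "B (C 1 2 4) (r 1 4) = -1" "B (C 1 3 4) (r 1 4) = -1" "B (r 1 4) (n 1) = -1" "B (C 0 2 4) (r 2 4) = 1" "B (C 1 2 4) (r 2 4) = 1" "B (r 2 4) (n 4) = 1" "B (C 2 3 4) (r 2 4) = -1" "B (r 2 4) (n 2) = -1" "B (S 3) (C 1 2 4) = 1" "B (S 3) (C 0 2 4) = -1" "B (S 3) (C 0 1 4) = 1" "B (S 3) z = -1" "B (S 3) (C 0 1 2) = -1" "B (C 0 3 4) (r 3 4) = 1" "B (C 1 3 4) (r 3 4) = 1" "B (C 2 3 4) (r 3 4) = 1" "B (r 3 4) (n 4) = 1" "B (r 3 4) (n 3) = -1" "B (S 2) (C 1 3 4) = 1" "B (S 2) (C 0 3 4) = -1" "B (S 2) z = 1" "B (S 2) (C 0 1 4) = 1" "B (S 2) (C 0 1 3) = -1" "B (S 1) (C 2 3 4) = 1" "B (S 1) z = -1" "B (S 1) (C 0 3 4) = -1" "B (S 1) (C 0 2 4) = 1" "B (S 1) (C 0 2 3) = -1" "B (S 0) z = 1" "B (S 0) (C 2 3 4) = 1" "B (S 0) (C 1 3 4) = -1" "B (S 0) (C 1 2 4) = 1" "B (S 0) (C 1 2 3) = -1"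
      by (simp_all add: B_u_n B_r_n Bc Sb del: One_nat_def)
    have E': "B p q = v" if "B q p = v" for p q v using that B_sym[of p q] by simp
    have "length x = 5" using x by auto
    from list5[OF this] obtain a b c d e where x5: "x = [a, b, c, d, e]" by (elim exE) blast
    note nb = hypercube_neighbour5[OF nz[unfolded x5] y]
    have "B (f x) (f y) = hypercube_matrix x y \<or> B (f y) (f x) = hypercube_matrix x y"
      using nb x unfolding x5
      by (elim insertE emptyE disjE) (simp_all add: f E del: One_nat_def)
    then show ?thesis using E' by blast
  qed
  have "equiv_to ?G \<or> card V \<le> card {x\<in>?I. even_weight x}"
  proof (rule recognize_weighing[OF W])
    show "?I \<noteq> {}" unfolding I using Ex_list_of_length[of 5] by auto
    show "?M x y = ?M y x" for x y unfolding M using hypercube_matrix_sym[of x y] by simp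
    show "even_weight x \<noteq> even_weight y" if "x \<in> ?I" "y \<in> ?I" "?M x y \<noteq> 0" for x y
      using that hypercube_parity[of x y] unfolding M I by auto
    show "B (f x) (f y) = ?M x y" if xy: "x \<in> ?I" "y \<in> ?I" "even_weight x" "\<not> even_weight y" "?M x y \<noteq> 0" for x y
    proof -
      have "x \<in> {x\<in>?I. even_weight x}" using xy by simp
      then have "B (f x) (f y) = hypercube_matrix x y"
        unfolding rows by (rule edge) (use xy in \<open>simp_all add: M I split: if_splits\<close>)
      then show ?thesis using xy by (simp add: M I)
    qed
    show "inj_on (fst \<circ> f) {x\<in>?I. even_weight x}"
    proof (rule inj_rows[where S = S and m = 5 and lab = lab])
      show "inj_on lab {x\<in>?I. even_weight x}" unfolding rows by (simp add: lab_def idx)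
      show "lab ` {x\<in>?I. even_weight x} \<subseteq> row_labels 5" unfolding rows by (simp add: lab_def idx row_labels_def)
      show "fst (f x) = fst (row_at S (lab x))" if "x \<in> {x\<in>?I. even_weight x}" for x
        using that unfolding rows by (elim insertE) (simp_all add: lab_def f idx row_at_def)
    qed (use S_row S_neq in auto)
  qed
  moreover have "card {x\<in>?I. even_weight x} \<le> 16" unfolding rows by simp
  ultimately show ?thesis by linarith
qed

end

section \<open>At most 16 vertices: the folded cube\<close>

lemma folded_Q4_matrix_eq:
  "folded_Q4_matrix [a, b, c, d] y =
     (if y = [\<not> a, b, c, d] then 1 else 0) + (if y = [a, \<not> b, c, d] then (-1) ^ of_bool a else 0) +
     (if y = [a, b, \<not> c, d] then (-1) ^ (of_bool a + of_bool b) else 0) +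
     (if y = [a, b, c, \<not> d] then (-1) ^ (of_bool a + of_bool b + of_bool c) else 0) +
     (if y = [\<not> a, \<not> b, \<not> c, \<not> d] then (-1) ^ (of_bool a + of_bool c) else 0)"
proof -
  have l4: "{..<4} = {0, 1, 2, 3 :: nat}" and l3: "{..<3} = {0, 1, 2 :: nat}" and l2: "{..<2} = {0, 1 :: nat}" by auto
  show ?thesis by (simp add: folded_Q4_matrix_def l4 l3 l2 numeral_eq_Suc)
qed

lemma list4: "length x = 4 \<Longrightarrow> \<exists>a b c d. x = [a, b, c, d]"
  by (auto simp: numeral_eq_Suc length_Suc_conv)

context nbhd
begin

lemma B_u_r: "i < 5 \<Longrightarrow> j < 5 \<Longrightarrow> i \<noteq> j \<Longrightarrow> B (r i j) u = 0"
  using u_nbr[of "r i j"] r_neq_n[of i j] B_sym[of "r i j" u] by auto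

text \<open>Both are neighbours of \<open>n i\<close>, and \<open>n_nonadjacent\<close> holds with
  every vertex in the role of \<open>u\<close>.\<close>

lemma r_share_nonadjacent:
  assumes p: "perm5 i j k l m"
  shows "B (r j i) (r k i) = 0"
proof -
  interpret L: nbhd V A "n i" "\<lambda>a. [u, r j i, r k i, r l i, r m i] ! a"
    by unfold_locales (use star_n[OF p] in simp)
  show ?thesis using L.n_nonadjacent[of 1 2] by simp
qed

lemma r_meet:
  assumes "a < 5" "b < 5" "c < 5" "d < 5" "a \<noteq> b" "c \<noteq> d" "a = c \<or> a = d \<or> b = c \<or> b = d"
  shows "B (r a b) (r c d) = 0"
proof -
  have core: "B (r x y) (r x z) = 0" if h: "x < 5" "y < 5" "z < 5" "x \<noteq> y" "x \<noteq> z" for x y z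
  proof (cases "y = z")
    case False
    obtain l m where "perm5 x y z l m" using perm5_ex3[OF h False] .
    from r_share_nonadjacent[OF this] show ?thesis using r_neg[of x y] r_neg[of x z] h by simp
  qed simp
  show ?thesis
    using assms(7) core[of a b d] core[of a b c] core[of b a d] core[of b a c] assms(1-6)
      r_neg[of a b] r_neg[of c d]
    by (elim disjE) auto
qed

text \<open>In the star of \<open>n i\<close>, the vertex \<open>r k l\<close> can only see the two
  \<open>r\<close> that avoid k and l; orthogonality relates these.\<close>

lemma r_rotate:
  assumes p: "perm5 i j k l m"
  shows "B (r k l) (r m i) = B (r k l) (r i j)"
proof -
  note d = perm5_neq[OF p] and less = perm5_less[OF p]
  have "B (r k l) (r k i) = 0" "B (r k l) (r l i) = 0"
    using r_meet d less by simp_all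
  moreover have "B (r k l) u = 0" "fst (r k l) \<noteq> fst (n i)" using B_u_r r_neq_n d less by simp_all
  moreover have "B (r k l) (r j i) = - B (r k l) (r i j)" "B (r k l) (r m i) = B (r k l) (r m i)"
    using B_r_neg[of i j] d less by simp_all
  ultimately show ?thesis using thin_sum(1)[OF star_n[OF p], of "r k l"] by simp
qed

text \<open>With at most 16 vertices, those near \<open>u\<close> are all. The three
  \<open>r\<close> on the points other than k and l are adjacent to \<open>r k l\<close> together or
  not at all, and in the latter case \<open>r k l\<close> would have degree 2.\<close>

lemma r_adjacent:
  assumes "card V \<le> 16" and p: "perm5 i j k l m"
  shows "B (r k l) (r i j) \<noteq> 0"
proof
  assume z: "B (r k l) (r i j) = 0"
  note d = perm5_neq[OF p] and less = perm5_less[OF p]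
  have q: "perm5 j m k l i" "perm5 m i k l j" using p unfolding perm5_def by auto
  have z': "B (r k l) (r m i) = 0" "B (r k l) (r j m) = 0"
    using r_rotate[OF p] r_rotate[OF q(2)] z by simp_all
  have N: "N (fst (r k l)) \<subseteq> {fst (n k), fst (n l)}"
  proof
    fix y assume "y \<in> N (fst (r k l))"
    then have y: "B (r k l) (y, False) \<noteq> 0" by (simp add: B_N)
    then have "y \<in> V" using B_in_V(2)[of "r k l" "(y, False)"] by simp
    moreover have "(fst \<circ> near) ` near_index = V"
      using near_in_V card_image[OF inj_near] card_near_index assms(1)
      by (intro card_seteq finite_V) auto
    ultimately obtain a b where ab: "(a, b) \<in> near_index" "y = fst (near (a, b))" by force
    then have nz: "B (r k l) (near (a, b)) \<noteq> 0"
      using y ab(2) B_fst_cong[of "near (a, b)" "(y, False)" "r k l"] by simp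
    have "B (r k l) (r c e) = 0" if ce: "c < 5" "e < 5" "c \<noteq> e" for c e
    proof (cases "{c, e} \<subseteq> {i, j, m}")
      case True
      then show ?thesis
        using ce z z' r_neg[of i j] r_neg[of j m] r_neg[of m i] d less by auto
    next
      case False
      then have "k = c \<or> k = e \<or> l = c \<or> l = e" using perm5_cases[OF p ce(1)] perm5_cases[OF p ce(2)] by blast
      then show ?thesis using r_meet ce d less by blast
    qed
    then have "a = b \<and> a < 5" using nz ab(1) B_u_r[of k l] d less by (auto simp: near_index_def near_def split: if_splits)
    then show "y \<in> {fst (n k), fst (n l)}" using nz ab(2) B_r_n0[of k l a] d less by (auto simp: near_def)
  qed
  have "fst (r k l) \<in> V" using B_in_V(1)[of "r k l" "n l"] B_r_n(1)[of k l] d less by simp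
  then have "card (N (fst (r k l))) = 5" using A_deg by (simp add: N_def)
  moreover have "card (N (fst (r k l))) \<le> card {fst (n k), fst (n l)}" by (rule card_mono[OF _ N]) simp
  moreover have "card {fst (n k), fst (n l)} \<le> 2" by (simp add: card_insert_if)
  ultimately show False by simp
qed

text \<open>By \<open>r_rotate\<close>, one sign fixes those of all 15 edges among the
  \<open>r\<close>, which form a Petersen graph.\<close>

lemma folded_positive:
  assumes card: "card V \<le> 16" and e: "B (r 0 1) (r 2 3) = 1"
  shows "equiv_to folded_Q4"
proof -
  have rot: "B (r k l) (r j m) = B (r k l) (r i j)" "B (r k l) (r i m) = - B (r k l) (r i j)"
    if p: "perm5 i j k l m" for i j k l m
  proof -
    have "perm5 m i k l j" using p unfolding perm5_def by auto
    moreover have "B (r k l) (r i m) = - B (r k l) (r m i)"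
      by (rule B_r_neg) (use perm5_neq[OF p] perm5_less[OF p] in simp_all)
    ultimately show "B (r k l) (r j m) = B (r k l) (r i j)" "B (r k l) (r i m) = - B (r k l) (r i j)"
      using r_rotate[OF p] r_rotate[of m i k l j] by simp_all
  qed
  have qs: "perm5 2 3 0 1 4" "perm5 1 3 0 2 4" "perm5 1 2 0 3 4" "perm5 1 2 0 4 3" "perm5 0 3 1 2 4" "perm5 0 2 1 3 4" "perm5 0 2 1 4 3" "perm5 0 1 2 3 4" "perm5 0 1 2 4 3" "perm5 0 1 3 4 2"
    by (rule perm5I; simp)+
  note rots = rot[OF qs(1)] rot[OF qs(2)] rot[OF qs(3)] rot[OF qs(4)] rot[OF qs(5)] rot[OF qs(6)] rot[OF qs(7)] rot[OF qs(8)] rot[OF qs(9)] rot[OF qs(10)]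
  have rr: "B (r 0 1) (r 2 3) = 1" "B (r 0 1) (r 2 4) = -1" "B (r 0 1) (r 3 4) = 1" "B (r 0 2) (r 1 3) = -1" "B (r 0 2) (r 1 4) = 1" "B (r 0 2) (r 3 4) = -1" "B (r 0 3) (r 1 2) = 1" "B (r 0 3) (r 1 4) = -1" "B (r 0 3) (r 2 4) = 1" "B (r 0 4) (r 1 2) = -1" "B (r 0 4) (r 1 3) = 1" "B (r 0 4) (r 2 3) = -1" "B (r 1 2) (r 3 4) = 1" "B (r 1 3) (r 2 4) = -1" "B (r 1 4) (r 2 3) = 1"
    using rots e B_sym[of "r 1 2" "r 0 3"] B_sym[of "r 1 2" "r 0 4"] B_sym[of "r 1 3" "r 0 2"] B_sym[of "r 1 3" "r 0 4"] B_sym[of "r 1 4" "r 0 2"] B_sym[of "r 1 4" "r 0 3"] B_sym[of "r 2 3" "r 0 1"] B_sym[of "r 2 3" "r 0 4"] B_sym[of "r 2 3" "r 1 4"] B_sym[of "r 2 4" "r 0 1"] B_sym[of "r 2 4" "r 0 3"] B_sym[of "r 2 4" "r 1 3"] B_sym[of "r 3 4" "r 0 1"] B_sym[of "r 3 4" "r 0 2"] B_sym[of "r 3 4" "r 1 2"]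
    by linarith+
  \<comment> \<open>\<open>n 0\<close>, \<open>n 1\<close>, \<open>n 2\<close>, \<open>n 4\<close>
    sit at the unit vectors and \<open>n 3\<close> at the all-ones vector; each \<open>r a b\<close>
    sits at the sum modulo 2. With the signature of \<open>folded_Q4\<close>, only
    \<open>r 1 3\<close> has to be negated.\<close>
  define f :: "bool list \<Rightarrow> 'a \<times> bool" where
    "f x = [u, n 4, n 2, r 2 4, n 1, r 1 4, r 1 2, r 0 3, n 0, r 0 4, r 0 2, neg (r 1 3), r 0 1, r 2 3, r 3 4, n 3] ! (8 * of_bool (x ! 0) + 4 * of_bool (x ! 1) + 2 * of_bool (x ! 2) + of_bool (x ! 3))" for x
  define lab :: "bool list \<Rightarrow> nat \<times> nat" where
    "lab x = [(5, 5), (4, 4), (2, 2), (2, 4), (1, 1), (1, 4), (1, 2), (0, 3), (0, 0), (0, 4), (0, 2), (1, 3), (0, 1), (2, 3), (3, 4), (3, 3)] ! (8 * of_bool (x ! 0) + 4 * of_bool (x ! 1) + 2 * of_bool (x ! 2) + of_bool (x ! 3))" for x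
  have f: "f [False, False, False, False] = u" "f [False, False, False, True] = n 4" "f [False, False, True, False] = n 2" "f [False, False, True, True] = r 2 4" "f [False, True, False, False] = n 1" "f [False, True, False, True] = r 1 4" "f [False, True, True, False] = r 1 2" "f [False, True, True, True] = r 0 3" "f [True, False, False, False] = n 0" "f [True, False, False, True] = r 0 4" "f [True, False, True, False] = r 0 2" "f [True, False, True, True] = neg (r 1 3)" "f [True, True, False, False] = r 0 1" "f [True, True, False, True] = r 2 3" "f [True, True, True, False] = r 3 4" "f [True, True, True, True] = n 3"
    by (simp_all add: f_def)
  have lab: "lab [False, False, False, False] = (5, 5)" "lab [False, False, False, True] = (4, 4)" "lab [False, False, True, False] = (2, 2)" "lab [False, False, True, True] = (2, 4)" "lab [False, True, False, False] = (1, 1)" "lab [False, True, False, True] = (1, 4)" "lab [False, True, True, False] = (1, 2)" "lab [False, True, True, True] = (0, 3)" "lab [True, False, False, False] = (0, 0)" "lab [True, False, False, True] = (0, 4)" "lab [True, False, True, False] = (0, 2)" "lab [True, False, True, True] = (1, 3)" "lab [True, True, False, False] = (0, 1)" "lab [True, True, False, True] = (2, 3)" "lab [True, True, True, False] = (3, 4)" "lab [True, True, True, True] = (3, 3)"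
    by (simp_all add: lab_def)
  let ?I = "{[False, False, False, False], [False, False, False, True], [False, False, True, False], [False, False, True, True], [False, True, False, False], [False, True, False, True], [False, True, True, False], [False, True, True, True], [True, False, False, False], [True, False, False, True], [True, False, True, False], [True, False, True, True], [True, True, False, False], [True, True, False, True], [True, True, True, False], [True, True, True, True]} :: bool list set"
  have I: "pverts (ugraph folded_Q4) = ?I"
  proof (intro subset_antisym subsetI)
    fix x assume "x \<in> pverts (ugraph folded_Q4)"
    then have "length x = 4" by (simp add: folded_Q4_def)
    then obtain a b c d where "x = [a, b, c, d]" using list4 by blast
    then show "x \<in> ?I" by (cases a; cases b; cases c; cases d) simp_all
  qed (auto simp: folded_Q4_def)
  have M: "signed_adj folded_Q4 x y = (if length x = 4 \<and> length y = 4 then folded_Q4_matrix x y else 0)" for x y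
    unfolding folded_Q4_def signed_adj_of by simp
  show ?thesis
  proof (rule equiv_toI[where f = f])
    show "finite (pverts (ugraph folded_Q4))" "pverts (ugraph folded_Q4) \<noteq> {}" unfolding I by simp_all
    show "inj_on (fst \<circ> f) (pverts (ugraph folded_Q4))"
    proof (rule inj_onI)
      fix x y assume xy: "x \<in> pverts (ugraph folded_Q4)" "y \<in> pverts (ugraph folded_Q4)" "(fst \<circ> f) x = (fst \<circ> f) y"
      have l: "lab z \<in> near_index \<and> (fst \<circ> near) (lab z) = fst (f z)" if "z \<in> ?I" for z
        using that by (elim insertE emptyE) (simp_all add: lab f near_index_def near_def)
      have "lab x = lab y" by (rule inj_onD[OF inj_near]) (use xy l in \<open>simp_all only: I o_apply\<close>)
      have inj: "inj_on lab ?I" by (simp add: lab)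
      show "x = y"
        by (rule inj_onD[OF inj \<open>lab x = lab y\<close>]) (use xy in \<open>simp_all only: I\<close>)
    qed
  next
    fix x assume "x \<in> pverts (ugraph folded_Q4)"
    then have l: "length x = 4" by (simp add: folded_Q4_def)
    then obtain a b c d where x: "x = [a, b, c, d]" using list4 by blast
    let ?N = "{[\<not> a, b, c, d], [a, \<not> b, c, d], [a, b, \<not> c, d], [a, b, c, \<not> d], [\<not> a, \<not> b, \<not> c, \<not> d]}"
    have "?N \<subseteq> {y\<in>pverts (ugraph folded_Q4). signed_adj folded_Q4 x y \<noteq> 0}"
      unfolding x M folded_Q4_matrix_eq by (auto simp: folded_Q4_def)
    moreover have "card ?N = 5" by simp
    ultimately show "5 \<le> card {y\<in>pverts (ugraph folded_Q4). signed_adj folded_Q4 x y \<noteq> 0}"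
      using card_mono[of "{y\<in>pverts (ugraph folded_Q4). signed_adj folded_Q4 x y \<noteq> 0}" ?N] I by simp
  next
    fix x y assume x: "x \<in> pverts (ugraph folded_Q4)" and y: "y \<in> pverts (ugraph folded_Q4)" and nz: "signed_adj folded_Q4 x y \<noteq> 0"
    have "length x = 4" using x by (simp add: folded_Q4_def)
    then obtain a b c d where abcd: "x = [a, b, c, d]" using list4 by blast
    have "folded_Q4_matrix x y \<noteq> 0" using nz unfolding M by (auto split: if_splits)
    then have "y = [\<not> a, b, c, d] \<or> y = [a, \<not> b, c, d] \<or> y = [a, b, \<not> c, d] \<or> y = [a, b, c, \<not> d] \<or> y = [\<not> a, \<not> b, \<not> c, \<not> d]"
      unfolding abcd folded_Q4_matrix_eq by (auto split: if_splits)
    then show "B (f x) (f y) = signed_adj folded_Q4 x y"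
      unfolding abcd M folded_Q4_matrix_eq
      by (elim disjE; cases a; cases b; cases c; cases d)
        (simp_all add: f rr rr[THEN trans[OF B_sym]] B_u_n B_n_u B_r_n B_sym[of "n _" "r _ _"] del: One_nat_def)
  qed
qed

text \<open>Exchanging the points 0 and 1 negates \<open>r 0 1\<close> and keeps
  \<open>r 2 3\<close>, so the sign may be taken to be 1.\<close>

lemma folded_result:
  assumes "card V \<le> 16"
  shows "equiv_to folded_Q4"
proof (cases "B (r 0 1) (r 2 3) = 1")
  case True
  then show ?thesis using folded_positive assms by blast
next
  case False
  have p: "perm5 1 0 2 3 4" "perm5 2 3 0 1 4" by (rule perm5I; simp)+
  interpret L: nbhd V A u "n \<circ> (\<lambda>a. [1, 0, 2, 3, 4] ! a)" by (rule relabel(1)[OF p(1)])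
  have "L.r 0 1 = neg (r 0 1)" "L.r 2 3 = r 2 3" using r_neg[of 0 1] by (simp_all add: L.r_def r_def[symmetric] del: One_nat_def)
  moreover have "B (r 0 1) (r 2 3) = -1"
    using False r_adjacent[OF assms p(2)] B_vals[of "r 0 1" "r 2 3"] by auto
  ultimately show ?thesis using L.folded_positive assms by simp
qed

end

section \<open>Combining the cases over all labellings\<close>

context nbhd
begin

lemma C_relabel:
  assumes p: "perm5 i j k l m" and c: "set c \<subseteq> {..<5}" "distinct c" "take 3 c = [0, 1, 2]"
    and y: "cyc (C i j k) (map (\<lambda>a. [i, j, k, l, m] ! a) c)"
  shows "nbhd.cyc A u (n \<circ> (\<lambda>a. [i, j, k, l, m] ! a)) (nbhd.C A (n \<circ> (\<lambda>a. [i, j, k, l, m] ! a)) 0 1 2) c"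
proof -
  interpret L: nbhd V A u "n \<circ> (\<lambda>a. [i, j, k, l, m] ! a)" by (rule relabel(1)[OF p])
  have cyc: "L.cyc (C i j k) c" by (rule relabel(2)[OF p c(1) y])
  obtain c' where c': "c = [0, 1, 2] @ c'" using c(3) append_take_drop_id[of 3 c] by metis
  have "(0, 1) \<in> edges c" "(1, 2) \<in> edges c" by (simp_all add: edges_def c')
  then have "C i j k = L.C 0 1 2" using L.cyc_path[OF cyc, of 0 1 2] by simp
  then show ?thesis using cyc by simp
qed

lemma pent_relabel:
  assumes "\<not> no_pent"
  shows "\<exists>n'. nbhd V A u n' \<and> nbhd.cyc A u n' (nbhd.C A n' 0 1 2) [0, 1, 2, 3, 4]"
proof -
  obtain i j k l m where p: "perm5 i j k l m" and c: "cyc (C i j k) [i, j, k, l, m]"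
    using assms unfolding no_pent_def by blast
  have "nbhd.cyc A u (n \<circ> (\<lambda>a. [i, j, k, l, m] ! a)) (nbhd.C A (n \<circ> (\<lambda>a. [i, j, k, l, m] ! a)) 0 1 2) [0, 1, 2, 3, 4]"
    by (rule C_relabel[OF p]) (use c in \<open>simp_all add: numeral_eq_Suc\<close>)
  then show ?thesis using relabel(1)[OF p] by blast
qed

text \<open>The split is by labellings of the same neighbourhood: if none starts with a 5-cycle,
  then \<open>no_pent\<close> holds in all of them, and any \<open>C i j k\<close> that is not a
  triangle is a 4-cycle, which a relabelling moves to 0, 1, 2, 3.\<close>

lemma nbhd_result:
  "equiv_to folded_Q4 \<or> equiv_to (bipartite_signed_graph ico_indices W12_5) \<or>
   equiv_to (box_K2 (bipartite_signed_graph {..<7} W7_4)) \<or> equiv_to (signed_hypercube 5)"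
proof (cases "\<exists>n'. nbhd V A u n' \<and> nbhd.cyc A u n' (nbhd.C A n' 0 1 2) [0, 1, 2, 3, 4]")
  case True
  then obtain n' where n': "nbhd V A u n'" "nbhd.cyc A u n' (nbhd.C A n' 0 1 2) [0, 1, 2, 3, 4]" by blast
  then show ?thesis using nbhd.pent_result by blast
next
  case no: False
  show ?thesis
  proof (cases all_tri)
    case True
    then show ?thesis using tri_result folded_result by blast
  next
    case False
    then obtain i j k l m where p: "perm5 i j k l m" and c: "\<not> cyc (C i j k) [i, j, k]"
      unfolding all_tri_def by blast
    have p': "perm5 i j k m l" using p unfolding perm5_def by auto
    have no_pent using pent_relabel no by blast
    then have "\<not> cyc (C i j k) [i, j, k, l, m]" "\<not> cyc (C i j k) [i, j, k, m, l]"
      using p p' unfolding no_pent_def by blast+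
    then have "cyc (C i j k) [i, j, k, l] \<or> cyc (C i j k) [i, j, k, m]" using C_cases[OF p] c by blast
    then obtain l m where p: "perm5 i j k l m" and c: "cyc (C i j k) [i, j, k, l]" using p p' by blast
    interpret L: nbhd V A u "n \<circ> (\<lambda>a. [i, j, k, l, m] ! a)" by (rule relabel(1)[OF p])
    have "L.cyc (L.C 0 1 2) [0, 1, 2, 3]" by (rule C_relabel[OF p]) (use c in \<open>simp_all add: numeral_eq_Suc\<close>)
    moreover have L.no_pent using L.pent_relabel no by blast
    ultimately show ?thesis using L.square_result by blast
  qed
qed

end

context thin
begin

lemma thin_result:
  "equiv_to folded_Q4 \<or> equiv_to (bipartite_signed_graph ico_indices W12_5) \<or>
    equiv_to (box_K2 (bipartite_signed_graph {..<7} W7_4)) \<or> equiv_to (signed_hypercube 5)"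
proof -
  obtain x where "x \<in> V" using V_nonempty by blast
  then obtain xs where st: "star (x, False) xs" using star_exists[of "(x, False)"] by auto
  then obtain a b c d e where xs: "xs = [a, b, c, d, e]" using list5[of xs] by (auto simp: star_def)
  interpret nbhd V A "(x, False)" "\<lambda>i. [a, b, c, d, e] ! i"
    by unfold_locales (use st xs in simp)
  show ?thesis by (rule nbhd_result)
qed

end

section \<open>Back to switching equivalence and \<open>D_graph\<close>\<close>

lemma (in ortho5) equiv_to_switching_equivalent:
  assumes "V = pverts (ugraph \<Gamma>)" "A = signed_adj \<Gamma>" "equiv_to \<Gamma>'"
  shows "switching_equivalent \<Gamma> \<Gamma>'"
proof -
  obtain f where "bij_betw (fst \<circ> f) (pverts (ugraph \<Gamma>')) V"
    "\<forall>i\<in>pverts (ugraph \<Gamma>'). \<forall>j\<in>pverts (ugraph \<Gamma>').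
       signed_adj \<Gamma>' i j = sgnb (snd (f i)) * sgnb (snd (f j)) * A (fst (f i)) (fst (f j))"
    using assms(3) unfolding equiv_to_def B_def by blast
  then show ?thesis
    using finite_V assms(1,2) by (intro switching_equivalentI[of f]) auto
qed

theorem theorem2p4:
  fixes \<Gamma> :: "'a signed_graph" and G :: "'a pair_pre_digraph"
  assumes "signed_graph \<Gamma>"
    and "G = ugraph \<Gamma>"
    and "orthogonal \<Gamma>"
    and "k_regular 5 G"
  shows
    "(edgeless (D_graph G) \<and>
        (switching_equivalent \<Gamma> folded_Q4 \<or>
         switching_equivalent \<Gamma> (bipartite_signed_graph ico_indices W12_5) \<or>
         switching_equivalent \<Gamma> (box_K2 (bipartite_signed_graph {..<7} W7_4)) \<or>
         switching_equivalent \<Gamma> (signed_hypercube 5))) \<or>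
     (has_triangle (D_graph G) \<and>
        (switching_equivalent \<Gamma> (T_plus 3) \<or>
         switching_equivalent \<Gamma> (T_star 3) \<or>
         switching_equivalent \<Gamma> (box_K2 (T 4)) \<or>
         switching_equivalent \<Gamma> (T_plus 4))) \<or>
     (nonempty_matching (D_graph G) \<and>
        ((\<exists>n\<ge>3. n \<noteq> 4 \<and> switching_equivalent \<Gamma> (box_K2 (T n))) \<or>
         (\<exists>n\<ge>5. switching_equivalent \<Gamma> (T_plus n)) \<or>
         (\<exists>n\<ge>4. switching_equivalent \<Gamma> (T_star n))))"
proof -
  interpret ortho5 "pverts G" "signed_adj \<Gamma>"
    using ortho5_signed_adj assms by blast
  have sw: "switching_equivalent \<Gamma> \<Gamma>'" if "equiv_to \<Gamma>'" for \<Gamma>' :: "'b signed_graph"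
    using equiv_to_switching_equivalent that assms(2) by blast
  have D: "(v, w) \<in> parcs (D_graph G) \<longleftrightarrow> D v w" for v w
  proof -
    have adj: "signed_adj \<Gamma> x y \<noteq> 0 \<longleftrightarrow> (x, y) \<in> parcs G" for x y
      using assms(1,2) by (auto simp: signed_graph_def signed_adj_def)
    then have "common_neighbors G v w = N v \<inter> N w"
      using N_in_V(2) by (auto simp: common_neighbors_def N_def)
    then show ?thesis using D_in_V[of v w] D_in_V[of w v] D_sym[of v w] by (auto simp: D_graph_def D_def)
  qed
  have tri: "has_triangle (D_graph G)" if triangle
  proof -
    obtain u v w where h: "D u v" "D v w" "D u w" using \<open>triangle\<close> unfolding triangle_def by blast
    moreover have "u \<noteq> v" "v \<noteq> w" "u \<noteq> w" using h by (simp_all add: D_def)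
    ultimately show ?thesis unfolding has_triangle_def D by blast
  qed
  have mat: "nonempty_matching (D_graph G)" if matching
    unfolding nonempty_matching_def
  proof (intro conjI ballI)
    show "parcs (D_graph G) \<noteq> {}" using that D unfolding matching_def by auto
    fix v
    have arc: "\<exists>w. e = (v, w) \<and> D v w" if "e \<in> out_arcs (with_proj (D_graph G)) v" for e
      using that D by (cases e) auto
    have "e' = e" if "e \<in> out_arcs (with_proj (D_graph G)) v" "e' \<in> out_arcs (with_proj (D_graph G)) v" for e e'
      using arc[OF that(1)] arc[OF that(2)] \<open>matching\<close> unfolding matching_def by blast
    then have "out_arcs (with_proj (D_graph G)) v = {} \<or> (\<exists>e. out_arcs (with_proj (D_graph G)) v = {e})" by blast
    then show "out_degree (with_proj (D_graph G)) v \<le> 1" by (auto simp: out_degree_def)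
  qed
  show ?thesis
  proof (cases "\<exists>u v. D u v")
    case True
    then obtain u v where "D u v" by blast
    from D_result[OF this] show ?thesis
    proof
      assume "triangle \<and> (equiv_to (T_plus 3) \<or> equiv_to (T_star 3) \<or> equiv_to (box_K2 (T 4)) \<or> equiv_to (T_plus 4))"
      then show ?thesis by (blast intro: tri sw)
    next
      assume "matching \<and> ((\<exists>n\<ge>3. n \<noteq> 4 \<and> equiv_to (box_K2 (T n))) \<or> (\<exists>n\<ge>5. equiv_to (T_plus n)) \<or> (\<exists>n\<ge>4. equiv_to (T_star n)))"
      moreover from this have "nonempty_matching (D_graph G)" by (blast intro: mat)
      ultimately have "nonempty_matching (D_graph G) \<and>
        ((\<exists>n\<ge>3. n \<noteq> 4 \<and> switching_equivalent \<Gamma> (box_K2 (T n))) \<or>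
         (\<exists>n\<ge>5. switching_equivalent \<Gamma> (T_plus n)) \<or>
         (\<exists>n\<ge>4. switching_equivalent \<Gamma> (T_star n)))"
        by (blast intro: sw)
      then show ?thesis by (intro disjI2)
    qed
  next
    case False
    then interpret thin "pverts G" "signed_adj \<Gamma>" by unfold_locales blast
    have "edgeless (D_graph G)" using False D unfolding edgeless_def by auto
    then show ?thesis using thin_result by (blast intro: sw)
  qed
qed
end
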